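(* Let $G=S_n$ or $G=A_n$ with $n\ge 5$ and $n\ne 7,11$. Let $\omega(G)$ be the set of orders of elements of $G$ and let $\omega_{2,3}(G)$ be the set of those numbers in $\omega(G)$ not divisible by any prime $p>3$. Then for every $m\in\omega_{2,3}(G)$ with $m\ne 1$, $G$ contains a vanishing element of order $m$.
   Context: An element $g$ of a finite group $G$ is vanishing if $\chi(g)=0$ for some irreducible complex character $\chi$ of $G$. *)

theory Defs
  imports "HOL-Algebra.Sym_Groups" "HOL-Algebra.Multiplicative_Group"
    "Jordan_Normal_Form.VS_Connect"
begin

definition GL_complex :: "nat \<Rightarrow> complex mat monoid" where
  "GL_complex d = units_of (ring_mat TYPE(complex) d ())"

definition mat_trace :: "complex mat \<Rightarrow> complex" where
  "mat_trace A = (\<Sum>i<dim_row A. A $$ (i, i))"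

definition complex_rep :: "('a, 'b) monoid_scheme \<Rightarrow> nat \<Rightarrow> ('a \<Rightarrow> complex mat) \<Rightarrow> bool" where
  "complex_rep G d \<rho> \<longleftrightarrow> \<rho> \<in> hom G (GL_complex d)"

definition invariant_subspace ::
    "('a, 'b) monoid_scheme \<Rightarrow> nat \<Rightarrow> ('a \<Rightarrow> complex mat) \<Rightarrow> complex vec set \<Rightarrow> bool" where
  "invariant_subspace G d \<rho> W \<longleftrightarrow>
     VectorSpace.subspace class_ring W (module_vec TYPE(complex) d) \<and>
     (\<forall>g\<in>carrier G. \<forall>w\<in>W. \<rho> g *\<^sub>v w \<in> W)"

text \<open>The zero-dimensional representation is not irreducible.\<close>

definition irreducible_rep :: "('a, 'b) monoid_scheme \<Rightarrow> nat \<Rightarrow> ('a \<Rightarrow> complex mat) \<Rightarrow> bool" where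
  "irreducible_rep G d \<rho> \<longleftrightarrow>
     complex_rep G d \<rho> \<and> d > 0 \<and>
     (\<forall>W. invariant_subspace G d \<rho> W \<longrightarrow> W = {0\<^sub>v d} \<or> W = carrier_vec d)"

text \<open>Characters are total HOL functions; only their values on \<^term>\<open>carrier G\<close> are constrained.\<close>

definition irreducible_character :: "('a, 'b) monoid_scheme \<Rightarrow> ('a \<Rightarrow> complex) \<Rightarrow> bool" where
  "irreducible_character G \<chi> \<longleftrightarrow>
     (\<exists>d \<rho>. irreducible_rep G d \<rho> \<and> (\<forall>g\<in>carrier G. \<chi> g = mat_trace (\<rho> g)))"

definition vanishing :: "('a, 'b) monoid_scheme \<Rightarrow> 'a \<Rightarrow> bool" where
  "vanishing G g \<longleftrightarrow> g \<in> carrier G \<and> (\<exists>\<chi>. irreducible_character G \<chi> \<and> \<chi> g = 0)"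

definition element_orders :: "('a, 'b) monoid_scheme \<Rightarrow> nat set" where
  "element_orders G = group.ord G ` carrier G"

definition element_orders_23 :: "('a, 'b) monoid_scheme \<Rightarrow> nat set" where
  "element_orders_23 G =
     {m \<in> element_orders G. \<forall>p::nat. Factorial_Ring.prime p \<and> p > 3 \<longrightarrow> \<not> p dvd m}"

end

theory Submission
  imports Defs
begin

text \<open>
Let \<open>Y\<close> be a finite right \<open>G\<close>-set. If the class sum of \<open>g\<close> kills a nonzero function \<open>v\<close> on \<open>Y\<close>, then
its kernel is a nonzero invariant subspace, and the class sum has trace zero on every minimal invariant
subspace of the kernel; hence the character of that irreducible subspace vanishes at \<open>g\<close>. It remains to choose,
for every \<open>m = 2^a 3^b\<close>, a cycle type of order \<open>m\<close> and a vector \<open>v\<close>.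

Two kinds of vectors suffice. On the harmonic functions on \<open>k\<close>-subsets the class sum acts by a
multiple of the number of \<open>g\<close>-stable \<open>k\<close>-subsets minus the number of \<open>g\<close>-stable \<open>(k - 1)\<close>-subsets. For a
polytabloid, antisymmetry along the columns reduces the condition to the vanishing of one signed count of
placements of the boxes; this is used for hooks and, when \<open>m = 2\<close>, for the shapes with columns \<open>3, 2\<close> and
\<open>5, 4, 3, 2\<close>. There the class sum over the alternating group is half of the one over the symmetric group as soon as an odd
permutation commutes with \<open>g\<close>. An element of order \<open>m\<close> forces \<open>n\<close> to be large enough for cycles of lengths \<open>2^a\<close> and
\<open>3^b\<close> (and, in the alternating group, two more points); the remaining points are filled according to their number
modulo 3, 4 or 8.
\<close>

section \<open>Class sums on permutation modules\<close>

text \<open>The class-sum criterion produces some irreducible character without naming it, so one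
  vector serves both the symmetric and the alternating group. The shapes for involutions are
  predicted by the Murnaghan-Nakayama rule: the value at an involution is zero when its number of
  fixed points is smaller than the 2-core of the shape. Columns 3, 2 mean the shape (n - 3, 2, 1),
  whose 2-core for even n is (3, 2, 1), with 6 boxes. The obstacle is n = 3 modulo 4: an even
  involution then has at least three fixed points. The shape (n - 6, 3, 2, 1) has for odd n a 2-core
  of only 3 boxes, which does not exclude this case; columns 5, 4, 3, 2 mean (n - 10, 4, 3, 2, 1),
  whose 2-core for odd n is (5, 4, 3, 2, 1), with 15 boxes. The vanishing is then confirmed by a
  recursion over the ten boxes in positive rows whose coefficients do not involve n, so that one
  evaluation covers all degrees.\<close>

lemma biorth_card_le:
  fixes b c :: "nat \<Rightarrow> 'y \<Rightarrow> complex"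
  assumes Y: "finite Y" and bi: "\<And>i j. i < e \<Longrightarrow> j < e \<Longrightarrow> (\<Sum>y\<in>Y. c i y * b j y) = (if i = j then 1 else 0)"
  shows "e \<le> card Y" 
    and "e = card Y \<Longrightarrow> y \<in> Y \<Longrightarrow> y' \<in> Y \<Longrightarrow> (\<Sum>l<e. b l y * c l y') = (if y = y' then 1 else 0)"
proof -
  obtain f where f: "bij_betw f {..<card Y} Y"
    using ex_bij_betw_nat_finite[OF Y] by (auto simp: atLeast0LessThan)
  \<comment> \<open>The two systems become rectangular matrices with product 1; an inner size above
    \<open>card Y\<close> is filled with zeros.\<close>
  have CB: "mat e n (\<lambda>(i,k). if k < card Y then c i (f k) else 0) * mat n e (\<lambda>(k,j). if k < card Y then b j (f k) else 0) = 1\<^sub>m e"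
    (is "?C * ?B = _") if n: "n \<ge> card Y" for n
  proof (rule eq_matI)
    fix i j assume "i < dim_row (1\<^sub>m e)" "j < dim_col (1\<^sub>m e)"
    then have ij: "i < e" "j < e" by auto
    have "(?C * ?B) $$ (i,j) = (\<Sum>k<n. (if k < card Y then c i (f k) else 0) * (if k < card Y then b j (f k) else 0))"
      using ij by (simp add: scalar_prod_def atLeast0LessThan)
    also have "\<dots> = (\<Sum>k<card Y. c i (f k) * b j (f k))"
      by (rule sum.mono_neutral_cong_right) (use n in auto)
    also have "\<dots> = (\<Sum>y\<in>Y. c i y * b j y)" by (rule sum.reindex_bij_betw[OF f])
    also have "\<dots> = 1\<^sub>m e $$ (i,j)" using ij bi by simp
    finally show "(?C * ?B) $$ (i,j) = 1\<^sub>m e $$ (i,j)" .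
  qed auto
  show le: "e \<le> card Y"
  proof (rule ccontr)
    assume "\<not> e \<le> card Y"
    then have ce: "card Y < e" by simp
    let ?C = "mat e e (\<lambda>(i,k). if k < card Y then c i (f k) else 0)"
    let ?B = "mat e e (\<lambda>(k,j). if k < card Y then b j (f k) else 0)"
    \<comment> \<open>Padded to squares, a right inverse is also a left inverse; but the padded row
      \<open>card Y\<close> of \<open>?B\<close> is zero.\<close>
    have "?B * ?C = 1\<^sub>m e"
      by (rule mat_mult_left_right_inverse[OF _ _ CB]) (use ce in auto)
    then have "(?B * ?C) $$ (card Y, card Y) = 1" using ce by simp
    moreover have "(?B * ?C) $$ (card Y, card Y) = 0"
      using ce by (simp add: scalar_prod_def)
    ultimately show False by simp
  qed
  assume e: "e = card Y" and y: "y \<in> Y" "y' \<in> Y"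
  let ?C = "mat e e (\<lambda>(i,k). if k < card Y then c i (f k) else 0)"
  let ?B = "mat e e (\<lambda>(k,j). if k < card Y then b j (f k) else 0)"
  have BC: "?B * ?C = 1\<^sub>m e"
    by (rule mat_mult_left_right_inverse[OF _ _ CB]) (use e in auto)
  obtain k k' where k: "k < e" "f k = y" "k' < e" "f k' = y'"
    using f y e unfolding bij_betw_def by (metis imageE lessThan_iff)
  have "(\<Sum>l<e. b l y * c l y') = (?B * ?C) $$ (k,k')"
    using k e by (simp add: scalar_prod_def atLeast0LessThan)
  also have "\<dots> = (if k = k' then 1 else 0)" using BC k by simp
  also have "\<dots> = (if y = y' then 1 else 0)"
    using k f e unfolding bij_betw_def by (metis inj_onD lessThan_iff)
  finally show "(\<Sum>l<e. b l y * c l y') = (if y = y' then 1 else 0)" .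
qed

text \<open>A biorthogonal system of greatest length exists because \<open>card Y\<close> bounds the
  length, and maximality makes it span \<open>W\<close> on \<open>Y\<close>. Carrying the coordinate
  functionals along with the basis lets matrix entries and traces be written as finite sums.\<close>

lemma subspace_biorth_basis:
  fixes W :: "('y \<Rightarrow> complex) set"
  assumes Y: "finite Y"
    and add: "\<And>v w. v \<in> W \<Longrightarrow> w \<in> W \<Longrightarrow> (\<lambda>y. v y + w y) \<in> W"
    and scale: "\<And>a v. v \<in> W \<Longrightarrow> (\<lambda>y. a * v y) \<in> W"
  obtains e :: nat and b c :: "nat \<Rightarrow> 'y \<Rightarrow> complex" where "\<And>j. j < e \<Longrightarrow> b j \<in> W"
    "\<And>i j. i < e \<Longrightarrow> j < e \<Longrightarrow> (\<Sum>y\<in>Y. c i y * b j y) = (if i = j then 1 else 0)"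
    "\<And>w. w \<in> W \<Longrightarrow> \<exists>u. \<forall>y\<in>Y. w y = (\<Sum>l<e. u l * b l y)"
proof -
  define P where "P e \<longleftrightarrow> (\<exists>b c. (\<forall>j<e. b j \<in> W) \<and>
      (\<forall>i<e. \<forall>j<e. (\<Sum>y\<in>Y. c i y * b j y) = (if i = j then (1::complex) else 0)))" for e :: nat
  have bound: "e \<le> card Y" if "P e" for e
    using that biorth_card_le(1)[OF Y] unfolding P_def by blast
  have "P 0" unfolding P_def by simp
  then obtain e where e: "P e" and max: "\<And>e'. P e' \<Longrightarrow> e' \<le> e"
    using bound by (metis (no_types, lifting) GreatestI_nat Greatest_le_nat)
  from e obtain b c where bW: "\<And>j. j < e \<Longrightarrow> b j \<in> W"
    and bi: "\<And>i j. i < e \<Longrightarrow> j < e \<Longrightarrow> (\<Sum>y\<in>Y. c i y * b j y) = (if i = j then 1 else 0)"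
    unfolding P_def by blast
  \<comment> \<open>The empty combination is excluded because \<open>W\<close> may be empty.\<close>
  have comb: "(\<lambda>y. \<Sum>l<m. u l * b l y) \<in> W" if "m \<le> e" "0 < m" for m and u :: "nat \<Rightarrow> complex"
    using that
  proof (induction m)
    case (Suc m)
    show ?case
    proof (cases m)
      case 0 then show ?thesis using scale[OF bW[of 0], of "u 0"] Suc.prems by simp
    next
      case (Suc k)
      then have "(\<lambda>y. (\<Sum>l<m. u l * b l y) + u m * b m y) \<in> W"
        using Suc.IH Suc.prems by (intro add scale bW) auto
      then show ?thesis by simp
    qed
  qed simp
  have span: "\<exists>u. \<forall>y\<in>Y. w y = (\<Sum>l<e. u l * b l y)" if w: "w \<in> W" for w
  proof (rule ccontr)
    assume no: "\<not> ?thesis"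
    define u where "u l = (\<Sum>y\<in>Y. c l y * w y)" for l
    \<comment> \<open>A vector outside the span is first corrected so that every \<open>c l\<close>
      kills it.\<close>
    define w' where "w' y = w y + (\<Sum>l<e. (- u l) * b l y)" for y
    have w'W: "w' \<in> W"
    proof (cases "e = 0")
      case True then show ?thesis using w unfolding w'_def by simp
    next
      case False
      then show ?thesis unfolding w'_def by (intro add w comb) auto
    qed
    have cw': "(\<Sum>y\<in>Y. c i y * w' y) = 0" if "i < e" for i
    proof -
      have "(\<Sum>y\<in>Y. c i y * w' y) = u i + (\<Sum>y\<in>Y. \<Sum>l<e. - u l * (c i y * b l y))"
        unfolding w'_def u_def by (simp add: distrib_left sum.distrib sum_distrib_left algebra_simps)
      also have "(\<Sum>y\<in>Y. \<Sum>l<e. - u l * (c i y * b l y)) = (\<Sum>l<e. - u l * (\<Sum>y\<in>Y. c i y * b l y))"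
        by (subst sum.swap) (simp add: sum_distrib_left)
      also have "\<dots> = (\<Sum>l<e. if l = i then - u i else 0)"
        by (rule sum.cong) (use that bi in auto)
      also have "\<dots> = - u i" using that by simp
      finally show ?thesis by simp
    qed
    from no obtain y0 where y0: "y0 \<in> Y" "w' y0 \<noteq> 0"
      unfolding w'_def by (metis (no_types, lifting) add_eq_0_iff mult_minus_left sum.cong sum_negf add.inverse_inverse)
    \<comment> \<open>Evaluation at a point where \<open>w'\<close> is nonzero, normalised and then
      corrected to kill every \<open>b j\<close>; the pair \<open>w'\<close>, \<open>\<psi>\<close>
      lengthens the system.\<close>
    define \<phi> where "\<phi> y = (if y = y0 then 1 / w' y0 else 0)" for y
    define \<psi> where "\<psi> y = \<phi> y - (\<Sum>l<e. (b l y0 / w' y0) * c l y)" for y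
    have phi: "(\<Sum>y\<in>Y. \<phi> y * v y) = v y0 / w' y0" for v
    proof -
      have "(\<Sum>y\<in>Y. \<phi> y * v y) = (\<Sum>y\<in>Y. if y = y0 then v y0 / w' y0 else 0)"
        unfolding \<phi>_def by (rule sum.cong) auto
      then show ?thesis using Y y0 by simp
    qed
    have psi: "(\<Sum>y\<in>Y. \<psi> y * v y) = v y0 / w' y0 - (\<Sum>l<e. (b l y0 / w' y0) * (\<Sum>y\<in>Y. c l y * v y))" for v
    proof -
      have "(\<Sum>y\<in>Y. \<psi> y * v y) = (\<Sum>y\<in>Y. \<phi> y * v y) - (\<Sum>y\<in>Y. \<Sum>l<e. (b l y0 / w' y0) * (c l y * v y))"
        unfolding \<psi>_def by (simp add: left_diff_distrib sum_subtractf sum_distrib_right mult.assoc)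
      also have "(\<Sum>y\<in>Y. \<Sum>l<e. (b l y0 / w' y0) * (c l y * v y)) = (\<Sum>l<e. (b l y0 / w' y0) * (\<Sum>y\<in>Y. c l y * v y))"
        by (subst sum.swap) (simp add: sum_distrib_left)
      finally show ?thesis using phi by simp
    qed
    have psib: "(\<Sum>y\<in>Y. \<psi> y * b j y) = 0" if "j < e" for j
    proof -
      have "(\<Sum>l<e. (b l y0 / w' y0) * (\<Sum>y\<in>Y. c l y * b j y)) = (\<Sum>l<e. if l = j then b j y0 / w' y0 else 0)"
        by (rule sum.cong) (use that bi in auto)
      then show ?thesis using that psi[of "b j"] by simp
    qed
    have psiw: "(\<Sum>y\<in>Y. \<psi> y * w' y) = 1"
      using psi[of w'] cw' y0 by simp
    have "P (Suc e)" unfolding P_def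
    proof (intro exI conjI allI impI)
      show "(b(e := w')) j \<in> W" if "j < Suc e" for j
        using that bW w'W by (cases "j = e") auto
      show "(\<Sum>y\<in>Y. (c(e := \<psi>)) i y * (b(e := w')) j y) = (if i = j then 1 else 0)"
        if "i < Suc e" "j < Suc e" for i j
        using that bi cw' psib psiw by (cases "i = e"; cases "j = e") auto
    qed
    then show False using max by fastforce
  qed
  show thesis by (rule that[of e b c]) (use bW bi span in auto)
qed

text \<open>A nonzero invariant subspace of least dimension in the kernel is irreducible. The
  matrices of all conjugates of \<open>g\<close> sum to zero on it, and the trace of that sum is
  \<open>card (carrier G)\<close> times the character value. The action is a right action so that
  translation of functions is a homomorphism, not an antihomomorphism.\<close>

lemma vanishing_criterion:
  fixes G :: "('a, 'm) monoid_scheme" and act :: "'a \<Rightarrow> 'y \<Rightarrow> 'y" and v :: "'y \<Rightarrow> complex"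
  assumes G: "group G" and fin: "finite (carrier G)" and g: "g \<in> carrier G" and Y: "finite Y"
    and act: "\<And>x y. x \<in> carrier G \<Longrightarrow> y \<in> Y \<Longrightarrow> act x y \<in> Y"
    and act1: "\<And>y. y \<in> Y \<Longrightarrow> act \<one>\<^bsub>G\<^esub> y = y"
    and actm: "\<And>x z y. x \<in> carrier G \<Longrightarrow> z \<in> carrier G \<Longrightarrow> y \<in> Y \<Longrightarrow> act (x \<otimes>\<^bsub>G\<^esub> z) y = act z (act x y)"
    and v0: "y0 \<in> Y" "v y0 \<noteq> 0"
    and kill: "\<And>y. y \<in> Y \<Longrightarrow> (\<Sum>h\<in>carrier G. v (act (h \<otimes>\<^bsub>G\<^esub> g \<otimes>\<^bsub>G\<^esub> inv\<^bsub>G\<^esub> h) y)) = 0"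
  shows "vanishing G g"
proof -
  interpret group G by (rule G)
  \<comment> \<open>Summing over all \<open>h\<close> meets every conjugate equally often, so this
    is a positive multiple of the class sum.\<close>
  let ?cj = "\<lambda>h. h \<otimes>\<^bsub>G\<^esub> g \<otimes>\<^bsub>G\<^esub> inv\<^bsub>G\<^esub> h"
  let ?bi = "\<lambda>e (b :: nat \<Rightarrow> 'y \<Rightarrow> complex) c. \<forall>i<e. \<forall>j<e. (\<Sum>y\<in>Y. c i y * b j y) = (if i = j then 1 else 0)"
  let ?inv = "\<lambda>e (b :: nat \<Rightarrow> 'y \<Rightarrow> complex). \<forall>x\<in>carrier G. \<forall>j<e. \<exists>u. \<forall>y\<in>Y. b j (act x y) = (\<Sum>l<e. u l * b l y)"
  let ?kill = "\<lambda>e (b :: nat \<Rightarrow> 'y \<Rightarrow> complex). \<forall>j<e. \<forall>y\<in>Y. (\<Sum>h\<in>carrier G. b j (act (?cj h) y)) = 0"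
  \<comment> \<open>Some \<open>d\<close>-dimensional invariant subspace lies in the kernel,
    presented by a basis and its dual functionals.\<close>
  define Adm where "Adm d \<longleftrightarrow> 0 < d \<and> (\<exists>b c. ?bi d b c \<and> ?inv d b \<and> ?kill d b)" for d
  have cjc: "?cj h \<in> carrier G" if "h \<in> carrier G" for h using that g by simp
  have "\<exists>d. Adm d"
  proof -
    define W where "W = {w. \<forall>y\<in>Y. (\<Sum>h\<in>carrier G. w (act (?cj h) y)) = (0::complex)}"
    obtain e :: nat and b c where bW: "\<And>j. j < e \<Longrightarrow> b j \<in> W"
      and bi: "\<And>i j. i < e \<Longrightarrow> j < e \<Longrightarrow> (\<Sum>y\<in>Y. c i y * b j y) = (if i = j then 1 else 0)"
      and span: "\<And>w. w \<in> W \<Longrightarrow> \<exists>u. \<forall>y\<in>Y. w y = (\<Sum>l<e. u l * b l y)"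
    proof (rule subspace_biorth_basis[OF Y, of W])
      show "(\<lambda>y. v y + w y) \<in> W" if "v \<in> W" "w \<in> W" for v w
        using that unfolding W_def by (simp add: sum.distrib)
      show "(\<lambda>y. a * v y) \<in> W" if "v \<in> W" for a v
        using that unfolding W_def by (simp add: sum_distrib_left[symmetric])
    qed blast
    have "e \<noteq> 0"
    proof
      assume "e = 0"
      moreover have "v \<in> W" using kill unfolding W_def by simp
      ultimately show False using span[of v] v0 by auto
    qed
    moreover have "?inv e b"
    proof (intro ballI allI impI)
      fix x j assume x: "x \<in> carrier G" and j: "j < e"
      have "(\<lambda>y. b j (act x y)) \<in> W" unfolding W_def
      proof (intro CollectI ballI)
        fix y assume y: "y \<in> Y"
        \<comment> \<open>Shifting \<open>h\<close> by \<open>x\<close> moves \<open>x\<close>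
          across the conjugate, so translation preserves the kernel.\<close>
        have "(\<Sum>h\<in>carrier G. b j (act x (act (?cj h) y))) = (\<Sum>h\<in>carrier G. b j (act (?cj h) (act x y)))"
        proof (rule sum.reindex_bij_witness[of _ "\<lambda>h. x \<otimes>\<^bsub>G\<^esub> h" "\<lambda>h. inv\<^bsub>G\<^esub> x \<otimes>\<^bsub>G\<^esub> h"])
          fix h assume h: "h \<in> carrier G"
          have "x \<otimes>\<^bsub>G\<^esub> ?cj (inv\<^bsub>G\<^esub> x \<otimes>\<^bsub>G\<^esub> h) = ?cj h \<otimes>\<^bsub>G\<^esub> x"
            using x h g by (simp add: inv_mult_group m_assoc[symmetric])
          then show "b j (act (?cj (inv\<^bsub>G\<^esub> x \<otimes>\<^bsub>G\<^esub> h)) (act x y)) = b j (act x (act (?cj h) y))"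
            using actm[OF x cjc y, of "inv\<^bsub>G\<^esub> x \<otimes>\<^bsub>G\<^esub> h"] actm[OF cjc[OF h] x y] x h by simp
        qed (use x in \<open>auto simp: m_assoc[symmetric]\<close>)
        also have "\<dots> = 0" using bW[OF j] act[OF x y] unfolding W_def by simp
        finally show "(\<Sum>h\<in>carrier G. b j (act x (act (?cj h) y))) = 0" .
      qed
      then show "\<exists>u. \<forall>y\<in>Y. b j (act x y) = (\<Sum>l<e. u l * b l y)" by (rule span)
    qed
    moreover have "?kill e b" using bW unfolding W_def by simp
    ultimately show ?thesis using bi unfolding Adm_def by blast
  qed
  then obtain d where d: "Adm d" and min: "\<And>e. Adm e \<Longrightarrow> d \<le> e"
    by (metis LeastI Least_le)
  from d obtain b c where d0: "0 < d" and bi: "?bi d b c" and inv: "?inv d b" and kil: "?kill d b"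
    unfolding Adm_def by blast
  define \<rho> where "\<rho> x = mat d d (\<lambda>(i,j). \<Sum>y\<in>Y. c i y * b j (act x y))" for x
  have \<rho>c [simp]: "\<rho> x \<in> carrier_mat d d" "dim_row (\<rho> x) = d" "dim_col (\<rho> x) = d" for x unfolding \<rho>_def by auto
  have coef: "(\<Sum>y\<in>Y. c i y * (\<Sum>l<d. u l * b l y)) = u i" if "i < d" for i u
  proof -
    have "(\<Sum>y\<in>Y. c i y * (\<Sum>l<d. u l * b l y)) = (\<Sum>l<d. u l * (\<Sum>y\<in>Y. c i y * b l y))"
      by (simp add: sum_distrib_left mult.left_commute) (rule sum.swap)
    also have "\<dots> = (\<Sum>l<d. if l = i then u i else 0)" by (rule sum.cong) (use bi that in auto)
    finally show ?thesis using that by simp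
  qed
  have exp: "b j (act x y) = (\<Sum>l<d. \<rho> x $$ (l,j) * b l y)" if "x \<in> carrier G" "j < d" "y \<in> Y" for x j y
  proof -
    obtain u where u: "\<And>y. y \<in> Y \<Longrightarrow> b j (act x y) = (\<Sum>l<d. u l * b l y)" using inv \<open>x \<in> carrier G\<close> \<open>j < d\<close> by blast
    have "\<rho> x $$ (l,j) = u l" if "l < d" for l
      unfolding \<rho>_def using that \<open>j < d\<close> coef[OF that, of u] u by simp
    then show ?thesis using u[OF \<open>y \<in> Y\<close>] by simp
  qed
  have mult: "\<rho> (x \<otimes>\<^bsub>G\<^esub> z) = \<rho> x * \<rho> z" if x: "x \<in> carrier G" and z: "z \<in> carrier G" for x z
  proof (rule eq_matI)
    fix i j assume "i < dim_row (\<rho> x * \<rho> z)" "j < dim_col (\<rho> x * \<rho> z)"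
    then have ij: "i < d" "j < d" by auto
    have "\<rho> (x \<otimes>\<^bsub>G\<^esub> z) $$ (i,j) = (\<Sum>y\<in>Y. c i y * (\<Sum>k<d. \<rho> z $$ (k,j) * b k (act x y)))"
      using ij x z by (auto simp: \<rho>_def[of "x \<otimes>\<^bsub>G\<^esub> z"] actm exp[OF z ij(2) act[OF x]] intro!: sum.cong)
    also have "\<dots> = (\<Sum>k<d. \<rho> z $$ (k,j) * (\<Sum>y\<in>Y. c i y * b k (act x y)))"
      by (simp add: sum_distrib_left mult.left_commute) (rule sum.swap)
    also have "\<dots> = (\<Sum>k<d. \<rho> x $$ (i,k) * \<rho> z $$ (k,j))"
      using ij by (auto simp: \<rho>_def[of x] intro!: sum.cong)
    also have "\<dots> = (\<rho> x * \<rho> z) $$ (i,j)" using ij by (simp add: scalar_prod_def atLeast0LessThan)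
    finally show "\<rho> (x \<otimes>\<^bsub>G\<^esub> z) $$ (i,j) = (\<rho> x * \<rho> z) $$ (i,j)" .
  qed auto
  have one: "\<rho> \<one>\<^bsub>G\<^esub> = 1\<^sub>m d"
    by (rule eq_matI) (use bi in \<open>auto simp: \<rho>_def act1\<close>)
  have rep: "complex_rep G d \<rho>" unfolding complex_rep_def
  proof (rule homI)
    fix x assume x: "x \<in> carrier G"
    have "\<rho> x * \<rho> (inv\<^bsub>G\<^esub> x) = 1\<^sub>m d" "\<rho> (inv\<^bsub>G\<^esub> x) * \<rho> x = 1\<^sub>m d"
      using x mult[symmetric] one by auto
    then show "\<rho> x \<in> carrier (GL_complex d)"
      unfolding GL_complex_def units_of_def Units_def ring_mat_def by (auto intro!: bexI[of _ "\<rho> (inv\<^bsub>G\<^esub> x)"])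
  qed (auto simp: mult GL_complex_def units_of_def ring_mat_def)
  have irr: "irreducible_rep G d \<rho>" unfolding irreducible_rep_def
  proof (intro conjI allI impI)
    fix W assume W: "invariant_subspace G d \<rho> W"
    from W have sm: "submodule class_ring W (module_vec TYPE(complex) d)"
      and Winv: "\<And>x w. x \<in> carrier G \<Longrightarrow> w \<in> W \<Longrightarrow> \<rho> x *\<^sub>v w \<in> W"
      unfolding invariant_subspace_def VectorSpace.subspace_def by auto
    have Wc: "W \<subseteq> carrier_vec d" using submodule.subset[OF sm] by (simp add: module_vec_simps)
    have Wadd: "v + w \<in> W" if "v \<in> W" "w \<in> W" for v w
      using submodule.m_closed[OF sm that] by (simp add: module_vec_simps)
    have Wsc: "a \<cdot>\<^sub>v w \<in> W" if "w \<in> W" for a w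
      using submodule.smult_closed[OF sm _ that, of a] by (simp add: module_vec_simps class_ring_simps)
    have W0: "0\<^sub>v d \<in> W" using submodule.zero_closed[OF sm] by (simp add: module_vec_simps)
    \<comment> \<open>The subspace as a set of functions on \<open>{..<d}\<close>, so that it too
      has a biorthogonal basis.\<close>
    define V where "V = {w. vec d w \<in> W}"
    have vecW: "vec d (\<lambda>i. w $ i) = w" if "w \<in> W" for w
      using that Wc by (intro eq_vecI) auto
    obtain e :: nat and B C where BV: "\<And>j. j < e \<Longrightarrow> B j \<in> V"
      and BI: "\<And>i j. i < e \<Longrightarrow> j < e \<Longrightarrow> (\<Sum>y\<in>{..<d}. C i y * B j y) = (if i = j then 1 else 0)"
      and spn: "\<And>w. w \<in> V \<Longrightarrow> \<exists>u. \<forall>y\<in>{..<d}. w y = (\<Sum>l<e. u l * B l y)"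
    proof (rule subspace_biorth_basis[of "{..<d}" V])
      show "(\<lambda>y. v y + w y) \<in> V" if "v \<in> V" "w \<in> V" for v w
      proof -
        have "vec d (\<lambda>y. v y + w y) = vec d v + vec d w" by (rule eq_vecI) auto
        then show ?thesis using that Wadd unfolding V_def by simp
      qed
      show "(\<lambda>y. a * v y) \<in> V" if "v \<in> V" for a v
      proof -
        have "vec d (\<lambda>y. a * v y) = a \<cdot>\<^sub>v vec d v" by (rule eq_vecI) auto
        then show ?thesis using that Wsc unfolding V_def by simp
      qed
    qed auto
    note le = biorth_card_le[of "{..<d}" e C B, simplified card_lessThan finite_lessThan, OF TrueI BI]
    show "W = {0\<^sub>v d} \<or> W = carrier_vec d"
    proof (cases "e = 0")
      case True
      have "w = 0\<^sub>v d" if "w \<in> W" for w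
      proof -
        have "(\<lambda>i. w $ i) \<in> V" using vecW[OF that] that unfolding V_def by simp
        then obtain u where "\<forall>y\<in>{..<d}. w $ y = (\<Sum>l<e. u l * B l y)" using spn by blast
        then show ?thesis using True Wc that by (intro eq_vecI) auto
      qed
      then show ?thesis using W0 by blast
    next
      case False
      \<comment> \<open>An \<open>e\<close>-dimensional invariant subspace of vectors becomes an
        \<open>e\<close>-dimensional invariant subspace of functions inside the kernel; minimality
        of \<open>d\<close> forces \<open>e = d\<close>.\<close>
      define b' where "b' j y = (\<Sum>i<d. B j i * b i y)" for j y
      define c' where "c' j y = (\<Sum>i<d. C j i * c i y)" for j y
      have "Adm e" unfolding Adm_def
      proof (intro conjI exI)
        show "0 < e" using False by simp
        show "?bi e b' c'"
        proof (intro allI impI)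
          fix i j assume ij: "i < e" "j < e"
          have "(\<Sum>y\<in>Y. c' i y * b' j y) = (\<Sum>k<d. C i k * (\<Sum>y\<in>Y. c k y * (\<Sum>l<d. B j l * b l y)))"
            unfolding b'_def c'_def
            by (simp add: sum_distrib_right sum_distrib_left[of "C _ _"] mult.assoc) (rule sum.swap)
          also have "\<dots> = (\<Sum>k<d. C i k * B j k)" by (rule sum.cong) (simp_all add: coef)
          finally show "(\<Sum>y\<in>Y. c' i y * b' j y) = (if i = j then 1 else 0)" using BI[OF ij] by simp
        qed
        show "?kill e b'"
        proof (intro allI impI ballI)
          fix j y assume y: "y \<in> Y"
          have "(\<Sum>h\<in>carrier G. b' j (act (?cj h) y)) = (\<Sum>i<d. B j i * (\<Sum>h\<in>carrier G. b i (act (?cj h) y)))"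
            unfolding b'_def by (subst sum.swap) (simp add: sum_distrib_left)
          also have "\<dots> = 0" using kil y by simp
          finally show "(\<Sum>h\<in>carrier G. b' j (act (?cj h) y)) = 0" .
        qed
        show "?inv e b'"
        proof (intro allI impI ballI)
          fix x j assume x: "x \<in> carrier G" and j: "j < e"
          have "vec d (B j) \<in> W" using BV[OF j] unfolding V_def by simp
          then have "\<rho> x *\<^sub>v vec d (B j) \<in> W" using Winv x by blast
          then have "(\<lambda>i. (\<rho> x *\<^sub>v vec d (B j)) $ i) \<in> V" using vecW unfolding V_def by simp
          then obtain u where u: "\<And>i. i < d \<Longrightarrow> (\<rho> x *\<^sub>v vec d (B j)) $ i = (\<Sum>l<e. u l * B l i)"
            using spn by (metis lessThan_iff)
          have "b' j (act x y) = (\<Sum>l<e. u l * b' l y)" if y: "y \<in> Y" for y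
          proof -
            have "b' j (act x y) = (\<Sum>i<d. B j i * (\<Sum>l<d. \<rho> x $$ (l,i) * b l y))"
              unfolding b'_def using exp[OF x _ y] by simp
            also have "\<dots> = (\<Sum>l<d. (\<Sum>i<d. \<rho> x $$ (l,i) * B j i) * b l y)"
              by (simp add: sum_distrib_left sum_distrib_right mult_ac) (rule sum.swap)
            also have "\<dots> = (\<Sum>l<d. (\<rho> x *\<^sub>v vec d (B j)) $ l * b l y)"
              by (rule sum.cong) (auto simp: scalar_prod_def atLeast0LessThan)
            also have "\<dots> = (\<Sum>l<d. (\<Sum>k<e. u k * B k l) * b l y)" using u by simp
            also have "\<dots> = (\<Sum>k<e. u k * b' k y)"
              unfolding b'_def by (simp add: sum_distrib_left sum_distrib_right mult_ac) (rule sum.swap)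
            finally show ?thesis .
          qed
          then show "\<exists>u. \<forall>y\<in>Y. b' j (act x y) = (\<Sum>l<e. u l * b' l y)" by blast
        qed
      qed
      then have ed: "e = d" using min le(1) by (meson le_antisym)
      have "w \<in> W" if w: "w \<in> carrier_vec d" for w
      proof -
        define u where "u l = (\<Sum>y<d. C l y * w $ y)" for l
        define s where "s m = vec d (\<lambda>i. \<Sum>l<m. u l * B l i)" for m
        have "s m \<in> W" if "m \<le> e" for m
          using that
        proof (induction m)
          case 0 then show ?case using W0 by (simp add: s_def zero_vec_def)
        next
          case (Suc m)
          have "s (Suc m) = s m + u m \<cdot>\<^sub>v vec d (B m)" unfolding s_def by (rule eq_vecI) auto
          then show ?case using Suc BV[of m] Wadd Wsc unfolding V_def by simp
        qed
        moreover have "s e = w"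
        proof (rule eq_vecI)
          fix i assume "i < dim_vec w"
          then have i: "i < d" using w by simp
          have "s e $ i = (\<Sum>l<e. (\<Sum>y<d. C l y * w $ y) * B l i)" using i unfolding s_def u_def by simp
          also have "\<dots> = (\<Sum>y<d. (\<Sum>l<e. B l i * C l y) * w $ y)"
            by (simp add: sum_distrib_left sum_distrib_right mult_ac) (rule sum.swap)
          also have "\<dots> = (\<Sum>y<d. if y = i then w $ i else 0)"
            by (rule sum.cong) (use le(2) ed i in auto)
          finally show "s e $ i = w $ i" using i by simp
        qed (use w in \<open>auto simp: s_def\<close>)
        ultimately show ?thesis by auto
      qed
      then show ?thesis using Wc by blast
    qed
  qed (use rep d0 in auto)
  have trace_conj: "mat_trace (\<rho> (?cj h)) = mat_trace (\<rho> g)" if h: "h \<in> carrier G" for h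
  proof -
    have tr: "mat_trace (A * B) = mat_trace (B * A)" if "A \<in> carrier_mat d d" "B \<in> carrier_mat d d" for A B
      using that unfolding mat_trace_def
      by (simp add: scalar_prod_def atLeast0LessThan mult.commute) (rule sum.swap)
    have "\<rho> (?cj h) = \<rho> h * (\<rho> g * \<rho> (inv\<^bsub>G\<^esub> h))" using h g by (simp add: mult assoc_mult_mat[of _ d d _ d _ d])
    then have "mat_trace (\<rho> (?cj h)) = mat_trace ((\<rho> g * \<rho> (inv\<^bsub>G\<^esub> h)) * \<rho> h)"
      using tr[of "\<rho> h" "\<rho> g * \<rho> (inv\<^bsub>G\<^esub> h)"] by (simp add: mult_carrier_mat[of _ d d _ d])
    also have "(\<rho> g * \<rho> (inv\<^bsub>G\<^esub> h)) * \<rho> h = \<rho> g"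
      using h g by (simp add: mult[symmetric]) (simp add: m_assoc)
    finally show ?thesis .
  qed
  have "of_nat (card (carrier G)) * mat_trace (\<rho> g) = (\<Sum>h\<in>carrier G. mat_trace (\<rho> (?cj h)))"
    by (simp add: trace_conj)
  also have "\<dots> = (\<Sum>i<d. \<Sum>y\<in>Y. c i y * (\<Sum>h\<in>carrier G. b i (act (?cj h) y)))"
    unfolding mat_trace_def by (simp add: \<rho>_def sum_distrib_left)
      (subst sum.swap, rule sum.cong, simp, rule sum.swap)
  also have "\<dots> = 0" using kil by simp
  finally have "mat_trace (\<rho> g) = 0" using fin by (auto simp: card_eq_0_iff)
  then show ?thesis
    unfolding vanishing_def irreducible_character_def using g irr
    by (intro conjI exI[of _ "\<lambda>x. mat_trace (\<rho> x)"]) auto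
qed

section \<open>Sums over conjugates in the symmetric and alternating groups\<close>

definition conj_by :: "('a \<Rightarrow> 'a) \<Rightarrow> ('a \<Rightarrow> 'a) \<Rightarrow> 'a \<Rightarrow> 'a" where
  "conj_by h g = h \<circ> g \<circ> inv' h"

lemma permutes_conj_by: "h permutes X \<Longrightarrow> g permutes X \<Longrightarrow> conj_by h g permutes X"
  unfolding conj_by_def by (intro permutes_compose permutes_inv)

lemma conj_by_compose:
  assumes "x permutes X" "h permutes X"
  shows "conj_by (x \<circ> h) g = x \<circ> conj_by h g \<circ> inv' x"
  unfolding conj_by_def using assms by (simp add: o_inv_distrib permutes_bij comp_assoc)

lemma sum_permutes_compose_left:
  assumes "x permutes X"
  shows "(\<Sum>h | h permutes X. f (x \<circ> h)) = (\<Sum>h | h permutes X. f h)"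
  by (rule sum.reindex_bij_witness[of _ "\<lambda>h. inv' x \<circ> h" "\<lambda>h. x \<circ> h"])
    (use assms in \<open>auto intro!: permutes_compose permutes_inv simp: comp_assoc[symmetric] permutes_inv_o\<close>)

lemma evenperm_compose_odd:
  assumes "x permutes X" "\<not> evenperm x" "h permutes X" "finite X"
  shows "evenperm (h \<circ> x) \<longleftrightarrow> \<not> evenperm h" "evenperm (x \<circ> h) \<longleftrightarrow> \<not> evenperm h"
  using assms evenperm_comp[of h x] evenperm_comp[of x h] unfolding permutation_permutes by auto

text \<open>Used with translation by an odd permutation that leaves the summand unchanged; this is
  the passage from the symmetric to the alternating group.\<close>

lemma sum_permutes_eq_double_even:
  fixes f :: "('a \<Rightarrow> 'a) \<Rightarrow> real"
  assumes X: "finite X"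
    and bij: "bij_betw t {h. h permutes X \<and> evenperm h} {h. h permutes X \<and> \<not> evenperm h}"
    and inv: "\<And>h. h permutes X \<Longrightarrow> f (t h) = f h"
  shows "(\<Sum>h | h permutes X. f h) = 2 * (\<Sum>h | h permutes X \<and> evenperm h. f h)"
proof -
  have fin: "finite {h. h permutes X}" using finite_permutations[OF X] .
  have split: "{h. h permutes X} = {h. h permutes X \<and> evenperm h} \<union> {h. h permutes X \<and> \<not> evenperm h}" by blast
  have "(\<Sum>h | h permutes X. f h) = (\<Sum>h | h permutes X \<and> evenperm h. f h) + (\<Sum>h | h permutes X \<and> \<not> evenperm h. f h)"
    unfolding split by (rule sum.union_disjoint) (use fin in \<open>auto elim: rev_finite_subset\<close>)
  also have "(\<Sum>h | h permutes X \<and> \<not> evenperm h. f h) = (\<Sum>h | h permutes X \<and> evenperm h. f (t h))"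
    by (rule sum.reindex_bij_betw[OF bij, symmetric])
  also have "\<dots> = (\<Sum>h | h permutes X \<and> evenperm h. f h)" by (rule sum.cong) (auto simp: inv)
  finally show ?thesis by simp
qed

lemma bij_betw_compose_odd:
  assumes X: "finite X" and x: "x permutes X" "\<not> evenperm x"
  shows "bij_betw (\<lambda>h. h \<circ> x) {h. h permutes X \<and> evenperm h} {h. h permutes X \<and> \<not> evenperm h}"
    and "bij_betw (\<lambda>h. x \<circ> h) {h. h permutes X \<and> evenperm h} {h. h permutes X \<and> \<not> evenperm h}"
proof -
  have i: "inv' x permutes X" using x(1) by (rule permutes_inv)
  have "permutation x" using x X by (auto simp: permutation_permutes)
  then have j: "\<not> evenperm (inv' x)" using x(2) evenperm_inv by blast
  have l: "inv' x \<circ> (x \<circ> h) = h" "x \<circ> (inv' x \<circ> h) = h" "h \<circ> x \<circ> inv' x = h" "h \<circ> inv' x \<circ> x = h" for h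
    by (simp_all add: fun_eq_iff permutes_inverses[OF x(1)])
  show "bij_betw (\<lambda>h. h \<circ> x) {h. h permutes X \<and> evenperm h} {h. h permutes X \<and> \<not> evenperm h}"
    by (rule bij_betw_byWitness[where f' = "\<lambda>h. h \<circ> inv' x"])
      (simp_all add: l image_subset_iff permutes_compose[OF x(1)] permutes_compose[OF i]
        evenperm_compose_odd[OF x _ X] evenperm_compose_odd[OF i j _ X])
  show "bij_betw (\<lambda>h. x \<circ> h) {h. h permutes X \<and> evenperm h} {h. h permutes X \<and> \<not> evenperm h}"
    by (rule bij_betw_byWitness[where f' = "\<lambda>h. inv' x \<circ> h"])
      (simp_all add: l image_subset_iff permutes_compose[OF _ x(1)] permutes_compose[OF _ i]
        evenperm_compose_odd[OF x _ X] evenperm_compose_odd[OF i j _ X])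
qed

definition sym_or_alt :: "nat \<Rightarrow> (nat \<Rightarrow> nat) monoid \<Rightarrow> bool" where
  "sym_or_alt n G \<longleftrightarrow> G = sym_group n \<or> G = alt_group n"

lemma sym_or_alt_conj:
  assumes "sym_or_alt n G" "h \<in> carrier G" "g \<in> carrier G"
  shows "h \<otimes>\<^bsub>G\<^esub> g \<otimes>\<^bsub>G\<^esub> inv\<^bsub>G\<^esub> h = conj_by h g"
  using assms unfolding sym_or_alt_def conj_by_def
  by (auto simp: sym_group_mult alt_group_mult alt_group_inv_equality)

lemma sym_or_alt_group: "sym_or_alt n G \<Longrightarrow> group G"
  unfolding sym_or_alt_def using sym_group_is_group alt_group_is_group by auto

lemma sym_or_alt_carrier: "sym_or_alt n G \<Longrightarrow> g \<in> carrier G \<Longrightarrow> g permutes {1..n}"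
  unfolding sym_or_alt_def using sym_group_carrier alt_group_carrier by auto

lemma sym_or_alt_finite: "sym_or_alt n G \<Longrightarrow> finite (carrier G)"
  using finite_subset[OF _ finite_permutations[of "{1..n}"], of "carrier G"] sym_or_alt_carrier by fastforce

text \<open>Both groups are handled by sums over the whole symmetric group; \<open>half\<close>
  recovers the sum over the even permutations.\<close>

lemma vanishing_sym_or_alt:
  fixes act :: "(nat \<Rightarrow> nat) \<Rightarrow> 'y \<Rightarrow> 'y" and v :: "'y \<Rightarrow> real"
  assumes G: "sym_or_alt n G" and g: "g \<in> carrier G" and Y: "finite Y"
    and act: "\<And>x y. x permutes {1..n} \<Longrightarrow> y \<in> Y \<Longrightarrow> act x y \<in> Y"
    and act1: "\<And>y. y \<in> Y \<Longrightarrow> act id y = y"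
    and actm: "\<And>x z y. x permutes {1..n} \<Longrightarrow> z permutes {1..n} \<Longrightarrow> y \<in> Y \<Longrightarrow> act (x \<circ> z) y = act z (act x y)"
    and v0: "y0 \<in> Y" "v y0 \<noteq> 0"
    and kill: "\<And>y. y \<in> Y \<Longrightarrow> (\<Sum>h | h permutes {1..n}. v (act (conj_by h g) y)) = 0"
    and half: "\<And>y. G = alt_group n \<Longrightarrow> y \<in> Y \<Longrightarrow> (\<Sum>h | h permutes {1..n}. v (act (conj_by h g) y))
      = 2 * (\<Sum>h | h permutes {1..n} \<and> evenperm h. v (act (conj_by h g) y))"
  shows "vanishing G g"
proof (rule vanishing_criterion[where v = "\<lambda>y. complex_of_real (v y)" and act = act])
  fix y assume y: "y \<in> Y"
  have "(\<Sum>h\<in>carrier G. v (act (conj_by h g) y)) = 0"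
    using G kill[OF y] half[OF _ y] unfolding sym_or_alt_def by (auto simp: sym_group_def alt_group_def)
  then have "complex_of_real (\<Sum>h\<in>carrier G. v (act (conj_by h g) y)) = 0" by simp
  then show "(\<Sum>h\<in>carrier G. complex_of_real (v (act (h \<otimes>\<^bsub>G\<^esub> g \<otimes>\<^bsub>G\<^esub> inv\<^bsub>G\<^esub> h) y))) = 0"
    using sym_or_alt_conj[OF G _ g] by simp
qed (use assms sym_or_alt_group sym_or_alt_finite sym_or_alt_carrier[OF G] in
  \<open>auto simp: sym_or_alt_def sym_group_one alt_group_one sym_group_mult alt_group_mult\<close>)

text \<open>The matrix counting common supersets is inverted in this way, which makes the projection
  onto harmonic functions explicit.\<close>

lemma kernel_inverse:
  fixes E :: "'y \<Rightarrow> 'y \<Rightarrow> real"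
  assumes Y: "finite Y"
    and inj: "\<And>w. (\<And>S. S \<in> Y \<Longrightarrow> (\<Sum>T\<in>Y. E S T * w T) = 0) \<Longrightarrow> (\<And>S. S \<in> Y \<Longrightarrow> w S = 0)"
  obtains \<psi> where "\<And>S R. S \<in> Y \<Longrightarrow> R \<in> Y \<Longrightarrow> (\<Sum>T\<in>Y. E S T * \<psi> T R) = (if S = R then 1 else 0)"
proof -
  obtain f where f: "bij_betw f {..<card Y} Y"
    using ex_bij_betw_nat_finite[OF Y] by (auto simp: atLeast0LessThan)
  let ?N = "card Y"
  let ?M = "mat ?N ?N (\<lambda>(i,j). E (f i) (f j))"
  define fi where "fi = inv_into {..<?N} f"
  have fi: "fi (f i) = i" if "i < ?N" for i
    using f that unfolding fi_def bij_betw_def by (simp add: inv_into_f_f)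
  have fY: "f i \<in> Y" if "i < ?N" for i using f that unfolding bij_betw_def by auto
  have ffi: "f (fi S) = S" "fi S < ?N" if "S \<in> Y" for S
    using f that unfolding fi_def bij_betw_def by (auto simp: f_inv_into_f) (metis inv_into_into lessThan_iff)
  have sumY: "(\<Sum>T\<in>Y. a T) = (\<Sum>j<?N. a (f j))" for a :: "'y \<Rightarrow> real"
    by (rule sum.reindex_bij_betw[OF f, symmetric])
  have "det ?M \<noteq> 0"
  proof
    assume "det ?M = 0"
    then obtain v where v: "v \<in> carrier_vec ?N" "v \<noteq> 0\<^sub>v ?N" "?M *\<^sub>v v = 0\<^sub>v ?N"
      using det_0_iff_vec_prod_zero_field[of ?M ?N] by auto
    have "v $ fi S = 0" if "S \<in> Y" for S
    proof (rule inj[of "\<lambda>S. v $ fi S", OF _ that])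
      fix S assume S: "S \<in> Y"
      have "(\<Sum>T\<in>Y. E S T * v $ fi T) = (?M *\<^sub>v v) $ (fi S)"
        using ffi[OF S] v(1) by (simp add: sumY fi scalar_prod_def atLeast0LessThan)
      then show "(\<Sum>T\<in>Y. E S T * v $ fi T) = 0" using v(3) ffi[OF S] by simp
    qed
    then have "v = 0\<^sub>v ?N" using v(1) fi fY by (intro eq_vecI) (auto, metis)
    then show False using v(2) by simp
  qed
  then have "?M \<in> Units (ring_mat TYPE(real) ?N ())"
    by (intro det_non_zero_imp_unit) auto
  then obtain B where B: "B \<in> carrier_mat ?N ?N" "?M * B = 1\<^sub>m ?N"
    unfolding Units_def ring_mat_def by auto
  show thesis
  proof (rule that[of "\<lambda>T R. B $$ (fi T, fi R)"])
    fix S R assume S: "S \<in> Y" and R: "R \<in> Y"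
    have "(\<Sum>T\<in>Y. E S T * B $$ (fi T, fi R)) = (?M * B) $$ (fi S, fi R)"
      using ffi[OF S] ffi[OF R] B(1) by (simp add: sumY fi scalar_prod_def atLeast0LessThan)
    moreover have "fi S = fi R \<longleftrightarrow> S = R" using ffi(1)[OF S] ffi(1)[OF R] by metis
    ultimately show "(\<Sum>T\<in>Y. E S T * B $$ (fi T, fi R)) = (if S = R then 1 else 0)"
      using B(2) ffi(2)[OF S] ffi(2)[OF R] by simp
  qed
qed

section \<open>Two-row shapes\<close>

definition ksubsets :: "nat \<Rightarrow> nat \<Rightarrow> nat set set" where
  "ksubsets n k = {A. A \<subseteq> {1..n} \<and> card A = k}"

lemma finite_ksubsets [simp]: "finite (ksubsets n k)"
  unfolding ksubsets_def by (rule finite_subset[of _ "Pow {1..n}"]) auto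

lemma card_ksubsets: "card (ksubsets n k) = n choose k"
  using n_subsets[of "{1..n}" k] unfolding ksubsets_def by simp

lemma ksubsetsD: "A \<in> ksubsets n k \<Longrightarrow> A \<subseteq> {1..n}" "A \<in> ksubsets n k \<Longrightarrow> card A = k"
   "A \<in> ksubsets n k \<Longrightarrow> finite A"
  unfolding ksubsets_def by (auto intro: finite_subset)

lemma vimage_permutes_subset: "p permutes X \<Longrightarrow> A \<subseteq> X \<Longrightarrow> p -` A \<subseteq> X"
  unfolding permutes_def by (metis subsetD subsetI vimage_eq)

lemma card_vimage_permutes: "p permutes X \<Longrightarrow> card (p -` A) = card A"
  by (rule card_vimage_inj) (auto simp: permutes_inj permutes_surj)

lemma vimage_ksubsets [simp]: "p permutes {1..n} \<Longrightarrow> A \<in> ksubsets n k \<Longrightarrow> p -` A \<in> ksubsets n k"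
  unfolding ksubsets_def by (simp add: vimage_permutes_subset card_vimage_permutes)

lemma vimage_inv_permutes: 
  assumes "p permutes X" shows "p -` (inv' p -` A) = A" "inv' p -` (p -` A) = A"
  using permutes_inv_o[OF assms] by (simp_all add: vimage_comp)

lemma bij_betw_vimage_ksubsets:
  assumes "p permutes {1..n}"
  shows "bij_betw (\<lambda>A. p -` A) (ksubsets n k) (ksubsets n k)"
  by (rule bij_betw_byWitness[where f' = "\<lambda>A. inv' p -` A"])
    (use assms in \<open>auto simp: vimage_inv_permutes permutes_inv\<close>)

lemma sum_vimage_ksubsets:
  assumes "p permutes {1..n}"
  shows "(\<Sum>A\<in>ksubsets n k. f (p -` A)) = (\<Sum>A\<in>ksubsets n k. f A)"
  by (rule sum.reindex_bij_betw[OF bij_betw_vimage_ksubsets[OF assms]])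

definition supersets :: "nat \<Rightarrow> nat \<Rightarrow> nat set \<Rightarrow> nat set set" where
  "supersets n k S = {A \<in> ksubsets n k. S \<subseteq> A}"

text \<open>The kernel of the map from functions on \<open>Suc j\<close>-subsets to functions on
  \<open>j\<close>-subsets; for \<open>2 * Suc j \<le> n\<close> this is the Specht module of shape
  (n - j - 1, j + 1).\<close>

definition harmonic :: "nat \<Rightarrow> nat \<Rightarrow> (nat set \<Rightarrow> real) \<Rightarrow> bool" where
  "harmonic n j v \<longleftrightarrow> (\<forall>S\<in>ksubsets n j. (\<Sum>A\<in>supersets n (Suc j) S. v A) = 0)"

lemma card_supersets_Suc:
  assumes S: "S \<in> ksubsets n j"
  shows "card (supersets n (Suc j) S) = n - j"
proof -
  have "bij_betw (\<lambda>x. insert x S) ({1..n} - S) (supersets n (Suc j) S)"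
    unfolding bij_betw_def
  proof
    show "inj_on (\<lambda>x. insert x S) ({1..n} - S)" by (auto simp: inj_on_def)
    show "(\<lambda>x. insert x S) ` ({1..n} - S) = supersets n (Suc j) S"
    proof (intro equalityI subsetI)
      fix A assume A: "A \<in> supersets n (Suc j) S"
      then have AA: "A \<subseteq> {1..n}" "card A = Suc j" "S \<subseteq> A" "finite A"
        unfolding supersets_def using ksubsetsD[of A n "Suc j"] by blast+
      then have "card (A - S) = 1" using ksubsetsD[OF S] by (simp add: card_Diff_subset)
      then obtain x where "A - S = {x}" by (auto simp: card_Suc_eq)
      then have "A = insert x S" "x \<in> {1..n} - S" using AA by auto
      then show "A \<in> (\<lambda>x. insert x S) ` ({1..n} - S)" by auto
    next
      fix A assume "A \<in> (\<lambda>x. insert x S) ` ({1..n} - S)"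
      then show "A \<in> supersets n (Suc j) S"
        using ksubsetsD[OF S] unfolding supersets_def ksubsets_def by auto
    qed
  qed
  then have "card (supersets n (Suc j) S) = card ({1..n} - S)" by (rule bij_betw_same_card[symmetric])
  also have "\<dots> = n - j" using ksubsetsD[OF S] by (simp add: card_Diff_subset)
  finally show ?thesis .
qed

lemma card_removals:
  assumes B: "finite B" "card B = Suc j"
  shows "card {S. S \<subseteq> B \<and> card S = j \<and> P S} = card {b \<in> B. P (B - {b})}"
proof -
  have "bij_betw (\<lambda>b. B - {b}) {b \<in> B. P (B - {b})} {S. S \<subseteq> B \<and> card S = j \<and> P S}"
    unfolding bij_betw_def
  proof
    show "inj_on (\<lambda>b. B - {b}) {b \<in> B. P (B - {b})}" by (auto simp: inj_on_def)
    show "(\<lambda>b. B - {b}) ` {b \<in> B. P (B - {b})} = {S. S \<subseteq> B \<and> card S = j \<and> P S}"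
    proof (intro equalityI subsetI)
      fix S assume S: "S \<in> {S. S \<subseteq> B \<and> card S = j \<and> P S}"
      then have "card (B - S) = 1" using B by (simp add: card_Diff_subset finite_subset[of S B])
      then obtain b where "B - S = {b}" by (auto simp: card_Suc_eq)
      then have "S = B - {b}" "b \<in> B" using S by auto
      then show "S \<in> (\<lambda>b. B - {b}) ` {b \<in> B. P (B - {b})}" using S by auto
    qed (use B in auto)
  qed
  then show ?thesis by (rule bij_betw_same_card[symmetric])
qed

declare One_nat_def [simp del]

text \<open>Two distinct \<open>j\<close>-sets have a common superset of size \<open>j + 1\<close>
  exactly when they have a common subset of size \<open>j - 1\<close>, and then one of each. Only
  the diagonal differs, with \<open>n - j\<close> against \<open>j\<close>. The form
  \<open>Suc (card R) = j\<close> admits no \<open>R\<close> when \<open>j = 0\<close>.\<close>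

lemma supersets_union_diff:
  assumes S: "S \<in> ksubsets n j" and T: "T \<in> ksubsets n j"
  shows "real (card (supersets n (Suc j) (S \<union> T))) - real (card {R. R \<subseteq> S \<inter> T \<and> Suc (card R) = j})
    = (if S = T then real n - 2 * real j else 0)"
proof (cases "S = T")
  case True
  have "j \<le> n" using ksubsetsD[OF S] card_mono[of "{1..n}" S] by auto
  moreover have "card {R. R \<subseteq> S \<and> Suc (card R) = j} = j"
  proof (cases j)
    case (Suc i)
    then show ?thesis using card_removals[of S i "\<lambda>_. True"] ksubsetsD[OF S] by simp
  qed simp
  ultimately show ?thesis using True card_supersets_Suc[OF S] by simp
next
  case False
  note fin = ksubsetsD(3)[OF S] ksubsetsD(3)[OF T]
  have cU: "card (S \<union> T) + card (S \<inter> T) = 2 * j"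
    using card_Un_Int[OF fin] ksubsetsD[OF S] ksubsetsD[OF T] by simp
  have ltI: "card (S \<inter> T) < j"
    using False psubset_card_mono[of S "S \<inter> T"] fin ksubsetsD(2)[OF S] ksubsetsD(2)[OF T]
    by (metis card_subset_eq inf_le1 inf_le2 card_mono le_neq_implies_less)
  have sup: "supersets n (Suc j) (S \<union> T) = (if card (S \<union> T) = Suc j then {S \<union> T} else {})"
  proof -
    have "A = S \<union> T \<and> card (S \<union> T) = Suc j" if A: "A \<in> supersets n (Suc j) (S \<union> T)" for A
    proof -
      have A': "finite A" "card A = Suc j" "S \<union> T \<subseteq> A"
        using A ksubsetsD[of A n "Suc j"] unfolding supersets_def by auto
      then have "card (S \<union> T) \<le> Suc j" using card_mono by metis
      moreover have "Suc j \<le> card (S \<union> T)" using cU ltI by linarith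
      ultimately show ?thesis using A' card_subset_eq[OF A'(1,3)] by simp
    qed
    moreover have "S \<union> T \<in> supersets n (Suc j) (S \<union> T)" if "card (S \<union> T) = Suc j"
      using that ksubsetsD[OF S] ksubsetsD[OF T] unfolding supersets_def ksubsets_def by simp
    ultimately show ?thesis by auto
  qed
  have sub: "{R. R \<subseteq> S \<inter> T \<and> Suc (card R) = j} = (if Suc (card (S \<inter> T)) = j then {S \<inter> T} else {})"
  proof -
    have "R = S \<inter> T \<and> Suc (card (S \<inter> T)) = j" if R: "R \<subseteq> S \<inter> T" "Suc (card R) = j" for R
    proof -
      have f: "finite (S \<inter> T)" using fin by simp
      have "card R \<le> card (S \<inter> T)" by (rule card_mono[OF f R(1)])
      then have "card R = card (S \<inter> T)" using R(2) ltI by linarith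
      then show ?thesis using card_subset_eq[OF f R(1)] R(2) by simp
    qed
    then show ?thesis by auto
  qed
  have "card (S \<union> T) = Suc j \<longleftrightarrow> Suc (card (S \<inter> T)) = j" using cU ltI by linarith
  then show ?thesis using False unfolding sup sub by simp
qed

text \<open>Exhibits a matrix of common neighbours as a Gram matrix, hence as positive
  semidefinite.\<close>

lemma sum_superset_square:
  fixes w :: "nat set \<Rightarrow> real"
  assumes Y: "finite Y" and Z: "finite Z"
  shows "(\<Sum>A\<in>Y. (\<Sum>S | S \<in> Z \<and> r S A. w S)\<^sup>2) = (\<Sum>S\<in>Z. \<Sum>T\<in>Z. w S * w T * real (card {A \<in> Y. r S A \<and> r T A}))"
proof -
  have "(\<Sum>S | S \<in> Z \<and> r S A. w S) = (\<Sum>S\<in>Z. w S * of_bool (r S A))" for A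
    by (rule sum.mono_neutral_cong_left) (use Z in auto)
  then have "(\<Sum>A\<in>Y. (\<Sum>S | S \<in> Z \<and> r S A. w S)\<^sup>2)
      = (\<Sum>A\<in>Y. \<Sum>S\<in>Z. \<Sum>T\<in>Z. w S * w T * (of_bool (r S A) * of_bool (r T A)))"
    by (simp add: power2_eq_square sum_product mult_ac)
  also have "\<dots> = (\<Sum>S\<in>Z. \<Sum>T\<in>Z. \<Sum>A\<in>Y. w S * w T * (of_bool (r S A) * of_bool (r T A)))"
    by (subst sum.swap, rule sum.cong, simp, rule sum.swap)
  also have "\<dots> = (\<Sum>S\<in>Z. \<Sum>T\<in>Z. w S * w T * real (card {A \<in> Y. r S A \<and> r T A}))"
    using Y by (intro sum.cong refl)
      (simp add: sum_distrib_left[symmetric] of_bool_conj[symmetric] Int_def[symmetric] Collect_conj_eq)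
  finally show ?thesis .
qed

text \<open>The matrix is positive definite because up-down minus down-up is \<open>n - 2 j\<close> times the identity.\<close>

lemma supersets_kernel_injective:
  fixes w :: "nat set \<Rightarrow> real"
  assumes j: "2 * j < n"
    and w: "\<And>S. S \<in> ksubsets n j \<Longrightarrow> (\<Sum>T\<in>ksubsets n j. real (card (supersets n (Suc j) (S \<union> T))) * w T) = 0"
    and S: "S \<in> ksubsets n j"
  shows "w S = 0"
proof -
  let ?Z = "ksubsets n j" and ?Y = "Pow {1..n} :: nat set set"
  let ?I = "\<Sum>R\<in>?Y. (\<Sum>S | S \<in> ?Z \<and> (R \<subseteq> S \<and> Suc (card R) = j). w S)\<^sup>2"
  have I: "?I = (\<Sum>S\<in>?Z. \<Sum>T\<in>?Z. w S * w T * real (card {R. R \<subseteq> S \<inter> T \<and> Suc (card R) = j}))"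
  proof -
    have "{R \<in> ?Y. (R \<subseteq> S \<and> Suc (card R) = j) \<and> R \<subseteq> T \<and> Suc (card R) = j} = {R. R \<subseteq> S \<inter> T \<and> Suc (card R) = j}"
      if "S \<in> ?Z" for S T using ksubsetsD(1)[OF that] by auto
    then show ?thesis by (subst sum_superset_square) auto
  qed
  have "0 = (\<Sum>S\<in>?Z. w S * (\<Sum>T\<in>?Z. real (card (supersets n (Suc j) (S \<union> T))) * w T))"
    using w by simp
  also have "\<dots> = (\<Sum>S\<in>?Z. \<Sum>T\<in>?Z. w S * w T * real (card (supersets n (Suc j) (S \<union> T))))"
    by (simp add: sum_distrib_left mult_ac)
  also have "\<dots> = ?I + (\<Sum>S\<in>?Z. \<Sum>T\<in>?Z. w S * w T * (if S = T then real n - 2 * real j else 0))"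
    unfolding I sum.distrib[symmetric]
  proof (intro sum.cong refl)
    fix S T assume "S \<in> ?Z" "T \<in> ?Z"
    from supersets_union_diff[OF this]
    have "real (card (supersets n (Suc j) (S \<union> T))) = real (card {R. R \<subseteq> S \<inter> T \<and> Suc (card R) = j})
      + (if S = T then real n - 2 * real j else 0)" by linarith
    then show "w S * w T * real (card (supersets n (Suc j) (S \<union> T)))
      = w S * w T * real (card {R. R \<subseteq> S \<inter> T \<and> Suc (card R) = j}) + w S * w T * (if S = T then real n - 2 * real j else 0)"
      by (simp only: distrib_left)
  qed
  also have "(\<Sum>S\<in>?Z. \<Sum>T\<in>?Z. w S * w T * (if S = T then real n - 2 * real j else 0)) = (\<Sum>S\<in>?Z. (real n - 2 * real j) * (w S)\<^sup>2)"
  proof (intro sum.cong refl)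
    fix S assume S: "S \<in> ?Z"
    have "(\<Sum>T\<in>?Z. w S * w T * (if S = T then real n - 2 * real j else 0))
      = (\<Sum>T\<in>?Z. if T = S then (real n - 2 * real j) * (w S)\<^sup>2 else 0)"
      by (intro sum.cong) (auto simp: power2_eq_square)
    then show "(\<Sum>T\<in>?Z. w S * w T * (if S = T then real n - 2 * real j else 0)) = (real n - 2 * real j) * (w S)\<^sup>2"
      using S by simp
  qed
  finally have eq: "?I + (\<Sum>S\<in>?Z. (real n - 2 * real j) * (w S)\<^sup>2) = 0" by simp
  have "?I \<ge> 0" by (intro sum_nonneg) simp
  moreover have nn: "(real n - 2 * real j) * (w S)\<^sup>2 \<ge> 0" for S using j by simp
  ultimately have "(\<Sum>S\<in>?Z. (real n - 2 * real j) * (w S)\<^sup>2) = 0"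
    using eq sum_nonneg[of ?Z "\<lambda>S. (real n - 2 * real j) * (w S)\<^sup>2"] by (meson add_nonneg_eq_0_iff)
  then have "(real n - 2 * real j) * (w S)\<^sup>2 = 0"
    using S nn by (subst (asm) sum_nonneg_eq_0_iff) auto
  then show ?thesis using j by simp
qed

section \<open>The class sum acts on harmonic functions by a scalar\<close>

definition moves :: "nat \<Rightarrow> (nat \<Rightarrow> nat) \<Rightarrow> nat set \<Rightarrow> nat set \<Rightarrow> nat" where
  "moves n g A B = card {h. h permutes {1..n} \<and> conj_by h g -` A = B}"

lemma sum_conj_eq_moves:
  fixes v :: "nat set \<Rightarrow> real"
  assumes g: "g permutes {1..n}" and A: "A \<in> ksubsets n k"
  shows "(\<Sum>h | h permutes {1..n}. v (conj_by h g -` A)) = (\<Sum>B\<in>ksubsets n k. real (moves n g A B) * v B)"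
proof -
  have fin: "finite {h. h permutes {1..n}}" by (rule finite_permutations) simp
  have "(\<Sum>h | h permutes {1..n}. v (conj_by h g -` A))
      = (\<Sum>B\<in>ksubsets n k. \<Sum>h\<in>{h \<in> {h. h permutes {1..n}}. conj_by h g -` A = B}. v (conj_by h g -` A))"
    by (rule sum.group[symmetric, OF fin]) (use A g in \<open>auto intro!: vimage_ksubsets permutes_conj_by\<close>)
  also have "\<dots> = (\<Sum>B\<in>ksubsets n k. real (moves n g A B) * v B)"
    unfolding moves_def by (intro sum.cong) auto
  finally show ?thesis .
qed

lemma moves_vimage:
  assumes x: "x permutes {1..n}"
  shows "moves n g (x -` A) (x -` B) = moves n g A B"
proof -
  have eq: "conj_by (inv' x \<circ> h) g -` (x -` A) = x -` B \<longleftrightarrow> conj_by h g -` A = B" if h: "h permutes {1..n}" for h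
  proof -
    have "conj_by (inv' x \<circ> h) g = inv' x \<circ> conj_by h g \<circ> x"
      using conj_by_compose[OF permutes_inv[OF x] h, of g] x by (simp add: permutes_inv_inv)
    then have "conj_by (inv' x \<circ> h) g -` (x -` A) = x -` (conj_by h g -` A)"
      by (simp add: vimage_comp[symmetric] vimage_inv_permutes[OF x])
    then show ?thesis using vimage_inv_permutes(2)[OF x] by metis
  qed
  have "bij_betw (\<lambda>h. inv' x \<circ> h) {h. h permutes {1..n} \<and> conj_by h g -` A = B}
     {h. h permutes {1..n} \<and> conj_by h g -` (x -` A) = x -` B}"
  proof (rule bij_betw_byWitness[where f' = "\<lambda>h. x \<circ> h"])
    have l: "inv' x \<circ> (x \<circ> h) = h" "x \<circ> (inv' x \<circ> h) = h" for h
      by (simp_all add: fun_eq_iff permutes_inverses[OF x(1)])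
    show "\<forall>h\<in>{h. h permutes {1..n} \<and> conj_by h g -` A = B}. x \<circ> (inv' x \<circ> h) = h"
     "\<forall>h\<in>{h. h permutes {1..n} \<and> conj_by h g -` (x -` A) = x -` B}. inv' x \<circ> (x \<circ> h) = h" by (simp_all only: l simp_thms ball_triv)
    show "(\<lambda>h. inv' x \<circ> h) ` {h. h permutes {1..n} \<and> conj_by h g -` A = B}
      \<subseteq> {h. h permutes {1..n} \<and> conj_by h g -` (x -` A) = x -` B}"
    proof (intro image_subsetI CollectI)
      fix h assume "h \<in> {h. h permutes {1..n} \<and> conj_by h g -` A = B}"
      then have h: "h permutes {1..n}" "conj_by h g -` A = B" by auto
      show "inv' x \<circ> h permutes {1..n} \<and> conj_by (inv' x \<circ> h) g -` (x -` A) = x -` B"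
        using permutes_compose[OF h(1) permutes_inv[OF x]] h(2) eq[OF h(1)] by blast
    qed
    show "(\<lambda>h. x \<circ> h) ` {h. h permutes {1..n} \<and> conj_by h g -` (x -` A) = x -` B}
      \<subseteq> {h. h permutes {1..n} \<and> conj_by h g -` A = B}"
    proof (intro image_subsetI CollectI)
      fix h assume "h \<in> {h. h permutes {1..n} \<and> conj_by h g -` (x -` A) = x -` B}"
      then have h: "h permutes {1..n}" "conj_by h g -` (x -` A) = x -` B" by auto
      have "x \<circ> h permutes {1..n}" by (rule permutes_compose[OF h(1) x])
      then show "x \<circ> h permutes {1..n} \<and> conj_by (x \<circ> h) g -` A = B"
        using eq[of "x \<circ> h"] h(2) unfolding l by blast
    qed
  qed
  then show ?thesis unfolding moves_def by (rule bij_betw_same_card[symmetric])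
qed

text \<open>The sizes of the sets and of their intersection determine how often each of the four
  membership patterns occurs, and a permutation can match points of equal pattern.\<close>

lemma ksubsets_pairs_transitive:
  assumes A: "A \<in> ksubsets n k" "B \<in> ksubsets n k" "A' \<in> ksubsets n k" "B' \<in> ksubsets n k"
    and c: "card (A \<inter> B) = card (A' \<inter> B')"
  obtains x where "x permutes {1..n}" "x -` A = A'" "x -` B = B'"
proof -
  have fib: "card {x \<in> {1..n}. (x \<in> A, x \<in> B) = t} = (case t of (True, True) \<Rightarrow> card (A \<inter> B) | (True, False) \<Rightarrow> k - card (A \<inter> B)
     | (False, True) \<Rightarrow> k - card (A \<inter> B) | (False, False) \<Rightarrow> n - (k + (k - card (A \<inter> B))))"
    if AB: "A \<in> ksubsets n k" "B \<in> ksubsets n k" for A B t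
  proof -
    note D = ksubsetsD[OF AB(1)] ksubsetsD[OF AB(2)]
    have e: "{x \<in> {1..n}. x \<in> A \<and> x \<in> B} = A \<inter> B" "{x \<in> {1..n}. x \<in> A \<and> x \<notin> B} = A - (A \<inter> B)"
      "{x \<in> {1..n}. x \<notin> A \<and> x \<in> B} = B - (A \<inter> B)" "{x \<in> {1..n}. x \<notin> A \<and> x \<notin> B} = {1..n} - (A \<union> (B - (A \<inter> B)))"
      using D by auto
    have "card (A \<union> (B - (A \<inter> B))) = k + (k - card (A \<inter> B))"
      using D by (subst card_Un_disjoint) (auto simp: card_Diff_subset)
    moreover have "A \<union> (B - (A \<inter> B)) \<subseteq> {1..n}" "finite (A \<union> (B - (A \<inter> B)))" using D by auto
    ultimately have "card ({1..n} - (A \<union> (B - (A \<inter> B)))) = n - (k + (k - card (A \<inter> B)))"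
      by (simp only: card_Diff_subset) simp
    then show ?thesis using e D by (auto split: bool.splits prod.splits simp: card_Diff_subset)
  qed
  have "image_mset (\<lambda>x. (x \<in> A', x \<in> B')) (mset_set {1..n}) = image_mset (\<lambda>x. (x \<in> A, x \<in> B)) (mset_set {1..n})"
  proof (rule multiset_eqI)
    fix t
    have *: "count (image_mset f (mset_set {1..n})) t = card {x \<in> {1..n}. f x = t}" for f :: "nat \<Rightarrow> bool \<times> bool"
      by (simp add: count_image_mset Int_def vimage_def conj_commute)
    show "count (image_mset (\<lambda>x. (x \<in> A', x \<in> B')) (mset_set {1..n})) t = count (image_mset (\<lambda>x. (x \<in> A, x \<in> B)) (mset_set {1..n})) t"
      unfolding * fib[OF A(1,2)] fib[OF A(3,4)] c ..
  qed
  from image_mset_eq_implies_permutes[OF finite_atLeastAtMost this]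
  obtain x where x: "x permutes {1..n}" and e: "\<forall>a\<in>{1..n}. (a \<in> A', a \<in> B') = (x a \<in> A, x a \<in> B)"
    by blast
  have "x -` A = A'" "x -` B = B'"
    using e vimage_permutes_subset[OF x ksubsetsD(1)[OF A(1)]] vimage_permutes_subset[OF x ksubsetsD(1)[OF A(2)]]
      ksubsetsD(1)[OF A(3)] ksubsetsD(1)[OF A(4)] by blast+
  then show thesis using that x by blast
qed

text \<open>Let \<open>u i\<close> be the level sum. Adding the harmonic condition over all
  \<open>j\<close>-sets that meet \<open>A\<close> in \<open>i\<close> points gives
  \<open>(i + 1) u (i + 1) + (j + 1 - i) u i = 0\<close>, which is solved downwards from
  \<open>u (j + 1) = v A\<close>.\<close>

lemma harmonic_level_sum:
  assumes v: "harmonic n j v" and A: "A \<in> ksubsets n (Suc j)"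
  shows "i \<le> Suc j \<Longrightarrow> (\<Sum>B | B \<in> ksubsets n (Suc j) \<and> card (A \<inter> B) = i. v B) = (- 1) ^ (Suc j - i) * real (Suc j choose i) * v A"
proof (induction "Suc j - i" arbitrary: i)
  case 0
  then have i: "i = Suc j" by simp
  have "{B \<in> ksubsets n (Suc j). card (A \<inter> B) = Suc j} = {A}"
  proof -
    have "B = A" if B: "B \<in> ksubsets n (Suc j)" "card (A \<inter> B) = Suc j" for B
      using B ksubsetsD[OF A] ksubsetsD[OF B(1)] card_subset_eq[of A "A \<inter> B"] card_subset_eq[of B "A \<inter> B"] by auto
    then show ?thesis using A ksubsetsD[OF A] by auto
  qed
  then show ?case using i by simp
next
  case (Suc d)
  then have i: "i < Suc j" "Suc j - Suc i = d" by auto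
  let ?K = "ksubsets n (Suc j)"
  let ?u = "\<lambda>i. \<Sum>B | B \<in> ?K \<and> card (A \<inter> B) = i. v B"
  have IH: "?u (Suc i) = (- 1) ^ d * real (Suc j choose Suc i) * v A"
    using Suc.hyps(1)[of "Suc i"] i by simp
  \<comment> \<open>A \<open>j\<close>-subset of \<open>B\<close> arises by removing one point,
    which lies in \<open>A\<close> or outside according to the level of \<open>B\<close>.\<close>
  have cnt: "card {S \<in> ksubsets n j. card (S \<inter> A) = i \<and> S \<subseteq> B}
      = (if card (A \<inter> B) = Suc i then Suc i else if card (A \<inter> B) = i then Suc j - i else 0)" if B: "B \<in> ?K" for B
  proof -
    note D = ksubsetsD[OF B]
    have "{S \<in> ksubsets n j. card (S \<inter> A) = i \<and> S \<subseteq> B} = {S. S \<subseteq> B \<and> card S = j \<and> card (S \<inter> A) = i}"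
      using D unfolding ksubsets_def by auto
    then have "card {S \<in> ksubsets n j. card (S \<inter> A) = i \<and> S \<subseteq> B} = card {b \<in> B. card ((B - {b}) \<inter> A) = i}"
      using card_removals[of B j "\<lambda>S. card (S \<inter> A) = i"] D by simp
    also have "{b \<in> B. card ((B - {b}) \<inter> A) = i} = (if card (A \<inter> B) = Suc i then A \<inter> B else if card (A \<inter> B) = i then B - (A \<inter> B) else {})"
    proof -
      have "card ((B - {b}) \<inter> A) = (if b \<in> A then card (A \<inter> B) - 1 else card (A \<inter> B))" if "b \<in> B" for b
      proof -
        have "(B - {b}) \<inter> A = (A \<inter> B) - {b}" by auto
        then show ?thesis using D(3) that by (auto simp: card_Diff_singleton)
      qed
      moreover have "card (A \<inter> B) > 0" if "b \<in> A" "b \<in> B" for b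
        using that D(3) by (auto simp: card_gt_0_iff)
      ultimately have "card ((B - {b}) \<inter> A) = i \<longleftrightarrow> (b \<in> A \<and> card (A \<inter> B) = Suc i) \<or> (b \<notin> A \<and> card (A \<inter> B) = i)"
        if "b \<in> B" for b using that by (cases "b \<in> A") force+
      then show ?thesis by (auto split: if_splits)
    qed
    finally show ?thesis using D by (auto simp: card_Diff_subset)
  qed
  have "0 = (\<Sum>S | S \<in> ksubsets n j \<and> card (S \<inter> A) = i. \<Sum>B\<in>supersets n (Suc j) S. v B)"
    using v unfolding harmonic_def by simp
  also have "\<dots> = (\<Sum>S | S \<in> ksubsets n j \<and> card (S \<inter> A) = i. \<Sum>B | B \<in> ?K \<and> S \<subseteq> B. v B)"
    unfolding supersets_def by simp
  also have "\<dots> = (\<Sum>B\<in>?K. \<Sum>S | S \<in> {S \<in> ksubsets n j. card (S \<inter> A) = i} \<and> S \<subseteq> B. v B)"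
    by (subst sum.swap_restrict) auto
  also have "\<dots> = (\<Sum>B\<in>?K. real (if card (A \<inter> B) = Suc i then Suc i else if card (A \<inter> B) = i then Suc j - i else 0) * v B)"
    using cnt by (intro sum.cong refl) simp
  also have "\<dots> = (\<Sum>B\<in>?K. (if card (A \<inter> B) = Suc i then real (Suc i) * v B else 0) + (if card (A \<inter> B) = i then real (Suc j - i) * v B else 0))"
    by (intro sum.cong) auto
  also have "\<dots> = real (Suc i) * ?u (Suc i) + real (Suc j - i) * ?u i"
    by (simp add: sum.distrib sum_distrib_left sum.inter_filter[symmetric])
  finally have "real (Suc j - i) * ?u i = - (real (Suc i) * ((- 1) ^ d * real (Suc j choose Suc i) * v A))"
    unfolding IH by simp
  also have "\<dots> = (- 1) ^ Suc d * (real (Suc i * (Suc j choose Suc i))) * v A"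
    by (simp add: algebra_simps del: binomial_Suc_Suc)
  also have "Suc i * (Suc j choose Suc i) = (Suc j - i) * (Suc j choose i)"
    using binomial_absorption[of i "Suc j"] binomial_absorb_comp[of "Suc j" i] by simp
  finally have "real (Suc j - i) * ?u i = real (Suc j - i) * ((- 1) ^ Suc d * real (Suc j choose i) * v A)"
    by (simp add: mult_ac)
  then show ?case using i(1) Suc.hyps(2) by simp
qed

text \<open>By transitivity the matrix entries of the class sum depend only on the size of the
  intersection, and the level sums of a harmonic function are fixed multiples of \<open>v A\<close>.
  Hence the scalar is the same for all \<open>v\<close> and \<open>A\<close>.\<close>

lemma harmonic_eigen:
  assumes g: "g permutes {1..n}"
  obtains \<omega> :: real where "\<And>v A. harmonic n j v \<Longrightarrow> A \<in> ksubsets n (Suc j) \<Longrightarrow>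
    (\<Sum>h | h permutes {1..n}. v (conj_by h g -` A)) = \<omega> * v A"
proof -
  let ?K = "ksubsets n (Suc j)"
  define \<kappa> where "\<kappa> i = (SOME m. \<exists>A\<in>?K. \<exists>B\<in>?K. card (A \<inter> B) = i \<and> m = moves n g A B)" for i
  have \<kappa>: "moves n g A B = \<kappa> (card (A \<inter> B))" if AB: "A \<in> ?K" "B \<in> ?K" for A B
  proof -
    have "\<exists>m. \<exists>A'\<in>?K. \<exists>B'\<in>?K. card (A' \<inter> B') = card (A \<inter> B) \<and> m = moves n g A' B'" using AB by blast
    from someI_ex[OF this] obtain A' B' where A': "A' \<in> ?K" "B' \<in> ?K" "card (A' \<inter> B') = card (A \<inter> B)"
      and m: "\<kappa> (card (A \<inter> B)) = moves n g A' B'" unfolding \<kappa>_def by blast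
    from ksubsets_pairs_transitive[OF A'(1,2) AB A'(3)] obtain x where
      "x permutes {1..n}" "x -` A' = A" "x -` B' = B" by blast
    then show ?thesis using m moves_vimage[of x n g A' B'] by simp
  qed
  define \<omega> where "\<omega> = (\<Sum>i\<le>Suc j. real (\<kappa> i) * ((- 1) ^ (Suc j - i) * real (Suc j choose i)))"
  show thesis
  proof (rule that)
    fix v A assume v: "harmonic n j v" and A: "A \<in> ?K"
    have "(\<Sum>h | h permutes {1..n}. v (conj_by h g -` A)) = (\<Sum>B\<in>?K. real (\<kappa> (card (A \<inter> B))) * v B)"
      using sum_conj_eq_moves[OF g A, of v] \<kappa>[OF A] by simp
    also have "\<dots> = (\<Sum>i\<le>Suc j. \<Sum>B | B \<in> ?K \<and> card (A \<inter> B) = i. real (\<kappa> (card (A \<inter> B))) * v B)"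
    proof (rule sum.group[symmetric])
      show "(\<lambda>B. card (A \<inter> B)) ` ?K \<subseteq> {..Suc j}"
        using ksubsetsD[OF A] card_mono[of A "A \<inter> B" for B] by auto
    qed auto
    also have "\<dots> = (\<Sum>i\<le>Suc j. real (\<kappa> i) * (\<Sum>B | B \<in> ?K \<and> card (A \<inter> B) = i. v B))"
      by (simp add: sum_distrib_left)
    also have "\<dots> = \<omega> * v A"
      unfolding \<omega>_def sum_distrib_right using harmonic_level_sum[OF v A] by (intro sum.cong) auto
    finally show "(\<Sum>h | h permutes {1..n}. v (conj_by h g -` A)) = \<omega> * v A" .
  qed
qed

lemma vimage_conj_by_fixed:
  assumes "h permutes X"
  shows "conj_by h g -` A = A \<longleftrightarrow> g -` (h -` A) = h -` A"
proof -
  have "conj_by h g -` A = inv' h -` (g -` (h -` A))" unfolding conj_by_def by (simp add: vimage_comp comp_assoc)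
  then show ?thesis using vimage_inv_permutes[OF assms] by metis
qed

lemma card_fixed_conj:
  assumes h: "h permutes {1..n}"
  shows "card {A \<in> ksubsets n k. conj_by h g -` A = A} = card {A \<in> ksubsets n k. g -` A = A}"
proof -
  have "real (card {A \<in> ksubsets n k. g -` A = A}) = (\<Sum>A\<in>ksubsets n k. of_bool (g -` A = A))"
    by (simp add: Int_def)
  also have "\<dots> = (\<Sum>A\<in>ksubsets n k. of_bool (g -` (h -` A) = h -` A))"
    by (rule sum_vimage_ksubsets[OF h, symmetric])
  also have "\<dots> = real (card {A \<in> ksubsets n k. conj_by h g -` A = A})"
    by (simp add: Int_def vimage_conj_by_fixed[OF h])
  finally show ?thesis by simp
qed

text \<open>As \<open>\<psi>\<close> inverts the matrix of common supersets, the inner double sum is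
  the kernel of a projection onto the functions lifted from \<open>j\<close>-subsets. These form a
  copy of the permutation module on \<open>j\<close>-subsets, so the trace of \<open>c\<close> is
  the number of fixed \<open>j\<close>-subsets.\<close>

lemma harmonic_kernel_trace:
  fixes \<psi> :: "nat set \<Rightarrow> nat set \<Rightarrow> real"
  assumes \<psi>: "\<And>S R. S \<in> ksubsets n j \<Longrightarrow> R \<in> ksubsets n j \<Longrightarrow>
      (\<Sum>T\<in>ksubsets n j. real (card (supersets n (Suc j) (S \<union> T))) * \<psi> T R) = (if S = R then 1 else 0)"
    and c: "c permutes {1..n}"
  shows "(\<Sum>A\<in>ksubsets n (Suc j). \<Sum>S | S \<in> ksubsets n j \<and> S \<subseteq> c -` A. \<Sum>T | T \<in> ksubsets n j \<and> T \<subseteq> A. \<psi> S T)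
    = real (card {T \<in> ksubsets n j. c -` T = T})"
proof -
  let ?Z = "ksubsets n j" and ?Y = "ksubsets n (Suc j)"
  have "(\<Sum>A\<in>?Y. \<Sum>S | S \<in> ?Z \<and> S \<subseteq> c -` A. \<Sum>T | T \<in> ?Z \<and> T \<subseteq> A. \<psi> S T)
    = (\<Sum>A\<in>?Y. \<Sum>S\<in>?Z. \<Sum>T\<in>?Z. of_bool (S \<subseteq> c -` A \<and> T \<subseteq> A) * \<psi> S T)"
  proof (rule sum.cong[OF refl])
    fix A
    have "(\<Sum>S | S \<in> ?Z \<and> S \<subseteq> c -` A. \<Sum>T | T \<in> ?Z \<and> T \<subseteq> A. \<psi> S T)
      = (\<Sum>S\<in>?Z. of_bool (S \<subseteq> c -` A) * (\<Sum>T | T \<in> ?Z \<and> T \<subseteq> A. \<psi> S T))"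
      by (rule sum.mono_neutral_cong_left) auto
    also have "\<dots> = (\<Sum>S\<in>?Z. of_bool (S \<subseteq> c -` A) * (\<Sum>T\<in>?Z. of_bool (T \<subseteq> A) * \<psi> S T))"
    proof -
      have "(\<Sum>T | T \<in> ?Z \<and> T \<subseteq> A. \<psi> S T) = (\<Sum>T\<in>?Z. of_bool (T \<subseteq> A) * \<psi> S T)" for S
        by (rule sum.mono_neutral_cong_left) auto
      then show ?thesis by simp
    qed
    also have "\<dots> = (\<Sum>S\<in>?Z. \<Sum>T\<in>?Z. of_bool (S \<subseteq> c -` A \<and> T \<subseteq> A) * \<psi> S T)"
      by (simp only: sum_distrib_left of_bool_conj mult.assoc)
    finally show "(\<Sum>S | S \<in> ?Z \<and> S \<subseteq> c -` A. \<Sum>T | T \<in> ?Z \<and> T \<subseteq> A. \<psi> S T)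
      = (\<Sum>S\<in>?Z. \<Sum>T\<in>?Z. of_bool (S \<subseteq> c -` A \<and> T \<subseteq> A) * \<psi> S T)" .
  qed
  also have "\<dots> = (\<Sum>S\<in>?Z. \<Sum>A\<in>?Y. \<Sum>T\<in>?Z. of_bool (S \<subseteq> c -` A \<and> T \<subseteq> A) * \<psi> S T)"
    by (rule sum.swap)
  also have "\<dots> = (\<Sum>S\<in>?Z. \<Sum>T\<in>?Z. \<Sum>A\<in>?Y. of_bool (S \<subseteq> c -` A \<and> T \<subseteq> A) * \<psi> S T)"
    by (rule sum.cong[OF refl], rule sum.swap)
  also have "\<dots> = (\<Sum>T\<in>?Z. \<Sum>S\<in>?Z. \<Sum>A\<in>?Y. of_bool (S \<subseteq> c -` A \<and> T \<subseteq> A) * \<psi> S T)"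
    by (rule sum.swap)
  \<comment> \<open>Replacing \<open>A\<close> by its preimage counts the common supersets of
    \<open>S\<close> and of the preimage of \<open>T\<close>; afterwards \<open>\<psi>\<close>
    collapses the sum over \<open>S\<close>.\<close>
  also have "\<dots> = (\<Sum>T\<in>?Z. \<Sum>S\<in>?Z. real (card (supersets n (Suc j) (c -` T \<union> S))) * \<psi> S T)"
  proof (intro sum.cong refl)
    fix S T
    have "(\<Sum>A\<in>?Y. of_bool (S \<subseteq> c -` A \<and> T \<subseteq> A)) = (\<Sum>A\<in>?Y. of_bool (c -` T \<union> S \<subseteq> c -` A) :: real)"
    proof (intro sum.cong refl)
      fix A
      have "T \<subseteq> A \<longleftrightarrow> c -` T \<subseteq> c -` A" using permutes_surj[OF c] by (metis surj_image_vimage_eq image_mono vimage_mono)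
      then show "of_bool (S \<subseteq> c -` A \<and> T \<subseteq> A) = (of_bool (c -` T \<union> S \<subseteq> c -` A) :: real)" by auto
    qed
    also have "\<dots> = (\<Sum>A\<in>?Y. of_bool (c -` T \<union> S \<subseteq> A))"
      by (rule sum_vimage_ksubsets[OF c])
    also have "\<dots> = real (card (supersets n (Suc j) (c -` T \<union> S)))"
      unfolding supersets_def by (simp add: Int_def)
    finally show "(\<Sum>A\<in>?Y. of_bool (S \<subseteq> c -` A \<and> T \<subseteq> A) * \<psi> S T) = real (card (supersets n (Suc j) (c -` T \<union> S))) * \<psi> S T"
      by (simp add: sum_distrib_right)
  qed
  also have "\<dots> = (\<Sum>T\<in>?Z. if c -` T = T then 1 else 0)"
    using \<psi> c by (intro sum.cong refl) simp
  also have "\<dots> = real (card {T \<in> ?Z. c -` T = T})" by (simp add: sum.If_cases Int_def)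
  finally show ?thesis .
qed

text \<open>The projection \<open>P\<close> onto harmonic functions has trace
  \<open>(n choose Suc j) - (n choose j)\<close>, positive since \<open>2 * Suc j \<le> n\<close>.
  The trace of the class sum on its image is \<open>\<omega>\<close> times this number and, counted
  by fixed sets, zero by \<open>eq\<close>. So \<open>\<omega> = 0\<close>, and any nonzero column
  of \<open>P\<close> is a vector that is killed.\<close>

lemma two_row_vanishing:
  assumes G: "sym_or_alt n G" and gG: "g \<in> carrier G" and n: "n \<ge> 5" and k: "2 * Suc j \<le> n"
    and eq: "card {A \<in> ksubsets n (Suc j). g -` A = A} = card {A \<in> ksubsets n j. g -` A = A}"
  shows "vanishing G g"
proof -
  let ?Z = "ksubsets n j" and ?Y = "ksubsets n (Suc j)"
  let ?S = "{h. h permutes {1..n}}"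
  note g = sym_or_alt_carrier[OF G gG]
  obtain \<psi> where \<psi>: "\<And>S R. S \<in> ?Z \<Longrightarrow> R \<in> ?Z \<Longrightarrow>
      (\<Sum>T\<in>?Z. real (card (supersets n (Suc j) (S \<union> T))) * \<psi> T R) = (if S = R then 1 else 0)"
  proof (rule kernel_inverse[of ?Z "\<lambda>S T. real (card (supersets n (Suc j) (S \<union> T)))"])
    show "w S = 0" if "\<And>S. S \<in> ?Z \<Longrightarrow> (\<Sum>T\<in>?Z. real (card (supersets n (Suc j) (S \<union> T))) * w T) = 0" "S \<in> ?Z" for w S
      by (rule supersets_kernel_injective[OF _ that]) (use k in auto)
  qed auto
  \<comment> \<open>The identity minus the projection onto lifted functions.\<close>
  define P where "P B A = of_bool (A = B) - (\<Sum>S | S \<in> ?Z \<and> S \<subseteq> B. \<Sum>T | T \<in> ?Z \<and> T \<subseteq> A. \<psi> S T)" for A B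
  have Pc: "(\<Sum>A\<in>?Y. P (c -` A) A) = real (card {A \<in> ?Y. c -` A = A}) - real (card {T \<in> ?Z. c -` T = T})"
    if c: "c permutes {1..n}" for c
  proof -
    have "(\<Sum>A\<in>?Y. of_bool (A = c -` A)) = real (card {A \<in> ?Y. c -` A = A})"
      by (simp add: Int_def eq_commute)
    then show ?thesis using harmonic_kernel_trace[OF \<psi> c] unfolding P_def sum_subtractf by simp
  qed
  have harm: "harmonic n j (\<lambda>B. P B A)" if A: "A \<in> ?Y" for A
    unfolding harmonic_def
  proof
    fix S0 assume S0: "S0 \<in> ?Z"
    have fs: "finite (supersets n (Suc j) S0)" unfolding supersets_def by simp
    have "(\<Sum>B\<in>supersets n (Suc j) S0. \<Sum>S | S \<in> ?Z \<and> S \<subseteq> B. \<Sum>T | T \<in> ?Z \<and> T \<subseteq> A. \<psi> S T)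
      = (\<Sum>S\<in>?Z. \<Sum>B | B \<in> supersets n (Suc j) S0 \<and> S \<subseteq> B. \<Sum>T | T \<in> ?Z \<and> T \<subseteq> A. \<psi> S T)"
      by (rule sum.swap_restrict) (use fs in auto)
    also have "\<dots> = (\<Sum>S\<in>?Z. \<Sum>T | T \<in> ?Z \<and> T \<subseteq> A. real (card (supersets n (Suc j) (S0 \<union> S))) * \<psi> S T)"
    proof (rule sum.cong[OF refl])
      fix S
      have "{B \<in> supersets n (Suc j) S0. S \<subseteq> B} = supersets n (Suc j) (S0 \<union> S)" unfolding supersets_def by auto
      then show "(\<Sum>B | B \<in> supersets n (Suc j) S0 \<and> S \<subseteq> B. \<Sum>T | T \<in> ?Z \<and> T \<subseteq> A. \<psi> S T)
        = (\<Sum>T | T \<in> ?Z \<and> T \<subseteq> A. real (card (supersets n (Suc j) (S0 \<union> S))) * \<psi> S T)"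
        by (simp add: sum_distrib_left)
    qed
    also have "\<dots> = (\<Sum>T | T \<in> ?Z \<and> T \<subseteq> A. if S0 = T then 1 else 0)"
      by (subst sum.swap) (intro sum.cong refl, use \<psi> S0 in auto)
    also have "\<dots> = of_bool (S0 \<subseteq> A)" using S0 by (simp add: sum.If_cases Int_def)
    finally have "(\<Sum>B\<in>supersets n (Suc j) S0. P B A) = (\<Sum>B\<in>supersets n (Suc j) S0. of_bool (A = B)) - of_bool (S0 \<subseteq> A)"
      unfolding P_def sum_subtractf by simp
    also have "(\<Sum>B\<in>supersets n (Suc j) S0. of_bool (A = B)) = (of_bool (A \<in> supersets n (Suc j) S0) :: real)"
      using fs by (simp add: of_bool_def)
    finally show "(\<Sum>B\<in>supersets n (Suc j) S0. P B A) = 0" using A unfolding supersets_def by simp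
  qed
  obtain \<omega> where \<omega>: "\<And>v A. harmonic n j v \<Longrightarrow> A \<in> ?Y \<Longrightarrow> (\<Sum>h\<in>?S. v (conj_by h g -` A)) = \<omega> * v A"
    using harmonic_eigen[OF g, of j] by blast
  have trP: "(\<Sum>A\<in>?Y. P A A) > 0"
  proof -
    have "(\<Sum>A\<in>?Y. P A A) = real (card ?Y) - real (card ?Z)" using Pc[OF permutes_id] by simp
    then show ?thesis unfolding card_ksubsets using binomial_strict_mono[of j "Suc j" n] k by simp
  qed
  have "\<omega> * (\<Sum>A\<in>?Y. P A A) = (\<Sum>A\<in>?Y. \<Sum>h\<in>?S. P (conj_by h g -` A) A)"
    unfolding sum_distrib_left using \<omega>[OF harm] by (intro sum.cong) auto
  also have "\<dots> = (\<Sum>h\<in>?S. \<Sum>A\<in>?Y. P (conj_by h g -` A) A)" by (rule sum.swap)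
  also have "\<dots> = 0"
    by (rule sum.neutral) (use Pc[OF permutes_conj_by[OF _ g]] card_fixed_conj eq in auto)
  finally have \<omega>0: "\<omega> = 0" using trP by simp
  have "\<exists>A0\<in>?Y. P A0 A0 \<noteq> 0"
  proof (rule ccontr)
    assume "\<not> ?thesis"
    then have "(\<Sum>A\<in>?Y. P A A) = 0" by (intro sum.neutral) auto
    then show False using trP by simp
  qed
  then obtain A0 where A0: "A0 \<in> ?Y" "P A0 A0 \<noteq> 0" by blast
  show ?thesis
  proof (rule vanishing_sym_or_alt[OF G gG, where act = "\<lambda>x A. x -` A" and Y = ?Y and v = "\<lambda>B. P B A0" and ?y0.0 = A0])
    fix A assume A: "A \<in> ?Y"
    show "(\<Sum>h\<in>?S. P (conj_by h g -` A) A0) = 0" using \<omega>[OF harm[OF A0(1)] A] \<omega>0 by simp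
    let ?E = "{h. h permutes {1..n} \<and> evenperm h}"
    have finS: "finite ?S" "finite ?E" by (auto simp: finite_permutations)
    have "(\<Sum>h\<in>?S. P (conj_by h g -` A) A0) = (\<Sum>B\<in>?Y. \<Sum>h\<in>?S. of_bool (conj_by h g -` A = B) * P B A0)"
    proof (subst sum.swap, intro sum.cong refl)
      fix h assume "h \<in> ?S"
      then have m: "conj_by h g -` A \<in> ?Y" using A g by (auto intro!: vimage_ksubsets permutes_conj_by)
      have "(\<Sum>B\<in>?Y. of_bool (conj_by h g -` A = B) * P B A0) = (\<Sum>B\<in>?Y. if conj_by h g -` A = B then P B A0 else 0)"
        by (intro sum.cong) auto
      then show "P (conj_by h g -` A) A0 = (\<Sum>B\<in>?Y. of_bool (conj_by h g -` A = B) * P B A0)" using m by simp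
    qed
    also have "\<dots> = (\<Sum>B\<in>?Y. 2 * (\<Sum>h\<in>?E. of_bool (conj_by h g -` A = B) * P B A0))"
    proof (intro sum.cong refl)
      fix B assume B: "B \<in> ?Y"
      \<comment> \<open>At least five points share four membership patterns, so two points look
        alike to \<open>A\<close> and \<open>B\<close>. Their transposition is odd and fixes both
        sets, which gives the halving one matrix entry at a time.\<close>
      have "\<not> inj_on (\<lambda>x. (x \<in> A, x \<in> B)) {1..n}"
      proof
        assume "inj_on (\<lambda>x. (x \<in> A, x \<in> B)) {1..n}"
        then have "card {1..n} \<le> card (UNIV :: (bool \<times> bool) set)" by (intro card_inj_on_le) auto
        then show False using n by (simp add: card_UNIV_bool card_cartesian_product UNIV_Times_UNIV[symmetric] del: UNIV_Times_UNIV)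
      qed
      then obtain a b where ab: "a \<in> {1..n}" "b \<in> {1..n}" "a \<noteq> b" "a \<in> A \<longleftrightarrow> b \<in> A" "a \<in> B \<longleftrightarrow> b \<in> B"
        unfolding inj_on_def by blast
      let ?t = "transpose a b"
      have t: "?t permutes {1..n}" "\<not> evenperm ?t" using ab by (auto simp: permutes_swap_id evenperm_swap)
      have tAB: "?t -` A = A" "?t -` B = B" using ab by (auto simp: transpose_def split: if_splits)
      have tt: "inv' ?t = ?t" by simp
      show "(\<Sum>h\<in>?S. of_bool (conj_by h g -` A = B) * P B A0) = 2 * (\<Sum>h\<in>?E. of_bool (conj_by h g -` A = B) * P B A0)"
      proof (rule sum_permutes_eq_double_even[OF _ bij_betw_compose_odd(2)[OF _ t]])
        fix h assume h: "h permutes {1..n}"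
        have "conj_by (?t \<circ> h) g -` A = ?t -` (conj_by h g -` (?t -` A))"
          unfolding conj_by_compose[OF t(1) h] tt by (simp add: vimage_comp comp_assoc)
        then have "conj_by (?t \<circ> h) g -` A = B \<longleftrightarrow> conj_by h g -` A = B"
          using vimage_inv_permutes(2)[OF t(1)] tAB unfolding tt by metis
        then show "of_bool (conj_by (?t \<circ> h) g -` A = B) * P B A0 = of_bool (conj_by h g -` A = B) * P B A0" by simp
      qed auto
    qed
    also have "\<dots> = 2 * (\<Sum>h\<in>?E. \<Sum>B\<in>?Y. of_bool (conj_by h g -` A = B) * P B A0)"
      by (subst sum.swap) (simp add: sum_distrib_left)
    also have "\<dots> = 2 * (\<Sum>h\<in>?E. P (conj_by h g -` A) A0)"
    proof -
      have "(\<Sum>B\<in>?Y. of_bool (conj_by h g -` A = B) * P B A0) = P (conj_by h g -` A) A0" if "h \<in> ?E" for h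
      proof -
        have m: "conj_by h g -` A \<in> ?Y" using A g that by (auto intro!: vimage_ksubsets permutes_conj_by)
        have "(\<Sum>B\<in>?Y. of_bool (conj_by h g -` A = B) * P B A0) = (\<Sum>B\<in>?Y. if conj_by h g -` A = B then P B A0 else 0)"
          by (intro sum.cong) auto
        then show ?thesis using m by simp
      qed
      then show ?thesis by simp
    qed
    finally show "(\<Sum>h\<in>?S. P (conj_by h g -` A) A0) = 2 * (\<Sum>h\<in>?E. P (conj_by h g -` A) A0)" .
  qed (use A0 in \<open>auto simp: vimage_comp intro!: vimage_ksubsets\<close>)
qed

section \<open>Polytabloids\<close>

definition rowpairs :: "nat \<Rightarrow> (nat \<times> nat) set" where
  "rowpairs m = {(a, b). a < b \<and> b < m}"

text \<open>The sign of the Vandermonde product of the labels: plus or minus 1 if they are distinct,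
  and 0 otherwise.\<close>

definition vand :: "nat \<Rightarrow> (nat \<Rightarrow> nat) \<Rightarrow> int" where
  "vand m l = (\<Prod>(a,b)\<in>rowpairs m. sgn (int (l b) - int (l a)))"

lemma finite_rowpairs [simp]: "finite (rowpairs m)"
  unfolding rowpairs_def by (rule finite_subset[of _ "{..<m} \<times> {..<m}"]) auto

definition inv_sign :: "nat \<Rightarrow> (nat \<Rightarrow> nat) \<Rightarrow> int" where
  "inv_sign m p = (\<Prod>(a,b)\<in>rowpairs m. if p a < p b then 1 else - 1)"

text \<open>Sorting the image of each pair permutes the pairs, and a factor changes sign exactly at
  the inversions of \<open>p\<close>.\<close>

lemma vand_permute:
  assumes p: "p permutes {..<m}"
  shows "vand m (l \<circ> p) = inv_sign m p * vand m l"
proof -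
  define \<theta> :: "(nat \<Rightarrow> nat) \<Rightarrow> nat \<times> nat \<Rightarrow> nat \<times> nat" where "\<theta> = (\<lambda>q (a,b). if q a < q b then (q a, q b) else (q b, q a))"
  have \<theta>: "\<theta> q \<in> rowpairs m \<rightarrow> rowpairs m" if q: "q permutes {..<m}" for q
  proof
    fix ab assume "ab \<in> rowpairs m"
    then obtain a b where ab: "ab = (a,b)" "a < b" "b < m" unfolding rowpairs_def by auto
    have "q a \<noteq> q b" using permutes_inj[OF q] ab by (simp add: inj_eq)
    moreover have "q a < m" "q b < m" using permutes_in_image[OF q] ab by auto
    ultimately show "\<theta> q ab \<in> rowpairs m" using ab unfolding \<theta>_def rowpairs_def by auto
  qed
  have \<theta>i: "\<theta> q' (\<theta> q ab) = ab" if "ab \<in> rowpairs m" "\<And>x. q' (q x) = x" for q q' ab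
    using that unfolding \<theta>_def rowpairs_def by (auto split: prod.splits if_splits)
  have bij: "bij_betw (\<theta> p) (rowpairs m) (rowpairs m)"
    by (rule bij_betw_byWitness[where f' = "\<theta> (inv' p)"])
      (use \<theta>[OF p] \<theta>[OF permutes_inv[OF p]] \<theta>i permutes_inverses[OF p] in \<open>auto simp: Pi_def\<close>)
  let ?g = "\<lambda>(a,b). sgn (int (l b) - int (l a))"
  have "vand m (l \<circ> p) = (\<Prod>ab\<in>rowpairs m. (case ab of (a,b) \<Rightarrow> if p a < p b then 1 else - 1) * ?g (\<theta> p ab))"
    unfolding vand_def
  proof (rule prod.cong[OF refl])
    fix ab assume "ab \<in> rowpairs m"
    show "(case ab of (a,b) \<Rightarrow> sgn (int ((l \<circ> p) b) - int ((l \<circ> p) a)))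
      = (case ab of (a,b) \<Rightarrow> if p a < p b then 1 else - 1) * ?g (\<theta> p ab)"
      unfolding \<theta>_def by (cases ab) (auto simp: sgn_if)
  qed
  also have "\<dots> = inv_sign m p * (\<Prod>ab\<in>rowpairs m. ?g (\<theta> p ab))"
    unfolding inv_sign_def by (rule prod.distrib)
  also have "(\<Prod>ab\<in>rowpairs m. ?g (\<theta> p ab)) = vand m l"
    unfolding vand_def by (rule prod.reindex_bij_betw[OF bij])
  finally show ?thesis .
qed

lemma inv_sign_transpose:
  assumes ij: "i < j" "j < m"
  shows "inv_sign m (transpose i j) = - 1"
proof -
  let ?t = "transpose i j" and ?M = "{i<..<j}"
  let ?I = "{(a,b) \<in> rowpairs m. \<not> ?t a < ?t b}"
  \<comment> \<open>The inversions are the pair itself and, for every point strictly between, one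
    pair with either end.\<close>
  have "?I = insert (i,j) (Pair i ` ?M \<union> (\<lambda>c. (c,j)) ` ?M)"
    using ij unfolding rowpairs_def by (auto simp: transpose_def split: if_splits)
  moreover have "card (insert (i,j) (Pair i ` ?M \<union> (\<lambda>c. (c,j)) ` ?M)) = Suc (2 * card ?M)"
  proof -
    have "card (Pair i ` ?M \<union> (\<lambda>c. (c,j)) ` ?M) = 2 * card ?M"
      by (subst card_Un_disjoint) (auto simp: card_image inj_on_def)
    moreover have "(i,j) \<notin> Pair i ` ?M \<union> (\<lambda>c. (c,j)) ` ?M" by auto
    ultimately show ?thesis by simp
  qed
  ultimately have cI: "card ?I = Suc (2 * card ?M)" by simp
  have "inv_sign m ?t = (\<Prod>ab\<in>rowpairs m. if ab \<in> ?I then - 1 else 1)"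
    unfolding inv_sign_def by (rule prod.cong) (auto split: prod.splits)
  also have "\<dots> = (\<Prod>ab\<in>?I. - 1)"
    by (rule prod.mono_neutral_cong_right) auto
  also have "\<dots> = - 1" unfolding prod_constant cI by simp
  finally show ?thesis .
qed

lemma vand_nonzero_iff: "vand m l \<noteq> 0 \<longleftrightarrow> inj_on l {..<m}"
proof -
  have "vand m l \<noteq> 0 \<longleftrightarrow> (\<forall>a b. a < b \<and> b < m \<longrightarrow> l a \<noteq> l b)"
    unfolding vand_def by (simp add: prod_zero_iff) (auto simp: rowpairs_def sgn_eq_0_iff dest: sym)
  also have "\<dots> \<longleftrightarrow> inj_on l {..<m}"
    unfolding inj_on_def by (auto, metis less_trans linorder_neqE_nat)
  finally show ?thesis .
qed

text \<open>\<open>ls\<close> lists only the antisymmetrised columns; every other point lies in row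
  0, in a column of length one.\<close>

definition boxes :: "nat list \<Rightarrow> (nat \<times> nat) set" where
  "boxes ls = {(c, r). c < length ls \<and> r < ls ! c}"

text \<open>The coefficient of the polytabloid at the tabloid in which the point of box
  \<open>b\<close> lies in row \<open>y b\<close>.\<close>

definition vandprod :: "nat list \<Rightarrow> (nat \<times> nat \<Rightarrow> nat) \<Rightarrow> int" where
  "vandprod ls y = (\<Prod>c<length ls. vand (ls ! c) (\<lambda>r. y (c, r)))"

definition Injs :: "'b set \<Rightarrow> 'a set \<Rightarrow> ('b \<Rightarrow> 'a) set" where
  "Injs B X = {q \<in> B \<rightarrow>\<^sub>E X. inj_on q B}"

text \<open>The tabloid of the placement \<open>q\<close>. The default 0 puts the points outside all
  boxes into the first row.\<close>

definition hit_row :: "(nat \<times> nat) set \<Rightarrow> (nat \<times> nat \<Rightarrow> 'a) \<Rightarrow> 'a \<Rightarrow> nat" where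
  "hit_row B q x = (if x \<in> q ` B then snd (inv_into B q x) else 0)"

lemma hit_row_eq: "inj_on q B \<Longrightarrow> b \<in> B \<Longrightarrow> hit_row B q (q b) = snd b"
  unfolding hit_row_def by simp

lemma boxes_Sigma: "boxes ls = (SIGMA c:{..<length ls}. {..<ls ! c})"
  unfolding boxes_def by auto

lemma finite_boxes [simp]: "finite (boxes ls)"
  unfolding boxes_Sigma by simp

lemma finite_Injs [simp]: "finite B \<Longrightarrow> finite X \<Longrightarrow> finite (Injs B X)"
  unfolding Injs_def by (rule finite_subset[of _ "B \<rightarrow>\<^sub>E X"]) (auto intro: finite_PiE)

lemma card_boxes: "card (boxes ls) = sum_list ls"
  unfolding boxes_Sigma by (simp add: sum_list_sum_nth atLeast0LessThan)

text \<open>Induction on the label \<open>r\<close>: a block of at most \<open>r\<close> points is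
  already filled with the labels below its size, so \<open>r\<close> occurs only in larger blocks,
  at most once in each. The count then forces it to occur in every one of them.\<close>

lemma content_rigid:
  fixes y :: "'a \<Rightarrow> nat" and D :: "'a set set"
  assumes fin: "finite D" "\<And>d. d \<in> D \<Longrightarrow> finite d" and disj: "\<And>d e. d \<in> D \<Longrightarrow> e \<in> D \<Longrightarrow> d \<noteq> e \<Longrightarrow> d \<inter> e = {}"
    and inj: "\<And>d. d \<in> D \<Longrightarrow> inj_on y d"
    and cont: "\<And>r. card {x \<in> \<Union>D. y x = r} = card {d \<in> D. r < card d}"
  shows "d \<in> D \<Longrightarrow> y ` d = {..<card d}"
proof -
  have full: "y ` d = {..<card d}" if "d \<in> D" "\<And>r. r < card d \<Longrightarrow> r \<in> y ` d" for d
  proof -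
    have "{..<card d} \<subseteq> y ` d" using that by auto
    moreover have "card (y ` d) = card {..<card d}" using card_image[OF inj[OF that(1)]] by simp
    ultimately show ?thesis using card_subset_eq[of "y ` d" "{..<card d}"] fin(2)[OF that(1)] by simp
  qed
  have "\<forall>d\<in>D. r < card d \<longrightarrow> r \<in> y ` d" for r
  proof (induction r rule: less_induct)
    case (less r)
    let ?f = "\<lambda>d. {x \<in> d. y x = r}"
    have small: "?f d = {}" if "d \<in> D" "\<not> r < card d" for d
    proof -
      have "y ` d = {..<card d}" by (rule full) (use that less in force)+
      then show ?thesis using that by auto
    qed
    have le1: "card (?f d) \<le> 1" if "d \<in> D" for d
      using inj[OF that] fin(2)[OF that] unfolding One_nat_def card_le_Suc0_iff_eq[OF finite_subset[OF _ fin(2)[OF that]], of "?f d", simplified]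
      by (auto simp: inj_on_def)
    have "(\<Sum>d | d \<in> D \<and> r < card d. 1 - card (?f d)) + (\<Sum>d | d \<in> D \<and> r < card d. card (?f d)) = card {d \<in> D. r < card d}"
      unfolding sum.distrib[symmetric] using le1 by simp
    moreover have "(\<Sum>d | d \<in> D \<and> r < card d. card (?f d)) = card {x \<in> \<Union>D. y x = r}"
    proof -
      have "{x \<in> \<Union>D. y x = r} = (\<Union>d\<in>{d \<in> D. r < card d}. ?f d)" using small by auto
      also have "card \<dots> = (\<Sum>d | d \<in> D \<and> r < card d. card (?f d))"
        by (rule card_UN_disjoint) (use fin disj in auto)
      finally show ?thesis by simp
    qed
    ultimately have "(\<Sum>d | d \<in> D \<and> r < card d. 1 - card (?f d)) = 0" using cont by simp
    then have "\<forall>d\<in>D. r < card d \<longrightarrow> 1 - card (?f d) = 0" using fin by auto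
    then have "\<forall>d\<in>D. r < card d \<longrightarrow> ?f d \<noteq> {}" by (metis card.empty diff_zero zero_neq_one)
    then show ?case by blast
  qed
  then show "d \<in> D \<Longrightarrow> y ` d = {..<card d}" using full by blast
qed

lemma ex_permutes_extending:
  assumes X: "finite X" and B: "B \<subseteq> X" and q: "inj_on q B" "q ` B \<subseteq> X"
  obtains h where "h permutes X" "\<And>b. b \<in> B \<Longrightarrow> h b = q b"
proof -
  have "card (X - B) = card (X - q ` B)"
    using card_image[OF q(1)] B q X by (simp add: card_Diff_subset finite_subset)
  then obtain r where r: "bij_betw r (X - B) (X - q ` B)"
    using X by (metis finite_Diff finite_same_card_bij)
  define h where "h x = (if x \<in> B then q x else if x \<in> X then r x else x)" for x
  have "bij_betw h B (q ` B)" using q(1) unfolding bij_betw_def h_def by (auto simp: inj_on_def)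
  moreover have "bij_betw h (X - B) (X - q ` B)"
    using r by (rule bij_betw_cong[THEN iffD1, rotated]) (auto simp: h_def)
  ultimately have "bij_betw h (B \<union> (X - B)) (q ` B \<union> (X - q ` B))"
    by (rule bij_betw_combine) auto
  then have "bij_betw h X X" using B q by (simp add: Un_absorb1)
  then have "h permutes X" by (rule bij_imp_permutes) (use B in \<open>auto simp: h_def\<close>)
  then show thesis by (rule that) (simp add: h_def)
qed

text \<open>Every injective placement comes from equally many permutations; \<open>c\<close> is the
  number of those that fix all points of the placement \<open>\<beta>\<close>.\<close>

lemma sum_permutes_restrict:
  fixes \<Phi> :: "('b \<Rightarrow> 'a) \<Rightarrow> int"
  assumes X: "finite X" and Bx: "finite Bx" and \<beta>: "inj_on \<beta> Bx" "\<beta> ` Bx \<subseteq> X"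
  obtains c where "(\<Sum>h | h permutes X. \<Phi> (restrict (h \<circ> \<beta>) Bx)) = c * (\<Sum>q\<in>Injs Bx X. \<Phi> q)"
proof -
  let ?S = "{h. h permutes X}"
  let ?fib = "\<lambda>q. {h \<in> ?S. restrict (h \<circ> \<beta>) Bx = q}"
  let ?F = "{h \<in> ?S. \<forall>b\<in>Bx. h (\<beta> b) = \<beta> b}"
  have fib: "card (?fib q) = card ?F" if q: "q \<in> Injs Bx X" for q
  proof -
    have "inj_on (q \<circ> inv_into Bx \<beta>) (\<beta> ` Bx)" "(q \<circ> inv_into Bx \<beta>) ` (\<beta> ` Bx) \<subseteq> X"
      using q \<beta> unfolding Injs_def by (auto simp: inj_on_def)
    then obtain h0 where h0: "h0 permutes X" "\<And>b. b \<in> \<beta> ` Bx \<Longrightarrow> h0 b = (q \<circ> inv_into Bx \<beta>) b"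
      using ex_permutes_extending[OF X \<beta>(2)] by blast
    have h0b: "h0 (\<beta> b) = q b" if "b \<in> Bx" for b using h0(2)[of "\<beta> b"] that \<beta> by simp
    have qe: "q = restrict q Bx" using q PiE_restrict[of q Bx "\<lambda>_. X"] unfolding Injs_def by simp
    have "bij_betw (\<lambda>h. h0 \<circ> h) ?F (?fib q)"
    proof (rule bij_betw_byWitness[where f' = "\<lambda>h. inv' h0 \<circ> h"])
      show "\<forall>h\<in>?F. inv' h0 \<circ> (h0 \<circ> h) = h" "\<forall>h\<in>?fib q. h0 \<circ> (inv' h0 \<circ> h) = h"
        by (simp_all add: fun_eq_iff permutes_inverses[OF h0(1)])
      show "(\<lambda>h. h0 \<circ> h) ` ?F \<subseteq> ?fib q"
      proof (intro image_subsetI CollectI conjI)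
        fix h assume h: "h \<in> ?F"
        then show "h0 \<circ> h permutes X" using permutes_compose[OF _ h0(1)] by blast
        show "restrict (h0 \<circ> h \<circ> \<beta>) Bx = q"
          by (subst qe) (use h h0b in \<open>auto simp: restrict_def\<close>)
      qed
      show "(\<lambda>h. inv' h0 \<circ> h) ` ?fib q \<subseteq> ?F"
      proof (intro image_subsetI CollectI conjI ballI)
        fix h assume h: "h \<in> ?fib q"
        then show "inv' h0 \<circ> h permutes X" using permutes_compose[OF _ permutes_inv[OF h0(1)]] by blast
        fix b assume b: "b \<in> Bx"
        have "restrict (h \<circ> \<beta>) Bx b = q b" using h by simp
        then have "h (\<beta> b) = h0 (\<beta> b)" using b h0b by simp
        then show "(inv' h0 \<circ> h) (\<beta> b) = \<beta> b" using permutes_inverses(2)[OF h0(1)] by simp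
      qed
    qed
    then show ?thesis by (rule bij_betw_same_card[symmetric])
  qed
  have "(\<Sum>h\<in>?S. \<Phi> (restrict (h \<circ> \<beta>) Bx)) = (\<Sum>q\<in>Injs Bx X. \<Sum>h\<in>?fib q. \<Phi> (restrict (h \<circ> \<beta>) Bx))"
  proof (rule sum.group[symmetric])
    show "finite ?S" using X by (rule finite_permutations)
    show "(\<lambda>h. restrict (h \<circ> \<beta>) Bx) ` ?S \<subseteq> Injs Bx X"
    proof
      fix q assume "q \<in> (\<lambda>h. restrict (h \<circ> \<beta>) Bx) ` ?S"
      then obtain h where h: "h permutes X" "q = restrict (h \<circ> \<beta>) Bx" by auto
      have "inj_on (h \<circ> \<beta>) Bx" using \<beta>(1) permutes_inj[OF h(1)] by (simp add: comp_inj_on inj_on_subset)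
      moreover have "h (\<beta> b) \<in> X" if "b \<in> Bx" for b using \<beta>(2) that permutes_in_image[OF h(1)] by auto
      ultimately show "q \<in> Injs Bx X" unfolding Injs_def h(2) by (simp add: inj_on_restrict_eq)
    qed
  qed (use X Bx in auto)
  also have "\<dots> = (\<Sum>q\<in>Injs Bx X. int (card ?F) * \<Phi> q)"
    using fib by (intro sum.cong) auto
  also have "\<dots> = int (card ?F) * (\<Sum>q\<in>Injs Bx X. \<Phi> q)" by (simp add: sum_distrib_left)
  finally show thesis by (rule that)
qed

lemma vandprod_cong: "(\<And>b. b \<in> boxes ls \<Longrightarrow> y b = z b) \<Longrightarrow> vandprod ls y = vandprod ls z"
  unfolding vandprod_def vand_def by (auto simp: boxes_def rowpairs_def intro!: prod.cong)

lemma inv_sign_id: "inv_sign m id = 1"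
  unfolding inv_sign_def by (auto simp: rowpairs_def intro!: prod.neutral)

text \<open>The element of the column stabiliser that acts on column \<open>c\<close> by
  \<open>pf c\<close>.\<close>

lemma permutes_lift_columns:
  fixes ls :: "nat list" and pf :: "nat \<Rightarrow> nat \<Rightarrow> nat"
  assumes \<beta>: "inj_on \<beta> (boxes ls)" "\<beta> ` boxes ls \<subseteq> X"
    and pf: "\<And>c. c < length ls \<Longrightarrow> pf c permutes {..<ls ! c}"
  obtains \<pi> where "\<pi> permutes X" "\<And>c r. (c, r) \<in> boxes ls \<Longrightarrow> \<pi> (\<beta> (c, r)) = \<beta> (c, pf c r)"
    "\<And>x. x \<notin> \<beta> ` boxes ls \<Longrightarrow> \<pi> x = x"
proof -
  let ?B = "boxes ls"
  define \<theta> where "\<theta> pf b = (fst b, pf (fst b) (snd b))" for pf :: "nat \<Rightarrow> nat \<Rightarrow> nat" and b :: "nat \<times> nat"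
  have \<theta>: "\<theta> pf b \<in> ?B" if "b \<in> ?B" "\<And>c. c < length ls \<Longrightarrow> pf c permutes {..<ls ! c}" for pf b
    using that permutes_in_image[OF that(2), of "fst b" "snd b"] unfolding \<theta>_def boxes_def by auto
  have bij: "bij_betw (\<theta> pf) ?B ?B"
  proof (rule bij_betw_byWitness[where f' = "\<theta> (\<lambda>c. inv' (pf c))"])
    have fst: "fst b < length ls" if "b \<in> ?B" for b using that unfolding boxes_def by auto
    show "\<forall>b\<in>?B. \<theta> (\<lambda>c. inv' (pf c)) (\<theta> pf b) = b" "\<forall>b\<in>?B. \<theta> pf (\<theta> (\<lambda>c. inv' (pf c)) b) = b"
      using permutes_inverses[OF pf[OF fst]] unfolding \<theta>_def by simp_all
    show "\<theta> pf ` ?B \<subseteq> ?B"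
      by (rule image_subsetI, rule \<theta>, assumption, rule pf, assumption)
    show "\<theta> (\<lambda>c. inv' (pf c)) ` ?B \<subseteq> ?B"
      by (rule image_subsetI, rule \<theta>, assumption, rule permutes_inv, rule pf, assumption)
  qed
  define \<pi> where "\<pi> x = (if x \<in> \<beta> ` ?B then \<beta> (\<theta> pf (inv_into ?B \<beta> x)) else x)" for x
  have \<pi>\<beta>: "\<pi> (\<beta> b) = \<beta> (\<theta> pf b)" if "b \<in> ?B" for b
    using that \<beta>(1) unfolding \<pi>_def by simp
  have b: "bij_betw \<beta> ?B (\<beta> ` ?B)" using \<beta>(1) unfolding bij_betw_def by simp
  have "bij_betw (\<beta> \<circ> (\<theta> pf \<circ> inv_into ?B \<beta>)) (\<beta> ` ?B) (\<beta> ` ?B)"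
    by (rule bij_betw_trans[OF bij_betw_trans[OF bij_betw_inv_into[OF b] bij] b])
  then have "bij_betw \<pi> (\<beta> ` ?B) (\<beta> ` ?B)"
    by (rule bij_betw_cong[THEN iffD1, rotated]) (simp add: \<pi>_def)
  then have "\<pi> permutes (\<beta> ` ?B)" by (rule bij_imp_permutes) (simp add: \<pi>_def)
  then have "\<pi> permutes X" by (rule permutes_subset[OF _ \<beta>(2)])
  then show thesis
    by (rule that) (use \<pi>\<beta> in \<open>auto simp: \<theta>_def \<pi>_def\<close>)
qed

lemma vandprod_lift_columns:
  assumes pf: "\<And>c. c < length ls \<Longrightarrow> pf c permutes {..<ls ! c}"
    and \<pi>: "\<And>c r. (c, r) \<in> boxes ls \<Longrightarrow> \<pi> (\<beta> (c, r)) = \<beta> (c, pf c r)"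
  shows "vandprod ls (y \<circ> \<pi> \<circ> \<beta>) = (\<Prod>c<length ls. inv_sign (ls ! c) (pf c)) * vandprod ls (y \<circ> \<beta>)"
proof -
  have "vandprod ls (y \<circ> \<pi> \<circ> \<beta>) = vandprod ls (\<lambda>(c,r). (y \<circ> \<beta>) (c, pf c r))"
    by (rule vandprod_cong) (use \<pi> in auto)
  also have "\<dots> = (\<Prod>c<length ls. inv_sign (ls ! c) (pf c) * vand (ls ! c) (\<lambda>r. (y \<circ> \<beta>) (c, r)))"
    unfolding vandprod_def using vand_permute[OF pf, of _ "\<lambda>r. (y \<circ> \<beta>) (c, r)" for c]
    by (intro prod.cong) (auto simp: o_def)
  also have "\<dots> = (\<Prod>c<length ls. inv_sign (ls ! c) (pf c)) * vandprod ls (y \<circ> \<beta>)"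
    unfolding vandprod_def by (rule prod.distrib)
  finally show ?thesis .
qed

text \<open>The columns and the singletons outside the boxes partition \<open>X\<close>. In a
  rearrangement of the base tabloid, label \<open>r\<close> occurs as often as there are blocks with
  more than \<open>r\<close> points, so \<open>content_rigid\<close> applies.\<close>

lemma standard_filling_columns:
  fixes y :: "'a \<Rightarrow> nat"
  assumes X: "finite X" and \<beta>: "inj_on \<beta> (boxes ls)" "\<beta> ` boxes ls \<subseteq> X" and pos: "\<And>m. m \<in> set ls \<Longrightarrow> 0 < m"
    and \<sigma>: "\<sigma> permutes X" and y: "y = hit_row (boxes ls) \<beta> \<circ> \<sigma>"
    and inj: "\<And>c. c < length ls \<Longrightarrow> inj_on (\<lambda>r. y (\<beta> (c, r))) {..<ls ! c}"
  shows "c < length ls \<Longrightarrow> (\<lambda>r. y (\<beta> (c, r))) ` {..<ls ! c} = {..<ls ! c}"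
    and "x \<in> X - \<beta> ` boxes ls \<Longrightarrow> y x = 0"
proof -
  let ?B = "boxes ls" and ?a = "hit_row (boxes ls) \<beta>"
  let ?col = "\<lambda>c. \<beta> ` ({c} \<times> {..<ls ! c})"
  let ?D = "?col ` {..<length ls} \<union> (\<lambda>x. {x}) ` (X - \<beta> ` ?B)"
  have sub: "{c} \<times> {..<ls ! c} \<subseteq> ?B" if "c < length ls" for c using that unfolding boxes_def by auto
  have cardcol: "card (?col c) = ls ! c" if "c < length ls" for c
    using card_image[OF inj_on_subset[OF \<beta>(1) sub[OF that]]] by simp
  have U: "\<Union>?D = X" using \<beta>(2) unfolding boxes_def by (auto 0 4)
  have acol: "?a (\<beta> (c, r)) = r" if "c < length ls" "r < ls ! c" for c r
    using hit_row_eq[OF \<beta>(1), of "(c,r)"] that unfolding boxes_def by simp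
  have a0: "?a x = 0" if "x \<notin> \<beta> ` ?B" for x using that unfolding hit_row_def by simp
  have finD: "finite ?D" "\<And>d. d \<in> ?D \<Longrightarrow> finite d" using X by auto
  have disj: "d \<inter> e = {}" if "d \<in> ?D" "e \<in> ?D" "d \<noteq> e" for d e
  proof -
    have *: "?col c \<inter> ?col c' = {}" if "c < length ls" "c' < length ls" "?col c \<noteq> ?col c'" for c c'
    proof -
      have "({c} \<times> {..<ls ! c}) \<inter> ({c'} \<times> {..<ls ! c'}) = {}" using that(3) by auto
      then show ?thesis using inj_on_image_Int[OF \<beta>(1) sub[OF that(1)] sub[OF that(2)]] by simp
    qed
    have "?col c \<subseteq> \<beta> ` ?B" if "c < length ls" for c using sub[OF that] by auto
    then have **: "{x} \<inter> ?col c = {}" if "c < length ls" "x \<in> X - \<beta> ` ?B" for c x using that by blast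
    show ?thesis
      using that
    proof (elim UnE imageE)
      fix c c' assume "d = ?col c" "e = ?col c'" "c \<in> {..<length ls}" "c' \<in> {..<length ls}" "d \<noteq> e"
      then show ?thesis using *[of c c'] by blast
    next
      fix c x assume "d = ?col c" "e = {x}" "c \<in> {..<length ls}" "x \<in> X - \<beta> ` ?B"
      then show ?thesis using **[of c x] by blast
    next
      fix c x assume "e = ?col c" "d = {x}" "c \<in> {..<length ls}" "x \<in> X - \<beta> ` ?B"
      then show ?thesis using **[of c x] by blast
    next
      fix x x' assume "d = {x}" "e = {x'}" "d \<noteq> e"
      then show ?thesis by blast
    qed
  qed
  have card_a: "card {x \<in> d. ?a x = r} = (if r < card d then 1 else 0)" if "d \<in> ?D" for d r
    using that
  proof
    assume "d \<in> ?col ` {..<length ls}"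
    then obtain c where c: "c < length ls" "d = ?col c" by auto
    have "{x \<in> d. ?a x = r} = (if r < ls ! c then {\<beta> (c, r)} else {})"
      unfolding c(2) using acol[OF c(1)] by auto
    then show ?thesis using cardcol[OF c(1)] c(2) by simp
  next
    assume "d \<in> (\<lambda>x. {x}) ` (X - \<beta> ` ?B)"
    then obtain x where x: "x \<notin> \<beta> ` ?B" "d = {x}" by auto
    have "{x \<in> d. ?a x = r} = (if r = 0 then {x} else {})" using x a0[OF x(1)] by auto
    then show ?thesis using x by simp
  qed
  have cont: "card {x \<in> \<Union>?D. y x = r} = card {d \<in> ?D. r < card d}" for r
  proof -
    have "bij_betw \<sigma> {x \<in> X. y x = r} {x \<in> X. ?a x = r}"
      unfolding y by (rule bij_betw_byWitness[where f' = "inv' \<sigma>"])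
        (use \<sigma> permutes_in_image[OF \<sigma>] permutes_in_image[OF permutes_inv[OF \<sigma>]] permutes_inverses[OF \<sigma>] in auto)
    then have "card {x \<in> X. y x = r} = card {x \<in> X. ?a x = r}" by (rule bij_betw_same_card)
    also have "{x \<in> X. ?a x = r} = {x \<in> \<Union>?D. ?a x = r}" by (simp only: U)
    also have "\<dots> = (\<Union>d\<in>?D. {x \<in> d. ?a x = r})" by blast
    also have "card \<dots> = (\<Sum>d\<in>?D. card {x \<in> d. ?a x = r})"
    proof (rule card_UN_disjoint[OF finD(1)])
      show "\<forall>d\<in>?D. finite {x \<in> d. ?a x = r}" using finD(2) by (intro ballI finite_Collect_conjI disjI1) simp
      show "\<forall>d\<in>?D. \<forall>e\<in>?D. d \<noteq> e \<longrightarrow> {x \<in> d. ?a x = r} \<inter> {x \<in> e. ?a x = r} = {}"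
      proof (intro ballI impI)
        fix d e assume "d \<in> ?D" "e \<in> ?D" "d \<noteq> e"
        from disj[OF this] show "{x \<in> d. ?a x = r} \<inter> {x \<in> e. ?a x = r} = {}" by blast
      qed
    qed
    also have "\<dots> = (\<Sum>d\<in>?D. if r < card d then 1 else 0)" by (rule sum.cong[OF refl card_a])
    also have "\<dots> = card {d \<in> ?D. r < card d}" using finD(1) by (simp add: sum.If_cases Int_def)
    finally show ?thesis unfolding U .
  qed
  have injD: "inj_on y d" if "d \<in> ?D" for d
    using that
  proof
    assume "d \<in> ?col ` {..<length ls}"
    then obtain c where c: "c < length ls" "d = ?col c" by auto
    show ?thesis unfolding c(2) using inj[OF c(1)] by (auto simp: inj_on_def)
  qed auto
  note rigid = content_rigid[OF finD disj injD cont]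
  show "(\<lambda>r. y (\<beta> (c, r))) ` {..<ls ! c} = {..<ls ! c}" if c: "c < length ls" for c
  proof -
    have "y ` ?col c = {..<ls ! c}" using rigid[of "?col c"] cardcol[OF c] c by simp
    moreover have "y ` ?col c = (\<lambda>r. y (\<beta> (c, r))) ` {..<ls ! c}" by auto
    ultimately show ?thesis by simp
  qed
  show "y x = 0" if "x \<in> X - \<beta> ` ?B" for x
    using rigid[of "{x}"] that by auto
qed

text \<open>The class sum of a polytabloid is antisymmetric under the column stabiliser, hence
  determined on all tabloids by its value at the base tabloid \<open>?a\<close>. That value is a
  multiple of the signed count in \<open>sum0\<close>.\<close>

lemma polytabloid_vanishing:
  assumes G: "sym_or_alt n G" and gG: "g \<in> carrier G" and ls: "sum_list ls \<le> n" "\<And>m. m \<in> set ls \<Longrightarrow> 0 < m"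
    and odd: "G = alt_group n \<Longrightarrow> \<exists>t. t permutes {1..n} \<and> \<not> evenperm t \<and> t \<circ> g = g \<circ> t"
    and sum0: "(\<Sum>q\<in>Injs (boxes ls) {1..n}. vandprod ls (\<lambda>b. hit_row (boxes ls) q (g (q b)))) = 0"
  shows "vanishing G g"
proof -
  let ?X = "{1..n}" and ?B = "boxes ls"
  let ?S = "{h. h permutes ?X}"
  note g = sym_or_alt_carrier[OF G gG]
  have finS: "finite ?S" by (simp add: finite_permutations)
  obtain \<beta> where \<beta>: "inj_on \<beta> ?B" "\<beta> ` ?B \<subseteq> ?X"
    using inj_on_iff_card_le[of ?B ?X] ls(1) card_boxes[of ls] by auto
  let ?a = "hit_row ?B \<beta>"
  define v where "v y = vandprod ls (y \<circ> \<beta>)" for y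
  define F where "F y = (\<Sum>h\<in>?S. v (y \<circ> conj_by h g))" for y
  \<comment> \<open>Reindexing \<open>h\<close> as \<open>\<pi> \<circ> h\<close> carries the column
    permutation past the conjugate, where it acts on the polytabloid by a sign.\<close>
  have Fcol: "F (y \<circ> \<pi>) = (\<Prod>c<length ls. inv_sign (ls ! c) (pf c)) * F y" (is "_ = ?s * _")
    if pf: "\<And>c. c < length ls \<Longrightarrow> pf c permutes {..<ls ! c}" and \<pi>: "\<pi> permutes ?X"
     "\<And>c r. (c, r) \<in> ?B \<Longrightarrow> \<pi> (\<beta> (c, r)) = \<beta> (c, pf c r)" for pf \<pi> y
  proof -
    have "F (y \<circ> \<pi>) = (\<Sum>h\<in>?S. ?s * v (y \<circ> conj_by (\<pi> \<circ> h) g))"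
      unfolding F_def
    proof (rule sum.cong[OF refl])
      fix h assume "h \<in> ?S"
      then have "conj_by (\<pi> \<circ> h) g \<circ> \<pi> = \<pi> \<circ> conj_by h g"
        using conj_by_compose[OF \<pi>(1), of h g] permutes_inv_o(2)[OF \<pi>(1)] by (simp add: comp_assoc)
      then have "y \<circ> \<pi> \<circ> conj_by h g = (y \<circ> conj_by (\<pi> \<circ> h) g) \<circ> \<pi>" by (simp add: comp_assoc)
      then show "v (y \<circ> \<pi> \<circ> conj_by h g) = ?s * v (y \<circ> conj_by (\<pi> \<circ> h) g)"
        unfolding v_def using vandprod_lift_columns[where pf = pf and \<pi> = \<pi> and \<beta> = \<beta> and y = "y \<circ> conj_by (\<pi> \<circ> h) g", OF pf \<pi>(2)] by simp
    qed
    also have "\<dots> = ?s * F y"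
      unfolding F_def sum_distrib_left[symmetric]
      using sum_permutes_compose_left[OF \<pi>(1), of "\<lambda>h. v (y \<circ> conj_by h g)"] by simp
    finally show ?thesis .
  qed
  have Fa: "F ?a = 0"
  proof -
    let ?\<Phi> = "\<lambda>q. vandprod ls (\<lambda>b. hit_row ?B q (g (q b)))"
    have "F ?a = (\<Sum>h\<in>?S. ?\<Phi> (restrict (inv' h \<circ> \<beta>) ?B))"
      unfolding F_def
    proof (rule sum.cong[OF refl])
      fix h assume "h \<in> ?S"
      then have h: "h permutes ?X" by simp
      \<comment> \<open>The row into which the conjugate sends the point of a box can be read off
        from \<open>g\<close> and the placement pulled back along \<open>h\<close>.\<close>
      define q where "q = restrict (inv' h \<circ> \<beta>) ?B"
      have q: "q b = inv' h (\<beta> b)" if "b \<in> ?B" for b using that unfolding q_def by simp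
      have inv: "inv' h (h x) = x" "h (inv' h x) = x" for x using permutes_inverses[OF h] by auto
      have qi: "inj_on q ?B"
      proof (rule inj_onI)
        fix b b' assume b: "b \<in> ?B" "b' \<in> ?B" "q b = q b'"
        then have "h (inv' h (\<beta> b)) = h (inv' h (\<beta> b'))" using q by simp
        then show "b = b'" using b inj_onD[OF \<beta>(1)] unfolding inv by blast
      qed
      have "hit_row ?B q x = ?a (h x)" for x
      proof (cases "x \<in> q ` ?B")
        case True
        then obtain b where b: "b \<in> ?B" "x = q b" by auto
        then have "h x = \<beta> b" using q inv by simp
        then show ?thesis using hit_row_eq[OF qi b(1)] hit_row_eq[OF \<beta>(1) b(1)] b(2) by simp
      next
        case False
        have "h x \<notin> \<beta> ` ?B"
        proof
          assume "h x \<in> \<beta> ` ?B"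
          then obtain b where b: "b \<in> ?B" "h x = \<beta> b" by blast
          then have "x = q b" using q[OF b(1)] inv(1)[of x] by simp
          then show False using False b(1) by blast
        qed
        then show ?thesis using False unfolding hit_row_def by simp
      qed
      then show "v (?a \<circ> conj_by h g) = ?\<Phi> q"
        unfolding v_def conj_by_def by (intro vandprod_cong) (simp add: q)
    qed
    also have "\<dots> = (\<Sum>h\<in>?S. ?\<Phi> (restrict (h \<circ> \<beta>) ?B))"
      by (rule sum_permutations_inverse[symmetric])
    also have "\<dots> = 0"
    proof -
      obtain c where "(\<Sum>h\<in>?S. ?\<Phi> (restrict (h \<circ> \<beta>) ?B)) = c * (\<Sum>q\<in>Injs ?B ?X. ?\<Phi> q)"
        by (rule sum_permutes_restrict[OF finite_atLeastAtMost finite_boxes \<beta>, of ?\<Phi>])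
      then show ?thesis using sum0 by simp
    qed
    finally show ?thesis .
  qed
  define Y where "Y = (\<lambda>\<sigma>. ?a \<circ> \<sigma>) ` ?S"
  have F0: "F y = 0" if "y \<in> Y" for y
  proof -
    from that obtain \<sigma> where \<sigma>: "\<sigma> permutes ?X" "y = ?a \<circ> \<sigma>" unfolding Y_def by auto
    show ?thesis
    proof (cases "\<forall>c<length ls. inj_on (\<lambda>r. y (\<beta> (c, r))) {..<ls ! c}")
      \<comment> \<open>Two equal labels in one column: exchanging their boxes fixes
        \<open>y\<close> but changes the sign.\<close>
      case False
      then obtain c r r' where c: "c < length ls" "r < r'" "r' < ls ! c" "y (\<beta> (c, r)) = y (\<beta> (c, r'))"
        unfolding inj_on_def by (metis lessThan_iff linorder_neqE_nat)
      define pf where "pf c' = (if c' = c then transpose r r' else id)" for c'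
      have pf: "pf c' permutes {..<ls ! c'}" for c'
        using c unfolding pf_def by (auto intro: permutes_swap_id permutes_id)
      obtain \<pi> where \<pi>: "\<pi> permutes ?X" "\<And>c r. (c, r) \<in> ?B \<Longrightarrow> \<pi> (\<beta> (c, r)) = \<beta> (c, pf c r)"
         "\<And>x. x \<notin> \<beta> ` ?B \<Longrightarrow> \<pi> x = x"
        using permutes_lift_columns[OF \<beta>, of pf] pf by blast
      have "(\<Prod>c<length ls. inv_sign (ls ! c) (pf c)) = (\<Prod>c'<length ls. if c' = c then - 1 else 1)"
        using c inv_sign_transpose[OF c(2,3)] by (intro prod.cong) (auto simp: pf_def inv_sign_id)
      then have s: "(\<Prod>c<length ls. inv_sign (ls ! c) (pf c)) = - 1" using c(1) by simp
      have "y \<circ> \<pi> = y"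
      proof
        fix x
        show "(y \<circ> \<pi>) x = y x"
        proof (cases "x \<in> \<beta> ` ?B")
          case True
          then obtain c' s where "x = \<beta> (c', s)" "(c', s) \<in> ?B" by auto
          then show ?thesis using \<pi>(2) c(4) unfolding pf_def by (auto simp: transpose_def)
        qed (simp add: \<pi>(3))
      qed
      then show ?thesis using Fcol[OF pf \<pi>(1,2), of y] s by simp
    next
      \<comment> \<open>Every column now carries the labels 0, 1, ... up to its length, so
        \<open>y\<close> is the base tabloid moved by a column permutation.\<close>
      case True
      then have inj: "inj_on (\<lambda>r. y (\<beta> (c, r))) {..<ls ! c}" if "c < length ls" for c using that by blast
      have std1: "(\<lambda>r. y (\<beta> (c, r))) ` {..<ls ! c} = {..<ls ! c}" if "c < length ls" for c
        by (rule standard_filling_columns(1)[OF finite_atLeastAtMost \<beta> _ \<sigma>]) (fact ls(2) inj that)+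
      have std2: "y x = 0" if "x \<in> ?X - \<beta> ` ?B" for x
        by (rule standard_filling_columns(2)[OF finite_atLeastAtMost \<beta> _ \<sigma>]) (fact ls(2) inj that)+
      define pf where "pf c r = (if r < ls ! c then y (\<beta> (c, r)) else r)" for c r
      have pf: "pf c permutes {..<ls ! c}" if "c < length ls" for c
      proof (rule bij_imp_permutes)
        have "bij_betw (\<lambda>r. y (\<beta> (c, r))) {..<ls ! c} {..<ls ! c}"
          using inj[OF that] std1[OF that] unfolding bij_betw_def by simp
        then show "bij_betw (pf c) {..<ls ! c} {..<ls ! c}"
          by (rule bij_betw_cong[THEN iffD1, rotated]) (simp add: pf_def)
      qed (simp add: pf_def)
      obtain \<pi> where \<pi>: "\<pi> permutes ?X" "\<And>c r. (c, r) \<in> ?B \<Longrightarrow> \<pi> (\<beta> (c, r)) = \<beta> (c, pf c r)"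
         "\<And>x. x \<notin> \<beta> ` ?B \<Longrightarrow> \<pi> x = x"
        using permutes_lift_columns[OF \<beta>, of pf] pf by blast
      have "y = ?a \<circ> \<pi>"
      proof
        fix x
        show "y x = (?a \<circ> \<pi>) x"
        proof (cases "x \<in> \<beta> ` ?B")
          case True
          then obtain c r where x: "x = \<beta> (c, r)" "(c, r) \<in> ?B" by auto
          then have cr: "c < length ls" "r < ls ! c" unfolding boxes_def by auto
          have "(c, pf c r) \<in> ?B" using cr permutes_in_image[OF pf[OF cr(1)], of r] unfolding boxes_def by simp
          then have "?a (\<beta> (c, pf c r)) = pf c r" using hit_row_eq[OF \<beta>(1)] by simp
          then show ?thesis using x \<pi>(2)[OF x(2)] cr unfolding pf_def by simp
        next
          case False
          then have "(?a \<circ> \<pi>) x = 0" using \<pi>(3) unfolding hit_row_def by simp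
          moreover have "y x = 0"
          proof (cases "x \<in> ?X")
            case True then show ?thesis using std2 False by blast
          next
            case False': False
            then show ?thesis using \<sigma> False permutes_not_in[OF \<sigma>(1)] unfolding hit_row_def by simp
          qed
          ultimately show ?thesis by simp
        qed
      qed
      then show ?thesis using Fcol[OF pf \<pi>(1,2), of ?a] Fa by simp
    qed
  qed
  have inY: "y \<circ> x \<in> Y" if x: "x permutes ?X" and y: "y \<in> Y" for x y
  proof -
    from y obtain \<sigma> where "\<sigma> permutes ?X" "y = ?a \<circ> \<sigma>" unfolding Y_def by auto
    then show ?thesis using permutes_compose[OF x] unfolding Y_def by (auto simp: comp_assoc)
  qed
  have "v ?a \<noteq> 0"
  proof -
    have "v ?a = vandprod ls snd" unfolding v_def
      by (rule vandprod_cong) (simp add: hit_row_eq[OF \<beta>(1)])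
    then show ?thesis unfolding vandprod_def using vand_nonzero_iff by (simp add: prod_zero_iff)
  qed
  show ?thesis
  proof (rule vanishing_sym_or_alt[OF G gG, where act = "\<lambda>x y. y \<circ> x" and Y = Y and v = "\<lambda>y. real_of_int (v y)" and ?y0.0 = ?a])
    fix y assume y: "y \<in> Y"
    have "real_of_int (F y) = 0" using F0[OF y] by simp
    then show "(\<Sum>h\<in>?S. real_of_int (v (y \<circ> conj_by h g))) = 0" unfolding F_def by simp
    assume "G = alt_group n"
    then obtain t where t: "t permutes ?X" "\<not> evenperm t" "t \<circ> g = g \<circ> t" using odd by blast
    show "(\<Sum>h\<in>?S. real_of_int (v (y \<circ> conj_by h g))) = 2 * (\<Sum>h | h permutes ?X \<and> evenperm h. real_of_int (v (y \<circ> conj_by h g)))"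
    proof (rule sum_permutes_eq_double_even[OF _ bij_betw_compose_odd(1)[OF _ t(1,2)]])
      fix h assume h: "h permutes ?X"
      \<comment> \<open>Since \<open>t\<close> commutes with \<open>g\<close>, both \<open>h\<close>
        and \<open>h \<circ> t\<close> give the same conjugate.\<close>
      have "h (t (g (inv' t (inv' h x)))) = h (g (inv' h x))" for x
      proof -
        have "t (g (inv' t (inv' h x))) = g (t (inv' t (inv' h x)))" using t(3) by (metis comp_apply)
        then show ?thesis using permutes_inverses(1)[OF t(1)] by simp
      qed
      then have "conj_by (h \<circ> t) g = conj_by h g"
        unfolding conj_by_def using o_inv_distrib[of h t] permutes_bij[OF h] permutes_bij[OF t(1)] by (simp add: fun_eq_iff)
      then show "real_of_int (v (y \<circ> conj_by (h \<circ> t) g)) = real_of_int (v (y \<circ> conj_by h g))" by simp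
    qed auto
  next
    show "?a \<in> Y" unfolding Y_def using permutes_id[of ?X] by (auto simp: image_iff intro!: exI[of _ id])
  qed (use finS inY \<open>v ?a \<noteq> 0\<close> in \<open>auto simp: Y_def comp_assoc\<close>)
qed

section \<open>Expanding a polytabloid box by box\<close>

definition rvand :: "nat set \<Rightarrow> (nat \<Rightarrow> nat) \<Rightarrow> int" where
  "rvand A l = (\<Prod>(a,b)\<in>{(a,b). a \<in> A \<and> b \<in> A \<and> a < b}. sgn (int (l b) - int (l a)))"

text \<open>Demanding that the labels on \<open>A\<close> be exactly \<open>L\<close> allows a row
  to be removed together with its label, as in a Laplace expansion.\<close>

definition rel_vand :: "nat set \<Rightarrow> nat set \<Rightarrow> (nat \<Rightarrow> nat) \<Rightarrow> int" where
  "rel_vand A L l = (if l ` A = L then rvand A l else 0)"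

lemma vand_eq_rvand: "vand m l = rvand {..<m} l"
  unfolding vand_def rvand_def rowpairs_def by (rule prod.cong) auto

lemma rvand_cong: "(\<And>a. a \<in> A \<Longrightarrow> l a = l' a) \<Longrightarrow> rvand A l = rvand A l'"
  unfolding rvand_def by (rule prod.cong) auto

lemma rvand_zero:
  assumes A: "finite A" and n: "\<not> inj_on l A"
  shows "rvand A l = 0"
proof -
  from n obtain a b where ab: "a \<in> A" "b \<in> A" "a < b" "l a = l b"
    unfolding inj_on_def by (metis linorder_neqE_nat)
  have "finite {(a,b). a \<in> A \<and> b \<in> A \<and> a < b}" by (rule finite_subset[of _ "A \<times> A"]) (use A in auto)
  then show ?thesis unfolding rvand_def
    using ab by (intro prod_zero bexI[of _ "(a,b)"]) auto
qed

lemma rvand_remove: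
  assumes A: "finite A" and a: "a \<in> A"
  shows "rvand A l = rvand (A - {a}) l * (\<Prod>x\<in>A - {a}. if x < a then sgn (int (l a) - int (l x)) else sgn (int (l x) - int (l a)))"
proof -
  let ?P = "\<lambda>A. {(x,y). x \<in> A \<and> y \<in> A \<and> x < (y::nat)}"
  let ?h = "\<lambda>x. if x < a then (x, a) else (a, x)"
  have fin: "finite (?P A)" by (rule finite_subset[of _ "A \<times> A"]) (use A in auto)
  have eq: "?P A = ?P (A - {a}) \<union> ?h ` (A - {a})" 
  proof (intro equalityI subsetI)
    fix z assume "z \<in> ?P A"
    then obtain x y where z: "z = (x,y)" "x \<in> A" "y \<in> A" "x < y" by auto
    show "z \<in> ?P (A - {a}) \<union> ?h ` (A - {a})"
    proof (cases "x = a \<or> y = a")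
      case True
      then show ?thesis
      proof
        assume "x = a" then have "z = ?h y" "y \<in> A - {a}" using z by auto
        then show ?thesis by blast
      next
        assume "y = a" then have "z = ?h x" "x \<in> A - {a}" using z by auto
        then show ?thesis by blast
      qed
    qed (use z in auto)
  next
    fix z assume "z \<in> ?P (A - {a}) \<union> ?h ` (A - {a})"
    then show "z \<in> ?P A" using a by (auto split: if_splits)
  qed
  have dis: "?P (A - {a}) \<inter> ?h ` (A - {a}) = {}" by (auto split: if_splits)
  have "rvand A l = rvand (A - {a}) l * (\<Prod>(x,y)\<in>?h ` (A - {a}). sgn (int (l y) - int (l x)))"
    unfolding rvand_def by (subst eq, rule prod.union_disjoint[OF _ _ dis]) (use fin A in \<open>auto elim: rev_finite_subset\<close>)
  also have "(\<Prod>(x,y)\<in>?h ` (A - {a}). sgn (int (l y) - int (l x))) = (\<Prod>x\<in>A - {a}. case ?h x of (x,y) \<Rightarrow> sgn (int (l y) - int (l x)))"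
    by (subst prod.reindex) (auto simp: inj_on_def split: if_splits)
  also have "\<dots> = (\<Prod>x\<in>A - {a}. if x < a then sgn (int (l a) - int (l x)) else sgn (int (l x) - int (l a)))"
    by (rule prod.cong) auto
  finally show ?thesis .
qed

text \<open>Each smaller row and each smaller label contributes one sign; a smaller row that carries
  a smaller label contributes two, which cancel.\<close>

lemma rel_vand_assign:
  assumes A: "finite A" "a \<in> A"
  shows "rel_vand A L l = (if l a \<in> L then (- 1) ^ (card {x \<in> A. x < a} + card {t \<in> L. t < l a}) * rel_vand (A - {a}) (L - {l a}) l else 0)"
proof (cases "l a \<in> L")
  case True
  show ?thesis
  proof (cases "inj_on l A")
    case inj: True
    have im: "l ` (A - {a}) = l ` A - {l a}" using inj A by (auto simp: inj_on_def)
    have iff: "l ` A = L \<longleftrightarrow> l ` (A - {a}) = L - {l a}" unfolding im using True A(2) by (metis image_eqI insert_Diff)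
    show ?thesis
    proof (cases "l ` A = L")
      case L: True
      have "(\<Prod>x\<in>A - {a}. if x < a then sgn (int (l a) - int (l x)) else sgn (int (l x) - int (l a)))
        = (\<Prod>x\<in>A - {a}. (if x < a then - 1 else 1) * (if l x < l a then - 1 else 1))"
      proof (rule prod.cong[OF refl])
        fix x assume "x \<in> A - {a}"
        then have "l x \<noteq> l a" using inj A by (auto simp: inj_on_def)
        then show "(if x < a then sgn (int (l a) - int (l x)) else sgn (int (l x) - int (l a)))
           = (if x < a then - 1 else 1) * (if l x < l a then - 1 else (1::int))" by (auto simp: sgn_if)
      qed
      also have "\<dots> = (\<Prod>x\<in>A - {a}. if x < a then - 1 else 1) * (\<Prod>x\<in>A - {a}. if l x < l a then - 1 else 1)"
        by (rule prod.distrib)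
      also have "(\<Prod>x\<in>A - {a}. if x < a then - 1 else (1::int)) = (- 1) ^ card {x \<in> A. x < a}"
      proof -
        have "(A - {a}) \<inter> {x. x < a} = {x \<in> A. x < a}" by auto
        then show ?thesis using A by (simp add: prod.If_cases)
      qed
      also have "(\<Prod>x\<in>A - {a}. if l x < l a then - 1 else (1::int)) = (- 1) ^ card {t \<in> L. t < l a}"
      proof -
        have "{t \<in> L. t < l a} = l ` ((A - {a}) \<inter> {x. l x < l a})" using L by auto
        moreover have "inj_on l ((A - {a}) \<inter> {x. l x < l a})" using inj by (auto simp: inj_on_def)
        ultimately have "card {t \<in> L. t < l a} = card ((A - {a}) \<inter> {x. l x < l a})" by (simp add: card_image)
        then show ?thesis using A by (simp add: prod.If_cases)
      qed
      finally show ?thesis using True L iff rvand_remove[OF A, of l] unfolding rel_vand_def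
        by (simp add: power_add mult_ac)
    qed (use True iff in \<open>auto simp: rel_vand_def\<close>)
  next
    case ninj: False
    have "l ` (A - {a}) = L - {l a} \<Longrightarrow> \<not> inj_on l (A - {a})"
    proof
      assume im: "l ` (A - {a}) = L - {l a}" and "inj_on l (A - {a})"
      then have "inj_on l (insert a (A - {a}))" by (subst inj_on_insert) auto
      then show False using ninj A by (simp add: insert_absorb)
    qed
    then show ?thesis using rvand_zero[OF A(1) ninj] rvand_zero[of "A - {a}" l] A unfolding rel_vand_def by auto
  qed
next
  case False
  then show ?thesis using A unfolding rel_vand_def by auto
qed

text \<open>A state lists, for each column, the rows and the labels not yet used.\<close>

type_synonym state = "(nat list \<times> nat list) list"

definition box_list :: "state \<Rightarrow> (nat \<times> nat) list" where
  "box_list st = concat (map (\<lambda>c. map (Pair c) (fst (st ! c))) [0..<length st])"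

definition wf_state :: "state \<Rightarrow> bool" where
  "wf_state st \<longleftrightarrow> (\<forall>(rs, ls)\<in>set st. distinct rs \<and> distinct ls)"

definition state_vand :: "state \<Rightarrow> (nat \<times> nat \<Rightarrow> nat) \<Rightarrow> int" where
  "state_vand st y = (\<Prod>c<length st. rel_vand (set (fst (st ! c))) (set (snd (st ! c))) (\<lambda>r. y (c, r)))"

text \<open>At most one signed state. The empty list stands for zero: label \<open>t\<close> is no
  longer available in column \<open>c\<close>.\<close>

fun assign :: "state \<Rightarrow> nat \<times> nat \<Rightarrow> nat \<Rightarrow> (int \<times> state) list" where
  "assign st (c, r) t = (case st ! c of (rs, ls) \<Rightarrow>
     if t \<in> set ls then [(if even (length (filter (\<lambda>x. x < r) rs) + length (filter (\<lambda>x. x < t) ls)) then 1 else - 1,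
         st[c := (remove1 r rs, remove1 t ls)])] else [])"

text \<open>Made for involutions: if the point of box \<open>b\<close> goes to that of
  \<open>b'\<close>, each of the two boxes is labelled by the row of the other, and both are settled
  at once. The case \<open>b' = b\<close> is a fixed point.\<close>

definition assign2 :: "state \<Rightarrow> nat \<times> nat \<Rightarrow> nat \<times> nat \<Rightarrow> (int \<times> state) list" where
  "assign2 st b b' = (if b' = b then assign st b (snd b) else
     concat (map (\<lambda>(s, st'). map (\<lambda>(s', st''). (s * s', st'')) (assign st' b' (snd b))) (assign st b (snd b'))))"

lemma set_box_list: "set (box_list st) = {(c, r). c < length st \<and> r \<in> set (fst (st ! c))}"
  unfolding box_list_def by auto

lemma state_vand_cong:
  assumes "\<And>b. b \<in> set (box_list st) \<Longrightarrow> y b = y' b"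
  shows "state_vand st y = state_vand st y'"
  unfolding state_vand_def rel_vand_def
proof (rule prod.cong[OF refl])
  fix c assume "c \<in> {..<length st}"
  then have e: "y (c, r) = y' (c, r)" if "r \<in> set (fst (st ! c))" for r
    using assms that by (simp add: set_box_list)
  then show "(if (\<lambda>r. y (c, r)) ` set (fst (st ! c)) = set (snd (st ! c)) then rvand (set (fst (st ! c))) (\<lambda>r. y (c, r)) else 0)
    = (if (\<lambda>r. y' (c, r)) ` set (fst (st ! c)) = set (snd (st ! c)) then rvand (set (fst (st ! c))) (\<lambda>r. y' (c, r)) else 0)"
    using rvand_cong[of "set (fst (st ! c))" "\<lambda>r. y (c, r)" "\<lambda>r. y' (c, r)"] by (simp cong: image_cong)
qed

lemma assign_props:
  assumes wf: "wf_state st" and b: "b \<in> set (box_list st)" and m: "(s, st') \<in> set (assign st b t)"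
  shows "wf_state st'" "set (box_list st') = set (box_list st) - {b}"
proof -
  obtain c r where cr: "b = (c, r)" by (cases b)
  obtain rs ls where e: "st ! c = (rs, ls)" by (cases "st ! c")
  have c: "c < length st" "r \<in> set rs" using b cr e by (auto simp: set_box_list)
  have d: "distinct rs" "distinct ls" using wf c(1) e nth_mem[OF c(1)] unfolding wf_state_def by auto
  have st': "st' = st[c := (remove1 r rs, remove1 t ls)]" using m unfolding cr by (auto simp: e split: if_splits)
  show "wf_state st'" using wf d unfolding st' wf_state_def by (auto dest!: set_update_subset_insert[THEN subsetD])
  show "set (box_list st') = set (box_list st) - {b}"
    unfolding set_box_list st' cr using c d e by (auto simp: nth_list_update split: if_splits)
qed

lemma state_vand_assign:
  assumes wf: "wf_state st" and b: "b \<in> set (box_list st)" and y: "y b = t"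
  shows "state_vand st y = (\<Sum>(s, st')\<leftarrow>assign st b t. s * state_vand st' y)"
proof -
  obtain c r where cr: "b = (c, r)" by (cases b)
  obtain rs ls where e: "st ! c = (rs, ls)" by (cases "st ! c")
  have c: "c < length st" "r \<in> set rs" using b cr e by (auto simp: set_box_list)
  have d: "distinct rs" "distinct ls" using wf c(1) e nth_mem[OF c(1)] unfolding wf_state_def by auto
  let ?st = "st[c := (remove1 r rs, remove1 t ls)]"
  let ?f = "\<lambda>st c. rel_vand (set (fst (st ! c))) (set (snd (st ! c))) (\<lambda>r. y (c, r))"
  let ?s = "if even (length (filter (\<lambda>x. x < r) rs) + length (filter (\<lambda>x. x < t) ls)) then 1 else - 1 :: int"
  have col: "?f st c = (if t \<in> set ls then ?s * ?f ?st c else 0)"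
  proof -
    have "card {x \<in> set rs. x < r} = length (filter (\<lambda>x. x < r) rs)" "card {x \<in> set ls. x < t} = length (filter (\<lambda>x. x < t) ls)"
      using d by (simp_all add: distinct_length_filter Int_def conj_commute)
    then show ?thesis
      using rel_vand_assign[of "set rs" r "set ls" "\<lambda>r. y (c, r)"] c d y e
      by (simp add: cr minus_one_power_iff)
  qed
  have split: "(\<Prod>c'<length st. F c') = F c * (\<Prod>c'\<in>{..<length st} - {c}. F c')" for F :: "nat \<Rightarrow> int"
    by (rule prod.remove) (use c in auto)
  have "state_vand st y = ?f st c * (\<Prod>c'\<in>{..<length st} - {c}. ?f st c')"
    unfolding state_vand_def by (rule split)
  also have "(\<Prod>c'\<in>{..<length st} - {c}. ?f st c') = (\<Prod>c'\<in>{..<length st} - {c}. ?f ?st c')"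
    by (rule prod.cong) auto
  also have "?f st c * (\<Prod>c'\<in>{..<length st} - {c}. ?f ?st c') = (if t \<in> set ls then ?s * state_vand ?st y else 0)"
    unfolding col state_vand_def length_list_update split[of "?f ?st"] by simp
  also have "\<dots> = (\<Sum>(s, st')\<leftarrow>assign st b t. s * state_vand st' y)"
    unfolding cr by (simp add: e)
  finally show ?thesis .
qed

lemma sum_list_assign2:
  fixes F :: "state \<Rightarrow> int"
  assumes "b' \<noteq> b"
  shows "(\<Sum>(s, st')\<leftarrow>assign2 st b b'. s * F st') = (\<Sum>(s, st')\<leftarrow>assign st b (snd b'). s * (\<Sum>(s', st'')\<leftarrow>assign st' b' (snd b). s' * F st''))"
proof -
  have "(\<Sum>(s, st')\<leftarrow>concat (map (\<lambda>(s, st'). map (\<lambda>(s', st''). (s * s', st'')) (assign st' b' (snd b))) xs). s * F st')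
    = (\<Sum>(s, st')\<leftarrow>xs. s * (\<Sum>(s', st'')\<leftarrow>assign st' b' (snd b). s' * F st''))" for xs
    by (induction xs) (auto simp: sum_list_const_mult[symmetric] o_def case_prod_unfold mult_ac)
  then show ?thesis using assms unfolding assign2_def by simp
qed

lemma assign2_props:
  assumes wf: "wf_state st" and b: "b \<in> set (box_list st)" "b' \<in> set (box_list st)" and m: "(s, st') \<in> set (assign2 st b b')"
  shows "wf_state st'" "set (box_list st') = set (box_list st) - {b, b'}"
proof -
  have "wf_state st' \<and> set (box_list st') = set (box_list st) - {b, b'}"
  proof (cases "b' = b")
    case True
    then show ?thesis using m assign_props[OF wf b(1), of s st' "snd b"] unfolding assign2_def by simp
  next
    case False
    then obtain s1 st1 s2 where a: "(s1, st1) \<in> set (assign st b (snd b'))" "(s2, st') \<in> set (assign st1 b' (snd b))"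
      using m unfolding assign2_def by auto
    note p = assign_props[OF wf b(1) a(1)]
    have "b' \<in> set (box_list st1)" using p(2) b False by simp
    from assign_props[OF p(1) this a(2)] p(2) show ?thesis by auto
  qed
  then show "wf_state st'" "set (box_list st') = set (box_list st) - {b, b'}" by auto
qed

lemma state_vand_assign2:
  assumes wf: "wf_state st" and b: "b \<in> set (box_list st)" "b' \<in> set (box_list st)" and y: "y b = snd b'" "y b' = snd b"
  shows "state_vand st y = (\<Sum>(s, st')\<leftarrow>assign2 st b b'. s * state_vand st' y)"
proof (cases "b' = b")
  case True
  then show ?thesis using state_vand_assign[OF wf b(1), of y] y unfolding assign2_def by simp
next
  case False
  have "state_vand st y = (\<Sum>(s, st')\<leftarrow>assign st b (snd b'). s * state_vand st' y)"
    by (rule state_vand_assign[where y = y and t = "snd b'", OF wf b(1) y(1)])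
  also have "\<dots> = (\<Sum>(s, st')\<leftarrow>assign st b (snd b'). s * (\<Sum>(s', st'')\<leftarrow>assign st' b' (snd b). s' * state_vand st'' y))"
  proof (rule arg_cong[where f = sum_list], rule map_cong[OF refl], clarify)
    fix s st' assume m: "(s, st') \<in> set (assign st b (snd b'))"
    note p = assign_props[OF wf b(1) m]
    have "b' \<in> set (box_list st')" using p(2) b False by simp
    then show "s * state_vand st' y = s * (\<Sum>(s', st'')\<leftarrow>assign st' b' (snd b). s' * state_vand st'' y)"
      using state_vand_assign[where y = y and t = "snd b", OF p(1) _ y(2)] by simp
  qed
  also have "\<dots> = (\<Sum>(s, st')\<leftarrow>assign2 st b b'. s * state_vand st' y)"
    by (rule sum_list_assign2[OF False, symmetric])
  finally show ?thesis .
qed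

text \<open>For an involution, a contributing placement must be of this kind: the point of a box in
  a positive row has to come from a box, hence also goes to one.\<close>

definition closed_Injs :: "('a \<Rightarrow> 'a) \<Rightarrow> (nat \<times> nat) set \<Rightarrow> 'a set \<Rightarrow> (nat \<times> nat \<Rightarrow> 'a) set" where
  "closed_Injs g B R = {q \<in> Injs B R. \<forall>b\<in>B. 0 < snd b \<longrightarrow> g (q b) \<in> q ` B}"

text \<open>The point \<open>x\<close> in box \<open>b\<close> determines the point in
  \<open>b'\<close>. Removing this orbit leaves a closed placement of the other boxes; a single box
  takes a fixed point, two boxes take a moved one and its image.\<close>

lemma closed_Injs_peel:
  assumes gg: "\<And>x. g (g x) = x" and b: "b \<in> B" "b' \<in> B" and R: "g ` R \<subseteq> R"
  shows "bij_betw (\<lambda>(x, q). q(b := x, b' := g x))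
     (SIGMA x:{x \<in> R. g x = x \<longleftrightarrow> b' = b}. closed_Injs g (B - {b, b'}) (R - {x, g x}))
     {q \<in> closed_Injs g B R. g (q b) = q b'}"
    (is "bij_betw ?f ?A ?C")
proof (rule bij_betw_byWitness[where f' = "\<lambda>q. (q b, restrict q (B - {b, b'}))"])
  let ?B = "B - {b, b'}"
  have ginj: "g x = g z \<longleftrightarrow> x = z" for x z using gg by metis
  show "\<forall>a\<in>?A. (?f a b, restrict (?f a) ?B) = a"
  proof
    fix a assume "a \<in> ?A"
    then obtain x q where a: "a = (x, q)" and x: "x \<in> R" "g x = x \<longleftrightarrow> b' = b" and q: "q \<in> closed_Injs g ?B (R - {x, g x})"
      by auto
    have "restrict (q(b := x, b' := g x)) ?B = q"
      using q unfolding closed_Injs_def Injs_def by (auto simp: fun_eq_iff restrict_def PiE_def extensional_def)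
    then show "(?f a b, restrict (?f a) ?B) = a" using x unfolding a by auto
  qed
  show "\<forall>q\<in>?C. ?f (q b, restrict q ?B) = q"
  proof
    fix q assume q: "q \<in> ?C"
    then have "q x = undefined" if "x \<notin> B" for x
      using q that PiE_arb[of q B "\<lambda>_. R" x] unfolding closed_Injs_def Injs_def by simp
    then show "?f (q b, restrict q ?B) = q" using q by (auto simp: fun_eq_iff restrict_def)
  qed
  show "?f ` ?A \<subseteq> ?C"
  proof (rule image_subsetI)
    fix a assume "a \<in> ?A"
    then obtain x q where a: "a = (x, q)" and x: "x \<in> R" "g x = x \<longleftrightarrow> b' = b" and q: "q \<in> closed_Injs g ?B (R - {x, g x})"
      by auto
    let ?q = "q(b := x, b' := g x)"
    have qPiE: "q \<in> ?B \<rightarrow>\<^sub>E (R - {x, g x})" and qi: "inj_on q ?B"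
      and qc: "\<And>z. z \<in> ?B \<Longrightarrow> 0 < snd z \<Longrightarrow> g (q z) \<in> q ` ?B"
      using q unfolding closed_Injs_def Injs_def by auto
    have qm: "q z \<in> R" "q z \<noteq> x" "q z \<noteq> g x" if "z \<in> ?B" for z
      using PiE_mem[OF qPiE that] by auto
    define q' where "q' = q(b := x, b' := g x)"
    have qz: "q' z = q z" if "z \<in> ?B" for z using that unfolding q'_def by auto
    have qb: "q' b = x" "q' b' = g x" using x(2) unfolding q'_def by auto
    have cases: "z \<in> ?B \<or> z = b \<or> z = b'" if "z \<in> B" for z using that by blast
    have mem: "q' z \<in> R" if "z \<in> B" for z
      using cases[OF that] qm(1)[of z] qz[of z] qb x(1) R by (metis image_subset_iff)
    have "q' z = undefined" if "z \<notin> B" for z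
    proof -
      have "z \<noteq> b" "z \<noteq> b'" using that b by auto
      then show ?thesis using PiE_arb[OF qPiE, of z] that unfolding q'_def by simp
    qed
    then have "q' \<in> B \<rightarrow>\<^sub>E R" using mem by (intro PiE_I)
    moreover have "inj_on q' B"
    proof (rule inj_onI)
      fix z w assume zw: "z \<in> B" "w \<in> B" "q' z = q' w"
      show "z = w"
      proof (cases "z \<in> ?B")
        case z: True
        show ?thesis
        proof (cases "w \<in> ?B")
          case True then show ?thesis using inj_onD[OF qi _ z True] zw(3) qz[OF z] qz[OF True] by simp
        next
          case False then show ?thesis using cases[OF zw(2)] zw(3) qz[OF z] qm[OF z] qb by metis
        qed
      next
        case z: False
        show ?thesis
        proof (cases "w \<in> ?B")
          case True then show ?thesis using cases[OF zw(1)] z zw(3) qz[OF True] qm[OF True] qb by metis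
        next
          case False then show ?thesis using cases[OF zw(1)] cases[OF zw(2)] z zw(3) qb x(2) by metis
        qed
      qed
    qed
    moreover have "g (q' z) \<in> q' ` B" if z: "z \<in> B" "0 < snd z" for z
      using cases[OF z(1)]
    proof (elim disjE)
      assume zB: "z \<in> ?B"
      obtain w where w: "w \<in> ?B" "g (q z) = q w" using qc[OF zB z(2)] by blast
      then have "g (q' z) = q' w" using qz[OF zB] qz[OF w(1)] by simp
      then show ?thesis using w(1) by blast
    next
      assume "z = b" then have "g (q' z) = q' b'" using qb by simp
      then show ?thesis using b by blast
    next
      assume "z = b'" then have "g (q' z) = q' b" using qb gg by simp
      then show ?thesis using b by blast
    qed
    moreover have "g (q' b) = q' b'" unfolding qb ..
    ultimately show "?f a \<in> ?C" unfolding closed_Injs_def Injs_def a q'_def by simp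
  qed
  show "(\<lambda>q. (q b, restrict q ?B)) ` ?C \<subseteq> ?A"
  proof (rule image_subsetI)
    fix q assume q: "q \<in> ?C"
    then have qP: "q \<in> B \<rightarrow>\<^sub>E R" "inj_on q B" "g (q b) = q b'"
      and cl: "\<And>z. z \<in> B \<Longrightarrow> 0 < snd z \<Longrightarrow> g (q z) \<in> q ` B" unfolding closed_Injs_def Injs_def by auto
    have gb': "g (q b') = q b" using qP(3) gg by metis
    have x: "q b \<in> R" "g (q b) = q b \<longleftrightarrow> b' = b"
      using qP b by (auto simp: inj_on_def)
    have ne: "q z \<noteq> q b" "q z \<noteq> g (q b)" if "z \<in> ?B" for z
      using that b qP by (auto simp: inj_on_def)
    have "restrict q ?B \<in> ?B \<rightarrow>\<^sub>E (R - {q b, g (q b)})"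
      using qP(1) ne by (auto simp: PiE_def Pi_def)
    moreover have "inj_on (restrict q ?B) ?B" using qP(2) by (auto simp: inj_on_def)
    moreover have "g (restrict q ?B z) \<in> restrict q ?B ` ?B" if z: "z \<in> ?B" "0 < snd z" for z
    proof -
      obtain w where w: "w \<in> B" "g (q z) = q w" using cl[of z] z by auto
      have "w \<noteq> b" using w ne(2)[OF z(1)] gg by metis
      moreover have "w \<noteq> b'" using w ne(1)[OF z(1)] gg qP(3) by metis
      ultimately have "w \<in> ?B" using w by simp
      then show ?thesis using w z by (auto intro!: image_eqI[of _ _ w])
    qed
    ultimately show "(q b, restrict q ?B) \<in> ?A" using x unfolding closed_Injs_def Injs_def by auto
  qed
qed

lemma hit_row_peel:
  assumes gg: "\<And>x. g (g x) = x" and b: "b \<in> B" "b' \<in> B" and R: "g ` R \<subseteq> R"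
    and x: "x \<in> R" "g x = x \<longleftrightarrow> b' = b" and q: "q \<in> closed_Injs g (B - {b, b'}) (R - {x, g x})"
  defines "q' \<equiv> q(b := x, b' := g x)"
  shows "hit_row B q' (g (q' b)) = snd b'" "hit_row B q' (g (q' b')) = snd b"
    and "z \<in> B - {b, b'} \<Longrightarrow> hit_row B q' (g (q' z)) = hit_row (B - {b, b'}) q (g (q z))"
proof -
  have "(x, q) \<in> (SIGMA x:{x \<in> R. g x = x \<longleftrightarrow> b' = b}. closed_Injs g (B - {b, b'}) (R - {x, g x}))"
    using x q by auto
  then have "q' \<in> {q \<in> closed_Injs g B R. g (q b) = q b'}"
    using bij_betw_apply[OF closed_Injs_peel[OF gg b R]] unfolding q'_def by fastforce
  then have inj: "inj_on q' B" and gb: "g (q' b) = q' b'" unfolding closed_Injs_def Injs_def by auto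
  have gb': "g (q' b') = q' b" using gb gg by metis
  show "hit_row B q' (g (q' b)) = snd b'" unfolding gb by (rule hit_row_eq[OF inj b(2)])
  show "hit_row B q' (g (q' b')) = snd b" unfolding gb' by (rule hit_row_eq[OF inj b(1)])
  assume z: "z \<in> B - {b, b'}"
  have qi: "inj_on q (B - {b, b'})" using q unfolding closed_Injs_def Injs_def by auto
  have q'z: "q' w = q w" if "w \<in> B - {b, b'}" for w using that unfolding q'_def by auto
  show "hit_row B q' (g (q' z)) = hit_row (B - {b, b'}) q (g (q z))"
  proof (cases "g (q z) \<in> q ` (B - {b, b'})")
    case True
    then obtain w where w: "w \<in> B - {b, b'}" "g (q z) = q w" by auto
    have "hit_row B q' (q' w) = snd w" using w by (intro hit_row_eq[OF inj]) auto
    then show ?thesis using w q'z[OF z] q'z[OF w(1)] hit_row_eq[OF qi w(1)] by simp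
  next
    case False
    have "g (q' z) \<notin> q' ` B"
    proof
      assume "g (q' z) \<in> q' ` B"
      then obtain w where w: "w \<in> B" "g (q' z) = q' w" by auto
      have "w \<noteq> b" using w gb' z b inj gg by (metis DiffD1 DiffD2 inj_onD insertCI)
      moreover have "w \<noteq> b'" using w gb z b inj gg by (metis DiffD1 DiffD2 inj_onD insertCI)
      ultimately have "w \<in> B - {b, b'}" using w by simp
      then show False using False w q'z z by (metis imageI)
    qed
    then show ?thesis using False q'z[OF z] unfolding hit_row_def by simp
  qed
qed

definition falling :: "int \<Rightarrow> nat \<Rightarrow> int" where
  "falling r k = (\<Prod>i<k. r - int i)"

lemma falling_0 [simp]: "falling r 0 = 1" and falling_Suc: "falling r (Suc k) = falling r k * (r - int k)"
  unfolding falling_def by simp_all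

lemma falling_Suc_left: "falling r (Suc k) = r * falling (r - 1) k"
  unfolding falling_def prod.lessThan_Suc_shift by (simp add: o_def algebra_simps)

lemma Injs_insert_bij:
  assumes "b \<notin> B"
  shows "bij_betw (\<lambda>(x, q). q(b := x)) (SIGMA x:R. Injs B (R - {x})) (Injs (insert b B) R)"
proof (rule bij_betw_byWitness[where f' = "\<lambda>q. (q b, restrict q B)"])
  have e: "restrict (q(b := x)) B = q" if "q \<in> Injs B R'" for q x R'
    using that assms unfolding Injs_def by (auto simp: fun_eq_iff restrict_def PiE_def extensional_def)
  show "\<forall>a\<in>SIGMA x:R. Injs B (R - {x}). ((case a of (x, q) \<Rightarrow> q(b := x)) b, restrict (case a of (x, q) \<Rightarrow> q(b := x)) B) = a"
    using e by auto
  show "\<forall>q\<in>Injs (insert b B) R. (case (q b, restrict q B) of (x, q) \<Rightarrow> q(b := x)) = q"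
  proof
    fix q assume q: "q \<in> Injs (insert b B) R"
    then have "q x = undefined" if "x \<notin> insert b B" for x
      using that PiE_arb[of q "insert b B" "\<lambda>_. R" x] unfolding Injs_def by simp
    then show "(case (q b, restrict q B) of (x, q) \<Rightarrow> q(b := x)) = q" by (auto simp: fun_eq_iff restrict_def)
  qed
  show "(\<lambda>(x, q). q(b := x)) ` (SIGMA x:R. Injs B (R - {x})) \<subseteq> Injs (insert b B) R"
  proof (rule image_subsetI)
    fix a assume "a \<in> (SIGMA x:R. Injs B (R - {x}))"
    then obtain x q where a: "a = (x, q)" "x \<in> R" and q: "q \<in> B \<rightarrow>\<^sub>E (R - {x})" "inj_on q B"
      unfolding Injs_def by auto
    have "q(b := x) \<in> insert b B \<rightarrow>\<^sub>E R"
      using PiE_mem[OF q(1)] PiE_arb[OF q(1)] a(2) by (intro PiE_I) auto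
    moreover have "inj_on (q(b := x)) (insert b B)"
    proof -
      have "inj_on (q(b := x)) B" using q(2) assms by (simp add: inj_on_fun_updI inj_on_def)
      moreover have "(q(b := x)) ` B = q ` B" using assms by (intro image_cong) auto
      ultimately show ?thesis using PiE_mem[OF q(1)] by (subst inj_on_insert) auto
    qed
    ultimately show "(case a of (x, q) \<Rightarrow> q(b := x)) \<in> Injs (insert b B) R"
      unfolding Injs_def a(1) by simp
  qed
  show "(\<lambda>q. (q b, restrict q B)) ` Injs (insert b B) R \<subseteq> (SIGMA x:R. Injs B (R - {x}))"
  proof (rule image_subsetI)
    fix q assume "q \<in> Injs (insert b B) R"
    then have q: "q \<in> insert b B \<rightarrow>\<^sub>E R" "inj_on q (insert b B)" unfolding Injs_def by auto
    have "q z \<noteq> q b" if "z \<in> B" for z using that assms inj_onD[OF q(2), of z b] by auto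
    then have "restrict q B \<in> B \<rightarrow>\<^sub>E (R - {q b})" using PiE_mem[OF q(1)] by simp
    moreover have "inj_on (restrict q B) B" using q(2) by (simp add: inj_on_restrict_eq inj_on_insert)
    ultimately show "(q b, restrict q B) \<in> (SIGMA x:R. Injs B (R - {x}))"
      using PiE_mem[OF q(1), of b] unfolding Injs_def by simp
  qed
qed

lemma card_Injs:
  fixes B :: "'b set"
  assumes "finite B" "finite R"
  shows "int (card (Injs B R)) = falling (int (card R)) (card B)"
  using assms
proof (induction B arbitrary: R rule: finite_induct)
  case empty
  have "Injs ({} :: 'b set) R = {\<lambda>x. undefined}" unfolding Injs_def by auto
  then show ?case by simp
next
  case (insert b B)
  have "card (Injs (insert b B) R) = card (SIGMA x:R. Injs B (R - {x}))"
    by (rule bij_betw_same_card[OF Injs_insert_bij[OF insert.hyps(2)], symmetric])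
  also have "int \<dots> = (\<Sum>x\<in>R. int (card (Injs B (R - {x}))))"
    using insert by (subst card_SigmaI) auto
  also have "\<dots> = (\<Sum>x\<in>R. falling (int (card R) - 1) (card B))"
  proof (rule sum.cong[OF refl])
    fix x assume x: "x \<in> R"
    then have "int (card (R - {x})) = int (card R) - 1"
      using insert.prems card_gt_0_iff[of R] by (auto simp: card_Diff_singleton of_nat_diff Suc_leI)
    then show "int (card (Injs B (R - {x}))) = falling (int (card R) - 1) (card B)"
      using insert.IH[of "R - {x}"] insert.prems by simp
  qed
  finally show ?case using insert.hyps by (simp add: falling_Suc_left)
qed

text \<open>\<open>r\<close> and \<open>f\<close> are the numbers of remaining points and remaining
  fixed points. Box \<open>b\<close> takes one of \<open>f\<close> fixed points, or one of
  \<open>r - f\<close> moved points together with a partner box. Once the boxes in \<open>bs\<close>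
  are settled, the others lie in row 0; they are labelled 0 and filled arbitrarily.\<close>

fun val :: "(nat \<times> nat) list \<Rightarrow> state \<Rightarrow> int \<Rightarrow> int \<Rightarrow> int" where
  "val [] st r f = state_vand st (\<lambda>_. 0) * falling r (card (set (box_list st)))"
| "val (b # bs) st r f = (if b \<in> set (box_list st) then
     (\<Sum>b'\<leftarrow>box_list st. \<Sum>(s, st')\<leftarrow>assign2 st b b'. s * (if b' = b then f * val bs st' (r - 1) (f - 1) else (r - f) * val bs st' (r - 2) f))
   else val bs st r f)"

lemma distinct_box_list:
  assumes "wf_state st"
  shows "distinct (box_list st)"
proof -
  have A: "distinct (concat (map (\<lambda>c. map (Pair c) (h c)) cs))" if "distinct cs" "\<And>c. c \<in> set cs \<Longrightarrow> distinct (h c)"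
    for cs :: "nat list" and h :: "nat \<Rightarrow> nat list"
    using that by (induction cs) (auto simp: distinct_map inj_on_def)
  have "distinct (fst (st ! c))" if "c < length st" for c
    using assms nth_mem[OF that] unfolding wf_state_def by (auto simp: case_prod_unfold)
  then show ?thesis unfolding box_list_def using A[of "[0..<length st]" "\<lambda>c. fst (st ! c)"] by simp
qed

lemma sum_sum_list: "(\<Sum>x\<in>A. \<Sum>y\<leftarrow>ys. F x y) = (\<Sum>y\<leftarrow>ys. \<Sum>x\<in>A. (F x y :: int))"
  by (induction ys) (auto simp: sum.distrib)

text \<open>Induction on the boxes in positive rows that are still to be settled; sorting the
  placements by the box to which the point of \<open>b\<close> goes splits off one orbit of
  \<open>g\<close>.\<close>

lemma val_correct:
  assumes gg: "\<And>x. g (g x) = x"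
  shows "finite R \<Longrightarrow> g ` R \<subseteq> R \<Longrightarrow> wf_state st \<Longrightarrow> (\<And>b. b \<in> set (box_list st) \<Longrightarrow> 0 < snd b \<Longrightarrow> b \<in> set bs) \<Longrightarrow>
    (\<And>b. b \<in> set bs \<Longrightarrow> 0 < snd b) \<Longrightarrow>
    (\<Sum>q\<in>closed_Injs g (set (box_list st)) R. state_vand st (\<lambda>b. hit_row (set (box_list st)) q (g (q b))))
    = val bs st (int (card R)) (int (card {x \<in> R. g x = x}))"
proof (induction bs arbitrary: st R)
  case Nil
  then have z: "snd b = 0" if "b \<in> set (box_list st)" for b using that by fastforce
  then have "hit_row (set (box_list st)) q x = 0" for q :: "nat \<times> nat \<Rightarrow> 'a" and x
    unfolding hit_row_def using inv_into_into[of x q "set (box_list st)"] by auto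
  moreover have "closed_Injs g (set (box_list st)) R = Injs (set (box_list st)) R"
    using z unfolding closed_Injs_def by auto
  ultimately show ?case using card_Injs[of "set (box_list st)" R] Nil.prems(1) by simp
next
  case (Cons b bs)
  let ?B = "set (box_list st)"
  let ?y = "\<lambda>B q b. hit_row B q (g (q b))"
  show ?case
  proof (cases "b \<in> ?B")
    case False
    then have v: "val (b # bs) st r f = val bs st r f" for r f by simp
    have i: "b' \<in> set bs" if "b' \<in> ?B" "0 < snd b'" for b'
      using Cons.prems(4)[OF that] False that(1) by (metis set_ConsD)
    have p: "0 < snd b'" if "b' \<in> set bs" for b' using Cons.prems(5)[of b'] that by simp
    show ?thesis unfolding v by (rule Cons.IH[OF Cons.prems(1-3) i p])
  next
    case b: True
    have b0: "0 < snd b" by (rule Cons.prems(5)) simp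
    let ?C = "closed_Injs g ?B R"
    have finC: "finite ?C" unfolding closed_Injs_def using Cons.prems(1) by simp
    \<comment> \<open>In a closed placement the point of \<open>b\<close>, a box in a positive row,
      goes to the point of exactly one box.\<close>
    have "(\<Sum>q\<in>?C. state_vand st (?y ?B q)) = (\<Sum>b'\<in>?B. \<Sum>q | q \<in> ?C \<and> inv_into ?B q (g (q b)) = b'. state_vand st (?y ?B q))"
    proof (rule sum.group[symmetric, OF finC])
      show "(\<lambda>q. inv_into ?B q (g (q b))) ` ?C \<subseteq> ?B"
        by (rule image_subsetI, rule inv_into_into) (use b b0 in \<open>simp add: closed_Injs_def\<close>)
    qed simp
    also have "\<dots> = (\<Sum>b'\<in>?B. \<Sum>q\<in>{q \<in> ?C. g (q b) = q b'}. state_vand st (?y ?B q))"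
    proof (intro sum.cong refl)
      fix b' assume b': "b' \<in> ?B"
      show "{q \<in> ?C. inv_into ?B q (g (q b)) = b'} = {q \<in> ?C. g (q b) = q b'}"
      proof (rule Collect_cong, rule conj_cong[OF refl])
        fix q assume "q \<in> ?C"
        then have "g (q b) \<in> q ` ?B" "inj_on q ?B" using b b0 unfolding closed_Injs_def Injs_def by auto
        then show "(inv_into ?B q (g (q b)) = b') = (g (q b) = q b')" using b' by (metis f_inv_into_f inv_into_f_f)
      qed
    qed
    also have "\<dots> = (\<Sum>b'\<in>?B. \<Sum>(s, st')\<leftarrow>assign2 st b b'. s * (if b' = b
        then int (card {x \<in> R. g x = x}) * val bs st' (int (card R) - 1) (int (card {x \<in> R. g x = x}) - 1)
        else (int (card R) - int (card {x \<in> R. g x = x})) * val bs st' (int (card R) - 2) (int (card {x \<in> R. g x = x}))))"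
    proof (rule sum.cong[OF refl])
      fix b' assume b': "b' \<in> ?B"
      let ?X = "{x \<in> R. g x = x \<longleftrightarrow> b' = b}"
      let ?B' = "?B - {b, b'}"
      let ?r = "int (card R)" and ?f = "int (card {x \<in> R. g x = x})"
      note peel = closed_Injs_peel[where g = g, OF gg b b' Cons.prems(2)]
      have finI: "finite (closed_Injs g ?B' (R - {x, g x}))" for x
        unfolding closed_Injs_def using Cons.prems(1) by simp
      have "(\<Sum>q\<in>{q \<in> ?C. g (q b) = q b'}. state_vand st (?y ?B q))
        = (\<Sum>(x,q)\<in>(SIGMA x:?X. closed_Injs g ?B' (R - {x, g x})). state_vand st (?y ?B (q(b := x, b' := g x))))"
        by (subst sum.reindex_bij_betw[OF peel, symmetric]) (simp add: case_prod_unfold)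
      also have "\<dots> = (\<Sum>x\<in>?X. \<Sum>q\<in>closed_Injs g ?B' (R - {x, g x}). state_vand st (?y ?B (q(b := x, b' := g x))))"
        by (rule sum.Sigma[symmetric]) (use Cons.prems(1) finI in auto)
      also have "\<dots> = (\<Sum>x\<in>?X. \<Sum>q\<in>closed_Injs g ?B' (R - {x, g x}). \<Sum>(s, st')\<leftarrow>assign2 st b b'. s * state_vand st' (?y ?B' q))"
      proof (intro sum.cong refl)
        fix x q assume x: "x \<in> ?X" and q: "q \<in> closed_Injs g ?B' (R - {x, g x})"
        then have x': "x \<in> R" "g x = x \<longleftrightarrow> b' = b" by auto
        note hr = hit_row_peel[where g = g, OF gg b b' Cons.prems(2) x' q]
        have "state_vand st (?y ?B (q(b := x, b' := g x))) = (\<Sum>(s, st')\<leftarrow>assign2 st b b'. s * state_vand st' (?y ?B (q(b := x, b' := g x))))"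
          by (rule state_vand_assign2[OF Cons.prems(3) b b']) (use hr in auto)
        also have "\<dots> = (\<Sum>(s, st')\<leftarrow>assign2 st b b'. s * state_vand st' (?y ?B' q))"
        proof (rule arg_cong[where f = sum_list], rule map_cong[OF refl], clarify)
          fix s st' assume "(s, st') \<in> set (assign2 st b b')"
          note p = assign2_props[OF Cons.prems(3) b b' this]
          have "state_vand st' (?y ?B (q(b := x, b' := g x))) = state_vand st' (?y ?B' q)"
            by (rule state_vand_cong) (use hr(3) p(2) in simp)
          then show "s * state_vand st' (?y ?B (q(b := x, b' := g x))) = s * state_vand st' (?y ?B' q)" by simp
        qed
        finally show "state_vand st (?y ?B (q(b := x, b' := g x))) = (\<Sum>(s, st')\<leftarrow>assign2 st b b'. s * state_vand st' (?y ?B' q))" .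
      qed
      also have "\<dots> = (\<Sum>(s, st')\<leftarrow>assign2 st b b'. s * (\<Sum>x\<in>?X. \<Sum>q\<in>closed_Injs g ?B' (R - {x, g x}). state_vand st' (?y ?B' q)))"
        by (simp add: sum_sum_list sum_distrib_left case_prod_unfold)
      also have "\<dots> = (\<Sum>(s, st')\<leftarrow>assign2 st b b'. s * (if b' = b then ?f * val bs st' (?r - 1) (?f - 1) else (?r - ?f) * val bs st' (?r - 2) ?f))"
      proof (rule arg_cong[where f = sum_list], rule map_cong[OF refl], clarify)
        fix s st' assume m: "(s, st') \<in> set (assign2 st b b')"
        note p = assign2_props[OF Cons.prems(3) b b' m]
        have in_bs: "z \<in> set bs" if "z \<in> set (box_list st')" "0 < snd z" for z
          using that Cons.prems(4)[of z] p(2) by auto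
        have IH: "(\<Sum>q\<in>closed_Injs g ?B' (R - {x, g x}). state_vand st' (?y ?B' q))
          = val bs st' (int (card (R - {x, g x}))) (int (card {z \<in> R - {x, g x}. g z = z}))" if x: "x \<in> ?X" for x
        proof -
          have "g ` (R - {x, g x}) \<subseteq> R - {x, g x}"
          proof (rule image_subsetI)
            fix z assume z: "z \<in> R - {x, g x}"
            then have "g z \<noteq> x" "g z \<noteq> g x" using gg[of z] gg[of x] by auto
            then show "g z \<in> R - {x, g x}" using z Cons.prems(2) by blast
          qed
          moreover have "finite (R - {x, g x})" using Cons.prems(1) by simp
          moreover have "0 < snd b'" if "b' \<in> set bs" for b' using Cons.prems(5)[of b'] that by simp
          ultimately show ?thesis
            using Cons.IH[of "R - {x, g x}" st', OF _ _ p(1) in_bs] unfolding p(2) by blast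
        qed
        have "(\<Sum>x\<in>?X. \<Sum>q\<in>closed_Injs g ?B' (R - {x, g x}). state_vand st' (?y ?B' q))
          = (if b' = b then ?f * val bs st' (?r - 1) (?f - 1) else (?r - ?f) * val bs st' (?r - 2) ?f)"
        proof (cases "b' = b")
          case True
          have v: "val bs st' (int (card (R - {x, g x}))) (int (card {z \<in> R - {x, g x}. g z = z})) = val bs st' (?r - 1) (?f - 1)"
            if x: "x \<in> R" "g x = x" for x
          proof -
            have e: "R - {x, g x} = R - {x}" "{z \<in> R - {x}. g z = z} = {z \<in> R. g z = z} - {x}" using x by auto
            have "card R > 0" "card {z \<in> R. g z = z} > 0" using x Cons.prems(1) by (auto simp: card_gt_0_iff)
            moreover have "card (R - {x}) = card R - 1" "card ({z \<in> R. g z = z} - {x}) = card {z \<in> R. g z = z} - 1"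
              by (rule card_Diff_singleton, use x in simp)+
            ultimately have i: "int (card (R - {x})) = ?r - 1" "int (card ({z \<in> R. g z = z} - {x})) = ?f - 1" by linarith+
            show ?thesis unfolding e i ..
          qed
          have "(\<Sum>x\<in>?X. \<Sum>q\<in>closed_Injs g ?B' (R - {x, g x}). state_vand st' (?y ?B' q)) = (\<Sum>x\<in>?X. val bs st' (?r - 1) (?f - 1))"
          proof (rule sum.cong[OF refl])
            fix x assume x: "x \<in> ?X"
            then have "x \<in> R" "g x = x" using True by auto
            from IH[OF x] v[OF this] show "(\<Sum>q\<in>closed_Injs g ?B' (R - {x, g x}). state_vand st' (?y ?B' q)) = val bs st' (?r - 1) (?f - 1)" by (rule trans)
          qed
          then show ?thesis using True by simp
        next
          case False
          have v: "val bs st' (int (card (R - {x, g x}))) (int (card {z \<in> R - {x, g x}. g z = z})) = val bs st' (?r - 2) ?f"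
            if x: "x \<in> R" "g x \<noteq> x" for x
          proof -
            have e: "{z \<in> R - {x, g x}. g z = z} = {z \<in> R. g z = z}" using x gg by auto
            have sub: "{x, g x} \<subseteq> R" using x Cons.prems(2) by auto
            have "card {x, g x} = 2" using x by simp
            then have "card R \<ge> 2" "card (R - {x, g x}) = card R - 2"
              using card_mono[OF Cons.prems(1) sub] card_Diff_subset[OF _ sub] by auto
            then show ?thesis unfolding e by (simp add: of_nat_diff)
          qed
          have "(\<Sum>x\<in>?X. \<Sum>q\<in>closed_Injs g ?B' (R - {x, g x}). state_vand st' (?y ?B' q)) = (\<Sum>x\<in>?X. val bs st' (?r - 2) ?f)"
          proof (rule sum.cong[OF refl])
            fix x assume x: "x \<in> ?X"
            then have "x \<in> R" "g x \<noteq> x" using False by auto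
            from IH[OF x] v[OF this] show "(\<Sum>q\<in>closed_Injs g ?B' (R - {x, g x}). state_vand st' (?y ?B' q)) = val bs st' (?r - 2) ?f" by (rule trans)
          qed
          also have "\<dots> = int (card ?X) * val bs st' (?r - 2) ?f" by simp
          also have "int (card ?X) = ?r - ?f"
          proof -
            have "?X = R - {x \<in> R. g x = x}" using False by auto
            then show ?thesis using Cons.prems(1) card_mono[of R "{x \<in> R. g x = x}"]
              by (simp add: card_Diff_subset of_nat_diff)
          qed
          finally show ?thesis using False by simp
        qed
        then show "s * (\<Sum>x\<in>?X. \<Sum>q\<in>closed_Injs g ?B' (R - {x, g x}). state_vand st' (?y ?B' q))
          = s * (if b' = b then ?f * val bs st' (?r - 1) (?f - 1) else (?r - ?f) * val bs st' (?r - 2) ?f)" by simp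
      qed
      finally show "(\<Sum>q\<in>{q \<in> ?C. g (q b) = q b'}. state_vand st (?y ?B q))
        = (\<Sum>(s, st')\<leftarrow>assign2 st b b'. s * (if b' = b then ?f * val bs st' (?r - 1) (?f - 1) else (?r - ?f) * val bs st' (?r - 2) ?f))" .
    qed
    also have "\<dots> = val (b # bs) st (int (card R)) (int (card {x \<in> R. g x = x}))"
      using b by (simp add: sum.distinct_set_conv_list[OF distinct_box_list[OF Cons.prems(3)]])
    finally show ?thesis .
  qed
qed

text \<open>Otherwise, exchanging an element that is at least \<open>card A\<close> for a missing
  smaller number would push the sum below the least possible for that cardinality.\<close>

lemma sum_min_eq_lessThan:
  fixes A :: "nat set"
  assumes A: "finite A" and le: "\<Sum>A \<le> \<Sum>{..<card A}"
  shows "A = {..<card A}"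
proof (rule ccontr)
  assume ne: "A \<noteq> {..<card A}"
  have "\<exists>a\<in>A. card A \<le> a"
  proof (rule ccontr)
    assume "\<not> ?thesis"
    then have "A \<subseteq> {..<card A}" by (auto simp: not_le)
    then show False using card_subset_eq[of "{..<card A}" A] ne by simp
  qed
  then obtain a where a: "a \<in> A" "card A \<le> a" by blast
  have "\<exists>b<card A. b \<notin> A"
  proof (rule ccontr)
    assume "\<not> ?thesis"
    then have "{..<card A} \<subseteq> A" by auto
    then show False using card_subset_eq[of A "{..<card A}"] A ne by simp
  qed
  then obtain b where b: "b < card A" "b \<notin> A" by blast
  let ?A = "insert b (A - {a})"
  have c: "card ?A = card A" using a b A by (simp add: card_Diff_singleton card_gt_0_iff)
  have "\<Sum>{0..<card ?A} \<le> \<Sum>?A" by (rule card_sum_le_nat_sum)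
  then have "\<Sum>{..<card A} \<le> b + (\<Sum>A - a)"
    using a b A unfolding c by (simp add: atLeast0LessThan sum_diff1_nat)
  moreover have "a \<le> \<Sum>A" using member_le_sum[of a A "\<lambda>x. x"] a A by simp
  ultimately show False using le a b by linarith
qed

definition init_state :: "nat list \<Rightarrow> state" where
  "init_state ls = map (\<lambda>m. ([0..<m], [0..<m])) ls"

lemma init_state_props:
  "wf_state (init_state ls)" "set (box_list (init_state ls)) = boxes ls"
  unfolding wf_state_def init_state_def set_box_list boxes_def by auto

lemma state_vand_init:
  "state_vand (init_state ls) y = (if \<forall>c<length ls. (\<lambda>r. y (c, r)) ` {..<ls ! c} = {..<ls ! c} then vandprod ls y else 0)"
proof -
  have "state_vand (init_state ls) y = (\<Prod>c<length ls. if (\<lambda>r. y (c, r)) ` {..<ls ! c} = {..<ls ! c} then vand (ls ! c) (\<lambda>r. y (c, r)) else 0)"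
    unfolding state_vand_def rel_vand_def vand_eq_rvand
    by (auto simp: init_state_def atLeast0LessThan intro!: prod.cong)
  also have "\<dots> = (if \<forall>c<length ls. (\<lambda>r. y (c, r)) ` {..<ls ! c} = {..<ls ! c} then vandprod ls y else 0)"
    unfolding vandprod_def by (auto intro!: prod.cong prod_zero)
  finally show ?thesis .
qed

text \<open>Distinct labels in a column of length m sum to at least 0 + ... + (m - 1). On the other
  hand, the labels are the rows of the boxes that are hit, so their total is at most the sum of all
  rows. Equality throughout forces every box in a positive row to be hit and every column to carry
  the labels 0, ..., m - 1.\<close>

lemma vandprod_support:
  assumes g: "inj g" and q: "q \<in> Injs (boxes ls) X" and nz: "vandprod ls (\<lambda>b. hit_row (boxes ls) q (g (q b))) \<noteq> 0"
  shows "\<And>b. b \<in> boxes ls \<Longrightarrow> 0 < snd b \<Longrightarrow> q b \<in> (\<lambda>b. g (q b)) ` boxes ls"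
    and "\<And>c. c < length ls \<Longrightarrow> (\<lambda>r. hit_row (boxes ls) q (g (q (c, r)))) ` {..<ls ! c} = {..<ls ! c}"
proof -
  let ?B = "boxes ls"
  let ?y = "\<lambda>b. hit_row ?B q (g (q b))"
  have qi: "inj_on q ?B" using q unfolding Injs_def by auto
  have inj: "inj_on (\<lambda>r. ?y (c, r)) {..<ls ! c}" if "c < length ls" for c
    using nz that unfolding vandprod_def by (auto simp: prod_zero_iff vand_nonzero_iff)
  let ?im = "\<lambda>c. (\<lambda>r. ?y (c, r)) ` {..<ls ! c}"
  have cim: "card (?im c) = ls ! c" if "c < length ls" for c using card_image[OF inj[OF that]] by simp
  \<comment> \<open>The boxes whose point is the image of the point of some box.\<close>
  let ?H = "{b \<in> ?B. q b \<in> (\<lambda>b. g (q b)) ` ?B}"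
  have sumB: "(\<Sum>b\<in>?B. F b) = (\<Sum>c<length ls. \<Sum>r<ls ! c. F (c, r))" for F :: "nat \<times> nat \<Rightarrow> nat"
    unfolding boxes_Sigma by (subst sum.Sigma) auto
  have s1: "(\<Sum>b\<in>?B. ?y b) = (\<Sum>c<length ls. \<Sum>(?im c))"
    unfolding sumB by (rule sum.cong[OF refl]) (simp add: sum.reindex[OF inj] o_def)
  have s2: "(\<Sum>b\<in>?B. ?y b) = (\<Sum>b\<in>?H. snd b)"
  proof -
    let ?S = "{b \<in> ?B. g (q b) \<in> q ` ?B}"
    have "(\<Sum>b\<in>?B. ?y b) = (\<Sum>b\<in>?S. ?y b)"
      by (rule sum.mono_neutral_right) (auto simp: hit_row_def)
    also have "\<dots> = (\<Sum>b\<in>?S. snd (inv_into ?B q (g (q b))))"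
      by (rule sum.cong) (auto simp: hit_row_def)
    also have "\<dots> = (\<Sum>b\<in>?H. snd b)"
    proof (rule sum.reindex_bij_betw)
      show "bij_betw (\<lambda>b. inv_into ?B q (g (q b))) ?S ?H"
        unfolding bij_betw_def
      proof
        show "inj_on (\<lambda>b. inv_into ?B q (g (q b))) ?S"
        proof (rule inj_onI)
          fix a b assume ab: "a \<in> ?S" "b \<in> ?S" "inv_into ?B q (g (q a)) = inv_into ?B q (g (q b))"
          then have "g (q a) = g (q b)" by (metis (no_types, lifting) f_inv_into_f mem_Collect_eq)
          then show "a = b" using g qi ab by (auto simp: inj_eq inj_on_eq_iff)
        qed
        show "(\<lambda>b. inv_into ?B q (g (q b))) ` ?S = ?H"
        proof (intro equalityI subsetI)
          fix b assume "b \<in> (\<lambda>b. inv_into ?B q (g (q b))) ` ?S"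
          then obtain a where a: "a \<in> ?B" "g (q a) \<in> q ` ?B" "b = inv_into ?B q (g (q a))" by auto
          then have "q b = g (q a)" "b \<in> ?B" by (auto simp: f_inv_into_f inv_into_into)
          then show "b \<in> ?H" using a by auto
        next
          fix b assume "b \<in> ?H"
          then obtain a where a: "b \<in> ?B" "a \<in> ?B" "q b = g (q a)" by auto
          then have "a \<in> ?S" "b = inv_into ?B q (g (q a))" using inv_into_f_f[OF qi a(1)] by (auto intro!: image_eqI[of _ _ b])
          then show "b \<in> (\<lambda>b. inv_into ?B q (g (q b))) ` ?S" by auto
        qed
      qed
    qed
    finally show ?thesis .
  qed
  have bound: "\<Sum>{..<ls ! c} \<le> \<Sum>(?im c)" if "c < length ls" for c
    using card_sum_le_nat_sum[of "?im c"] cim[OF that] by (simp add: atLeast0LessThan)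
  have tot: "(\<Sum>b\<in>?B. snd b) = (\<Sum>c<length ls. \<Sum>{..<ls ! c})" unfolding sumB by simp
  have le: "(\<Sum>b\<in>?H. snd b) \<le> (\<Sum>b\<in>?B. snd b)" by (rule sum_mono2) auto
  have ge: "(\<Sum>c<length ls. \<Sum>{..<ls ! c}) \<le> (\<Sum>c<length ls. \<Sum>(?im c))" by (rule sum_mono) (use bound in auto)
  have eqs: "(\<Sum>b\<in>?H. snd b) = (\<Sum>b\<in>?B. snd b)" "(\<Sum>c<length ls. \<Sum>(?im c)) = (\<Sum>c<length ls. \<Sum>{..<ls ! c})"
    using le ge s1 s2 tot by linarith+
  show "q b \<in> (\<lambda>b. g (q b)) ` ?B" if b: "b \<in> ?B" "0 < snd b" for b
  proof (rule ccontr)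
    assume "\<not> ?thesis"
    then have "(\<Sum>b\<in>?H. snd b) < (\<Sum>b\<in>?B. snd b)" using b by (intro sum_strict_mono2[of ?B ?H b]) auto
    then show False using eqs by simp
  qed
  show "?im c = {..<ls ! c}" if c: "c < length ls" for c
  proof -
    have "\<Sum>(?im c) \<le> \<Sum>{..<ls ! c}"
    proof (rule ccontr)
      assume "\<not> ?thesis"
      then have "(\<Sum>c<length ls. \<Sum>{..<ls ! c}) < (\<Sum>c<length ls. \<Sum>(?im c))"
        by (intro sum_strict_mono_ex1) (use bound c in \<open>auto simp: not_le\<close>)
      then show False using eqs by simp
    qed
    then show ?thesis using sum_min_eq_lessThan[of "?im c"] cim[OF c] by simp
  qed
qed

text \<open>For an involution, coming from a box and going to a box are the same, so all nonzero
  terms belong to closed placements.\<close>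

lemma involution_sum_eq_val:
  assumes gg: "\<And>x. g (g x) = x" and g: "g permutes X" and X: "finite X"
    and bs: "set bs = {b \<in> boxes ls. 0 < snd b}"
  shows "(\<Sum>q\<in>Injs (boxes ls) X. vandprod ls (\<lambda>b. hit_row (boxes ls) q (g (q b))))
    = val bs (init_state ls) (int (card X)) (int (card {x \<in> X. g x = x}))"
proof -
  let ?B = "boxes ls"
  have ginj: "inj g" using permutes_inj[OF g] .
  have "(\<Sum>q\<in>Injs ?B X. vandprod ls (\<lambda>b. hit_row ?B q (g (q b))))
      = (\<Sum>q\<in>closed_Injs g ?B X. state_vand (init_state ls) (\<lambda>b. hit_row ?B q (g (q b))))"
  proof (rule sum.mono_neutral_cong_right)
    show "\<forall>q\<in>Injs ?B X - closed_Injs g ?B X. vandprod ls (\<lambda>b. hit_row ?B q (g (q b))) = 0"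
    proof
      fix q assume q: "q \<in> Injs ?B X - closed_Injs g ?B X"
      then obtain b where b: "b \<in> ?B" "0 < snd b" "g (q b) \<notin> q ` ?B" unfolding closed_Injs_def by auto
      have "q b \<notin> (\<lambda>b. g (q b)) ` ?B"
      proof
        assume "q b \<in> (\<lambda>b. g (q b)) ` ?B"
        then obtain a where "a \<in> ?B" "q b = g (q a)" by auto
        then show False using b(3) gg by auto
      qed
      then show "vandprod ls (\<lambda>b. hit_row ?B q (g (q b))) = 0"
        using vandprod_support(1)[OF ginj _ _ b(1,2), of q X] q by blast
    qed
    fix q assume "q \<in> closed_Injs g ?B X"
    then have "q \<in> Injs ?B X" unfolding closed_Injs_def by simp
    then show "vandprod ls (\<lambda>b. hit_row ?B q (g (q b))) = state_vand (init_state ls) (\<lambda>b. hit_row ?B q (g (q b)))"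
      unfolding state_vand_init using vandprod_support(2)[OF ginj, of q ls X] by auto
  qed (use X in \<open>auto simp: closed_Injs_def\<close>)
  also have "\<dots> = val bs (init_state ls) (int (card X)) (int (card {x \<in> X. g x = x}))"
    unfolding init_state_props(2)[symmetric]
    by (rule val_correct[where g = g, OF gg X _ init_state_props(1)])
      (simp_all add: bs init_state_props(2) permutes_image[OF g])
  finally show ?thesis .
qed

text \<open>The weights along a path of the recursion depend only on its endpoint, so they are moved to the leaves.\<close>

fun leafval :: "(nat \<Rightarrow> nat \<Rightarrow> int) \<Rightarrow> (nat \<times> nat) list \<Rightarrow> state \<Rightarrow> nat \<Rightarrow> int" where
  "leafval w [] st q = state_vand st (\<lambda>_. 0) * w q (card (set (box_list st)))"
| "leafval w (b # bs) st q = (if b \<in> set (box_list st) then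
     (\<Sum>b'\<leftarrow>box_list st. \<Sum>(s, st')\<leftarrow>assign2 st b b'. s * leafval w bs st' (if b' = b then Suc q else q))
   else leafval w bs st q)"

text \<open>Of \<open>N\<close> boxes, \<open>q\<close> hold fixed points and \<open>m\<close> are
  left in row 0, so \<open>(N - m - q) div 2\<close> pairs of boxes hold two-cycles. The factors
  count the choices of fixed points, of moved points and of the remaining points.\<close>

definition leaf_weight :: "nat \<Rightarrow> int \<Rightarrow> int \<Rightarrow> nat \<Rightarrow> nat \<Rightarrow> int" where
  "leaf_weight N r f q m = falling f q * (\<Prod>i<(N - m - q) div 2. r - f - 2 * int i)
     * falling (r - 2 * int ((N - m - q) div 2) - int q) m"

text \<open>\<open>p\<close> pairs and \<open>q\<close> fixed points are already placed; the factor
  on the left is the weight collected on the way.\<close>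

lemma val_eq_leafval:
  "wf_state st \<Longrightarrow> card (set (box_list st)) + 2 * p + q = N \<Longrightarrow>
    falling f q * (\<Prod>i<p. r - f - 2 * int i) * val bs st (r - 2 * int p - int q) (f - int q) = leafval (leaf_weight N r f) bs st q"
proof (induction bs arbitrary: st p q)
  case Nil
  then have "(N - card (set (box_list st)) - q) div 2 = p" by auto
  then show ?case by (simp add: leaf_weight_def mult_ac)
next
  case (Cons b bs)
  let ?B = "set (box_list st)"
  let ?P = "\<lambda>p. \<Prod>i<p. r - f - 2 * int i"
  show ?case
  proof (cases "b \<in> ?B")
    case False
    then show ?thesis using Cons.IH[OF Cons.prems] by simp
  next
    case b: True
    have "falling f q * ?P p * val (b # bs) st (r - 2 * int p - int q) (f - int q)
       = (\<Sum>b'\<leftarrow>box_list st. \<Sum>(s, st')\<leftarrow>assign2 st b b'. s * (falling f q * ?P p * (if b' = b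
           then (f - int q) * val bs st' (r - 2 * int p - int q - 1) (f - int q - 1)
           else ((r - 2 * int p - int q) - (f - int q)) * val bs st' (r - 2 * int p - int q - 2) (f - int q))))"
    proof -
      have "val (b # bs) st (r - 2 * int p - int q) (f - int q)
       = (\<Sum>b'\<leftarrow>box_list st. \<Sum>(s, st')\<leftarrow>assign2 st b b'. s * (if b' = b
           then (f - int q) * val bs st' (r - 2 * int p - int q - 1) (f - int q - 1)
           else ((r - 2 * int p - int q) - (f - int q)) * val bs st' (r - 2 * int p - int q - 2) (f - int q)))"
        by (simp only: val.simps b if_True)
      then show ?thesis
        by (simp only: sum_list_const_mult[symmetric] case_prod_unfold)
          (intro arg_cong[where f = sum_list] map_cong refl, simp only: mult_ac)
    qed
    also have "\<dots> = (\<Sum>b'\<leftarrow>box_list st. \<Sum>(s, st')\<leftarrow>assign2 st b b'. s * leafval (leaf_weight N r f) bs st' (if b' = b then Suc q else q))"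
    proof (intro arg_cong[where f = sum_list] map_cong refl, clarify)
      fix b' s st' assume b': "b' \<in> ?B" and m: "(s, st') \<in> set (assign2 st b b')"
      note p = assign2_props[OF Cons.prems(1) b b' m]
      show "s * (falling f q * ?P p * (if b' = b
           then (f - int q) * val bs st' (r - 2 * int p - int q - 1) (f - int q - 1)
           else ((r - 2 * int p - int q) - (f - int q)) * val bs st' (r - 2 * int p - int q - 2) (f - int q)))
         = s * leafval (leaf_weight N r f) bs st' (if b' = b then Suc q else q)"
      proof (cases "b' = b")
        case True
        have "card (set (box_list st')) + 2 * p + Suc q = N"
          using Cons.prems(2) p(2) b True card_Suc_Diff1[OF _ b] by simp
        note IH = Cons.IH[OF p(1) this]
        have "r - 2 * int p - int (Suc q) = r - 2 * int p - int q - 1" "f - int (Suc q) = f - int q - 1" by simp_all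
        from IH[unfolded this falling_Suc] show ?thesis by (simp only: True refl if_True mult_ac)
      next
        case False
        have "card {b, b'} = 2" "{b, b'} \<subseteq> ?B" using False b b' by auto
        then have "card (set (box_list st')) = card ?B - 2" "card ?B \<ge> 2"
          using p(2) card_Diff_subset[of "{b, b'}" ?B] card_mono[of ?B "{b, b'}"] by auto
        then have "card (set (box_list st')) + 2 * Suc p + q = N" using Cons.prems(2) by simp
        note IH = Cons.IH[OF p(1) this]
        have "r - 2 * int (Suc p) - int q = r - 2 * int p - int q - 2"
          "r - 2 * int p - int q - (f - int q) = r - f - 2 * int p" by simp_all
        from IH[unfolded this(1) prod.lessThan_Suc] show ?thesis
          unfolding \<open>r - 2 * int p - int q - (f - int q) = r - f - 2 * int p\<close>
          by (simp only: False if_False mult_ac)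
      qed
    qed
    also have "\<dots> = leafval (leaf_weight N r f) (b # bs) st q" using b by simp
    finally show ?thesis .
  qed
qed

text \<open>Equal states are merged after every step, which keeps the recursion small.\<close>

type_synonym entry = "int \<times> nat \<times> state"

definition entry_sum :: "(nat \<Rightarrow> nat \<Rightarrow> int) \<Rightarrow> (nat \<times> nat) list \<Rightarrow> entry list \<Rightarrow> int" where
  "entry_sum w bs es = (\<Sum>(a, q, st)\<leftarrow>es. a * leafval w bs st q)"

definition expand :: "nat \<times> nat \<Rightarrow> entry \<Rightarrow> entry list" where
  "expand b e = (case e of (a, q, st) \<Rightarrow> let xs = box_list st in if b \<in> set xs then
     concat (map (\<lambda>b'. let q' = (if b' = b then Suc q else q) in map (\<lambda>(s, st'). (a * s, q', st')) (assign2 st b b')) xs)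
     else [e])"

fun merge :: "entry \<Rightarrow> entry list \<Rightarrow> entry list" where
  "merge e [] = [e]"
| "merge (a, k) ((a', k') # es) = (if k = k' then (a + a', k') # es else (a', k') # merge (a, k) es)"

primrec combine :: "(entry \<Rightarrow> bool) list \<Rightarrow> entry list \<Rightarrow> entry list" where
  "combine [] es = foldr merge es []"
| "combine (p # ps) es = (if length es \<le> 1 then es
     else case List.partition p es of (xs, ys) \<Rightarrow> combine ps xs @ combine ps ys)"

text \<open>If there are at most \<open>f\<close> fixed points, entries that have placed more than
  \<open>f\<close> of them carry weight zero; discarding them keeps the list short.\<close>

primrec run :: "nat \<Rightarrow> (entry \<Rightarrow> bool) list \<Rightarrow> (nat \<times> nat) list \<Rightarrow> entry list \<Rightarrow> entry list" where
  "run f ps [] es = es"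
| "run f ps (b # bs) es = run f ps bs (combine ps (filter (\<lambda>(a, q, st). q \<le> f) (concat (map (expand b) es))))"

text \<open>At a leaf only the nonempty columns matter, so dropping the empty ones lets more entries
  merge.\<close>

definition tally :: "entry list \<Rightarrow> entry list" where
  "tally es = foldr merge (map (\<lambda>(a, q, st). (a, q, filter (\<lambda>c. c \<noteq> ([], [])) st)) es) []"

lemma entry_sum_simps [simp]:
  "entry_sum w bs [] = 0" "entry_sum w bs (e # es) = (case e of (a, q, st) \<Rightarrow> a * leafval w bs st q) + entry_sum w bs es"
  "entry_sum w bs (es @ es') = entry_sum w bs es + entry_sum w bs es'"
  unfolding entry_sum_def by simp_all

lemma entry_sum_merge: "entry_sum w bs (merge e es) = entry_sum w bs [e] + entry_sum w bs es"
  by (induction e es rule: merge.induct) (auto simp: algebra_simps)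

lemma entry_sum_expand: "entry_sum w bs (expand b e) = entry_sum w (b # bs) [e]"
proof -
  obtain a q st where e: "e = (a, q, st)" by (cases e)
  have 1: "entry_sum w bs (map (\<lambda>(s, st'). (a * s, q', st')) xs) = (\<Sum>(s, st')\<leftarrow>xs. a * (s * leafval w bs st' q'))" for xs q'
    by (induction xs) (auto simp: algebra_simps)
  have 2: "entry_sum w bs (concat (map F xs)) = (\<Sum>x\<leftarrow>xs. entry_sum w bs (F x))" for F :: "'c \<Rightarrow> entry list" and xs
    by (induction xs) auto
  show ?thesis
  proof (cases "b \<in> set (box_list st)")
    case True
    have "entry_sum w bs (expand b e) = (\<Sum>b'\<leftarrow>box_list st. \<Sum>(s, st')\<leftarrow>assign2 st b b'. a * (s * leafval w bs st' (if b' = b then Suc q else q)))"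
      unfolding e expand_def prod.case Let_def if_P[OF True] 2 1 ..
    also have "\<dots> = a * (\<Sum>b'\<leftarrow>box_list st. \<Sum>(s, st')\<leftarrow>assign2 st b b'. s * leafval w bs st' (if b' = b then Suc q else q))"
      by (simp only: sum_list_const_mult[symmetric] case_prod_unfold)
    finally show ?thesis using True by (simp add: e)
  qed (simp add: e expand_def Let_def)
qed

lemma leafval_zero:
  assumes "\<And>q m. f < q \<Longrightarrow> w q m = 0"
  shows "f < q \<Longrightarrow> leafval w bs st q = 0"
proof (induction bs arbitrary: st q)
  case (Cons b bs)
  then have z: "leafval w bs st' (if b' = b then Suc q else q) = 0" for b' st' by simp
  show ?case using Cons by (simp add: z case_prod_unfold)
qed (simp add: assms)

lemma entry_sum_foldr_merge: "entry_sum w bs (foldr merge es []) = entry_sum w bs es"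
  by (induction es) (auto simp: entry_sum_merge)

lemma entry_sum_combine: "entry_sum w bs (combine ps es) = entry_sum w bs es"
proof (induction ps arbitrary: es)
  case (Cons p ps)
  have "entry_sum w bs (filter p es) + entry_sum w bs (filter (\<lambda>x. \<not> p x) es) = entry_sum w bs es"
    by (induction es) auto
  then show ?case using Cons by (simp add: o_def)
qed (simp add: entry_sum_foldr_merge)

lemma entry_sum_run:
  assumes "\<And>q m. f < q \<Longrightarrow> w q m = 0"
  shows "entry_sum w [] (run f ps bs es) = entry_sum w bs es"
proof (induction bs arbitrary: es)
  case (Cons b bs)
  have 2: "entry_sum w bs (filter (\<lambda>(a, q, st). q \<le> f) es') = entry_sum w bs es'" for es'
    by (induction es') (auto simp: leafval_zero[OF assms])
  have 3: "entry_sum w bs (concat (map (expand b) es')) = entry_sum w (b # bs) es'" for es'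
    by (induction es') (auto simp: entry_sum_expand simp del: leafval.simps)
  show ?case using Cons.IH by (simp add: entry_sum_combine 2 3 del: leafval.simps)
qed simp

lemma prod_list_filter_neq:
  fixes h :: "'c \<Rightarrow> 'd::comm_monoid_mult"
  assumes "h z = 1"
  shows "prod_list (map h (filter (\<lambda>x. x \<noteq> z) xs)) = prod_list (map h xs)"
  using assms by (induction xs) auto

lemma leafval_drop_empty: "leafval w [] (filter (\<lambda>c. c \<noteq> ([], [])) st) q = leafval w [] st q"
proof -
  let ?h = "\<lambda>c. rel_vand (set (fst c)) (set (snd c)) (\<lambda>_::nat. 0::nat)" and ?k = "\<lambda>c::nat list \<times> nat list. card (set (fst c))"
  have 1: "state_vand xs (\<lambda>_. 0) = prod_list (map ?h xs)" for xs
    unfolding state_vand_def by (simp add: prod.list_conv_set_nth atLeast0LessThan)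
  have "set (box_list xs) = (SIGMA c:{..<length xs}. set (fst (xs ! c)))" for xs
    unfolding set_box_list by auto
  then have 2: "card (set (box_list xs)) = sum_list (map ?k xs)" for xs
    by (simp add: sum.list_conv_set_nth atLeast0LessThan)
  have "sum_list (map ?k (filter (\<lambda>c. c \<noteq> ([], [])) st)) = sum_list (map ?k st)"
    by (induction st) auto
  then show ?thesis
    using prod_list_filter_neq[of ?h "([], [])" st] by (simp add: 1 2 rel_vand_def rvand_def)
qed

lemma entry_sum_tally: "entry_sum w [] (tally es) = entry_sum w [] es"
proof -
  have "entry_sum w [] (map (\<lambda>(a, q, st). (a, q, filter (\<lambda>c. c \<noteq> ([], [])) st)) es) = entry_sum w [] es"
    by (induction es) (auto simp: leafval_drop_empty simp del: leafval.simps)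
  then show ?thesis unfolding tally_def by (simp only: entry_sum_foldr_merge)
qed

text \<open>The list on the right involves neither \<open>r\<close> nor \<open>f\<close>, only the
  bound \<open>k\<close>; these two numbers enter through the weights. One evaluation thus serves
  every degree.\<close>

lemma val_eq_tally:
  assumes f: "f \<le> k"
  shows "val bs (init_state ls) r (int f)
    = entry_sum (leaf_weight (sum_list ls) r (int f)) [] (tally (run k ps bs [(1, 0, init_state ls)]))"
proof -
  have N: "card (set (box_list (init_state ls))) + 2 * 0 + 0 = sum_list ls"
    by (simp add: init_state_props card_boxes)
  have "val bs (init_state ls) r (int f) = leafval (leaf_weight (sum_list ls) r (int f)) bs (init_state ls) 0"
    using val_eq_leafval[OF init_state_props(1) N, of "int f" r bs] by simp
  also have "\<dots> = entry_sum (leaf_weight (sum_list ls) r (int f)) bs [(1, 0, init_state ls)]"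
    by (simp del: leafval.simps)
  also have "\<dots> = entry_sum (leaf_weight (sum_list ls) r (int f)) [] (run k ps bs [(1, 0, init_state ls)])"
  proof (rule entry_sum_run[symmetric])
    fix q m :: nat assume q: "k < q"
    then have "f < q" using f by simp
    then have "falling (int f) q = 0" unfolding falling_def by (intro prod_zero bexI[of _ f]) auto
    then show "leaf_weight (sum_list ls) r (int f) q m = 0" unfolding leaf_weight_def by simp
  qed
  finally show ?thesis by (simp only: entry_sum_tally)
qed

definition staircase_boxes :: "(nat \<times> nat) list" where
  "staircase_boxes = [(0,4), (0,3), (1,3), (0,2), (1,2), (2,2), (0,1), (1,1), (2,1), (3,1)]"

text \<open>The tests only sort states into buckets before equal ones are merged; their choice affects speed, not correctness.\<close>

definition staircase_tests :: "(entry \<Rightarrow> bool) list" where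
  "staircase_tests = map (\<lambda>(c, l) (a, q, st). l \<in> set (snd (st ! c)))
     [(0,0), (1,0), (0,1), (1,1), (2,0), (2,1), (3,0), (0,2), (1,2), (0,3)]"

text \<open>All coefficients with at most three fixed points cancel, so the signed count is zero
  whatever the weights are.\<close>

lemma staircase_run:
  "list_all (\<lambda>(a, q, st). a = 0) (tally (run 3 staircase_tests staircase_boxes [(1, 0, init_state [5,4,3,2])]))"
  by code_simp

section \<open>Involutions and hooks\<close>

lemma commute_fixed_transpose:
  assumes g: "g permutes X" and ab: "a \<in> X" "b \<in> X" "a \<noteq> b" "g a = a" "g b = b"
  shows "\<exists>t. t permutes X \<and> \<not> evenperm t \<and> t \<circ> g = g \<circ> t"
proof (intro exI conjI)
  show "transpose a b permutes X" using ab by (simp add: permutes_swap_id)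
  show "\<not> evenperm (transpose a b)" using ab by (simp add: evenperm_swap)
  have ga: "g x = a \<longleftrightarrow> x = a" and gb: "g x = b \<longleftrightarrow> x = b" for x using permutes_inj[OF g] ab by (metis injD)+
  show "transpose a b \<circ> g = g \<circ> transpose a b"
    using ab(3) by (auto simp: fun_eq_iff transpose_def ga gb ab(4,5))
qed

lemma commute_two_cycle:
  assumes g: "g permutes X" and a: "a \<in> X" "g a \<noteq> a" "g (g a) = a"
  shows "\<exists>t. t permutes X \<and> \<not> evenperm t \<and> t \<circ> g = g \<circ> t"
proof (intro exI conjI)
  have "g a \<in> X" using a permutes_in_image[OF g] by simp
  then show "transpose a (g a) permutes X" using a by (simp add: permutes_swap_id)
  show "\<not> evenperm (transpose a (g a))" using a by (simp add: evenperm_swap)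
  have ga: "g x = a \<longleftrightarrow> x = g a" and gb: "g x = g a \<longleftrightarrow> x = a" for x using permutes_inj[OF g] a by (metis injD)+
  show "transpose a (g a) \<circ> g = g \<circ> transpose a (g a)"
    using a(2) by (auto simp: fun_eq_iff transpose_def ga gb a(3))
qed

text \<open>The transposition on a moved point and its image commutes with \<open>g\<close>, which
  settles the alternating group.\<close>

lemma involution_vanishing:
  assumes G: "sym_or_alt n G" and gG: "g \<in> carrier G" and gg: "\<And>x. g (g x) = x"
    and ls: "sum_list ls \<le> n" "\<And>m. m \<in> set ls \<Longrightarrow> 0 < m"
    and moved: "\<exists>a. g a \<noteq> a" and bs: "set bs = {b \<in> boxes ls. 0 < snd b}"
    and z: "val bs (init_state ls) (int n) (int (card {x \<in> {1..n}. g x = x})) = 0"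
  shows "vanishing G g"
proof (rule polytabloid_vanishing[OF G gG ls])
  note g = sym_or_alt_carrier[OF G gG]
  obtain a where "g a \<noteq> a" using moved by blast
  then show "\<exists>t. t permutes {1..n} \<and> \<not> evenperm t \<and> t \<circ> g = g \<circ> t"
    using commute_two_cycle[OF g, of a] gg permutes_not_in[OF g] by metis
  show "(\<Sum>q\<in>Injs (boxes ls) {1..n}. vandprod ls (\<lambda>b. hit_row (boxes ls) q (g (q b)))) = 0"
    using involution_sum_eq_val[where g = g, OF gg g _ bs] z by simp
qed

lemma involution_three_fixed_vanishing:
  assumes G: "sym_or_alt n G" and gG: "g \<in> carrier G" and gg: "\<And>x. g (g x) = x" and n: "n \<ge> 14"
    and moved: "\<exists>a. g a \<noteq> a" and f: "card {x \<in> {1..n}. g x = x} = 3"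
  shows "vanishing G g"
proof (rule involution_vanishing[OF G gG gg _ _ moved])
  let ?ls = "[5,4,3,2] :: nat list"
  show "set staircase_boxes = {b \<in> boxes ?ls. 0 < snd b}"
  proof -
    have "set (filter (\<lambda>b. 0 < snd b) (box_list (init_state ?ls))) = set staircase_boxes" by code_simp
    then show ?thesis by (simp add: init_state_props)
  qed
  have "val staircase_boxes (init_state ?ls) (int n) (int 3)
      = entry_sum (leaf_weight (sum_list ?ls) (int n) (int 3)) [] (tally (run 3 staircase_tests staircase_boxes [(1, 0, init_state ?ls)]))"
    by (rule val_eq_tally) simp
  also have "\<dots> = 0"
  proof -
    have "entry_sum w [] es = 0" if "list_all (\<lambda>(a, q, st). a = 0) es" for w es
      using that by (induction es) (simp_all add: case_prod_unfold del: leafval.simps)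
    from this[OF staircase_run] show ?thesis .
  qed
  finally show "val staircase_boxes (init_state ?ls) (int n) (int (card {x \<in> {1..n}. g x = x})) = 0" unfolding f .
qed (use n in auto)

lemma involution_few_fixed_vanishing:
  assumes G: "sym_or_alt n G" and gG: "g \<in> carrier G" and gg: "\<And>x. g (g x) = x" and n: "n \<ge> 5"
    and moved: "\<exists>a. g a \<noteq> a" and f: "card {x \<in> {1..n}. g x = x} \<in> {0, 2}"
  shows "vanishing G g"
proof (rule involution_vanishing[OF G gG gg _ _ moved])
  let ?ls = "[3,2] :: nat list" and ?bs = "[(0,2), (0,1), (1,1)] :: (nat \<times> nat) list"
  show "set ?bs = {b \<in> boxes ?ls. 0 < snd b}"
  proof -
    have "set (filter (\<lambda>b. 0 < snd b) (box_list (init_state ?ls))) = set ?bs" by code_simp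
    then show ?thesis by (simp add: init_state_props)
  qed
  \<comment> \<open>Two nonzero coefficients remain, -3 and 3. Their weights agree for
    \<open>f = 2\<close> and are both zero for \<open>f = 0\<close>.\<close>
  have R: "tally (run 2 [] ?bs [(1, 0, init_state ?ls)]) = [(0, 0, [([0], [0])]), (- 3, 2, [([0], [0])]), (0, 1, [([0], [0]), ([0], [0])]), (3, 1, [])]"
    by code_simp
  have w: "leaf_weight 5 r 0 1 0 = 0" "leaf_weight 5 r 0 2 1 = 0" "leaf_weight 5 r 2 1 0 = leaf_weight 5 r 2 2 1" for r
    by (simp_all add: leaf_weight_def falling_def lessThan_nat_numeral algebra_simps)
  have e: "{(a::nat, b::nat). a = 0 \<and> b = 0 \<and> a < b} = {}" by auto
  have v: "state_vand [] (\<lambda>_. 0) = 1" "state_vand [([0], [0])] (\<lambda>_. 0) = 1"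
    by (simp_all add: state_vand_def rel_vand_def rvand_def e)
  have b: "box_list [] = []" "box_list [([0], [0])] = [(0, 0)]" unfolding box_list_def by simp_all
  have "val ?bs (init_state ?ls) (int n) (int f) = 0" if f: "f = 0 \<or> f = 2" for f
  proof -
    have "val ?bs (init_state ?ls) (int n) (int f)
        = entry_sum (leaf_weight (sum_list ?ls) (int n) (int f)) [] (tally (run 2 [] ?bs [(1, 0, init_state ?ls)]))"
      by (rule val_eq_tally) (use f in auto)
    also have "\<dots> = 0" unfolding R using f by (auto simp: w v b simp flip: One_nat_def)
    finally show ?thesis .
  qed
  then show "val ?bs (init_state ?ls) (int n) (int (card {x \<in> {1..n}. g x = x})) = 0"
    using f by auto
qed (use n in auto)

text \<open>The shape with one column of length \<open>k + 1\<close>. A contributing placement is a path starting in row 0 together with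
  an invariant set; adding the fixed point \<open>c\<close> to that set shortens the path by one and swaps two labels.\<close>

lemma hook_vanishing:
  assumes G: "sym_or_alt n G" and gG: "g \<in> carrier G" and k: "Suc k \<le> n" and c: "c \<in> {1..n}" "g c = c"
    and inv1: "\<And>A. A \<subseteq> {1..n} \<Longrightarrow> g ` A = A \<Longrightarrow> card A \<noteq> Suc k"
    and odd: "G = alt_group n \<Longrightarrow> \<exists>t. t permutes {1..n} \<and> \<not> evenperm t \<and> t \<circ> g = g \<circ> t"
  shows "vanishing G g"
proof (rule polytabloid_vanishing[OF G gG, where ls = "[Suc k]"])
  let ?X = "{1..n}" and ?B = "boxes [Suc k]"
  note g = sym_or_alt_carrier[OF G gG]
  have inv2: "c \<in> A" if A: "A \<subseteq> ?X" "g ` A = A" "card A = k" for A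
  proof (rule ccontr)
    assume "c \<notin> A"
    moreover have "finite A" using A(1) finite_subset by blast
    ultimately have "card (insert c A) = Suc k" using A(3) by simp
    then show False using inv1[of "insert c A"] A c by auto
  qed
  have ginj: "inj g" and gX: "g x \<in> ?X \<longleftrightarrow> x \<in> ?X" for x using permutes_inj[OF g] permutes_in_image[OF g] by auto
  have geq: "g x = g z \<longleftrightarrow> x = z" for x z using ginj by (simp add: inj_eq)
  have B: "?B = Pair 0 ` {..k}" unfolding boxes_def by (auto simp: less_Suc_eq_le)
  have cB: "card ?B = Suc k" unfolding card_boxes by simp
  have o: "(0,0) \<in> ?B" unfolding B by auto
  have zero: "b = (0,0)" if "b \<in> ?B" "\<not> 0 < snd b" for b using that unfolding B by auto
  define y where "y q b = hit_row ?B q (g (q b))" for q :: "nat \<times> nat \<Rightarrow> nat" and b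
  define \<Phi> where "\<Phi> q = vandprod [Suc k] (y q)" for q
  \<comment> \<open>The placements that can contribute, by \<open>vandprod_support\<close>.\<close>
  define Q where "Q = {q \<in> Injs ?B ?X. \<forall>b\<in>?B. 0 < snd b \<longrightarrow> q b \<in> (\<lambda>b. g (q b)) ` ?B}"
  have QD: "inj_on q ?B" "q \<in> ?B \<rightarrow>\<^sub>E ?X" "\<And>b. b \<in> ?B \<Longrightarrow> 0 < snd b \<Longrightarrow> \<exists>a\<in>?B. q b = g (q a)" "card (q ` ?B) = Suc k"
    if "q \<in> Q" for q
    using that cB card_image[of q ?B] unfolding Q_def Injs_def by auto
  \<comment> \<open>If the point in row 0 were hit as well, the placed points would form an
    invariant set of \<open>k + 1\<close> points.\<close>
  have start: "q (0,0) \<notin> g ` q ` ?B" if q: "q \<in> Q" for q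
  proof
    assume s: "q (0,0) \<in> g ` q ` ?B"
    have "q b \<in> g ` q ` ?B" if "b \<in> ?B" for b
      using QD(3)[OF q that] s zero[OF that] by (cases "0 < snd b") auto
    then have sub: "q ` ?B \<subseteq> g ` q ` ?B" by blast
    have "card (g ` q ` ?B) = card (q ` ?B)" by (rule card_image) (rule inj_on_subset[OF ginj], simp)
    then have "g ` q ` ?B = q ` ?B" using card_subset_eq[OF _ sub] by simp
    moreover have "q ` ?B \<subseteq> ?X" using PiE_mem[OF QD(2)[OF q]] by auto
    ultimately show False using inv1 QD(4)[OF q] by blast
  qed
  have ex_end: "\<exists>m\<in>?B. g (q m) \<notin> q ` ?B" if q: "q \<in> Q" for q
  proof (rule ccontr)
    assume "\<not> ?thesis"
    then have "g ` q ` ?B \<subseteq> q ` ?B" by auto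
    moreover have "card (g ` q ` ?B) = card (q ` ?B)" by (rule card_image) (rule inj_on_subset[OF ginj], simp)
    ultimately have "g ` q ` ?B = q ` ?B" using card_subset_eq[of "q ` ?B" "g ` q ` ?B"] by simp
    then show False using start[OF q] o by auto
  qed
  \<comment> \<open>All \<open>k\<close> points in positive rows are images of placed points; two
    ends would leave at most \<open>k - 1\<close> sources for them.\<close>
  have uniq: "m = m'" if q: "q \<in> Q" and m: "m \<in> ?B" "g (q m) \<notin> q ` ?B" "m' \<in> ?B" "g (q m') \<notin> q ` ?B" for q m m'
  proof (rule ccontr)
    assume ne: "m \<noteq> m'"
    have "q ` (?B - {(0,0)}) \<subseteq> g ` q ` (?B - {m, m'})"
    proof (rule image_subsetI)
      fix b assume b: "b \<in> ?B - {(0,0)}"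
      then obtain a where a: "a \<in> ?B" "q b = g (q a)" using QD(3)[OF q, of b] zero[of b] by blast
      then have "a \<noteq> m" "a \<noteq> m'" using m b by (metis DiffD1 imageI)+
      then show "q b \<in> g ` q ` (?B - {m, m'})" using a by auto
    qed
    then have "card (q ` (?B - {(0,0)})) \<le> card (g ` q ` (?B - {m, m'}))" by (intro card_mono) auto
    also have "\<dots> \<le> card (?B - {m, m'})" by (rule order.trans[OF card_image_le card_image_le]) simp_all
    also have "\<dots> = Suc k - 2" using m ne cB by (simp add: card_Diff_subset)
    finally have "card (q ` (?B - {(0,0)})) \<le> Suc k - 2" .
    moreover have "card (q ` (?B - {(0,0)})) = k"
      using card_image[OF inj_on_subset[OF QD(1)[OF q], of "?B - {(0,0)}"]] o cB by (simp add: card_Diff_singleton)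
    moreover have "k \<noteq> 0" using m(1,3) ne zero unfolding B by auto
    ultimately show False by linarith
  qed
  define e where "e q = (THE m. m \<in> ?B \<and> g (q m) \<notin> q ` ?B)" for q
  have e: "e q = m" if "q \<in> Q" "m \<in> ?B" "g (q m) \<notin> q ` ?B" for q m
    unfolding e_def by (rule the_equality) (use that uniq in blast)+
  \<comment> \<open>\<open>e q\<close> is the box at the end of the path. If \<open>c\<close> is
    placed, its box takes over the next point of the path; otherwise \<open>c\<close> replaces the
    last point of the path.\<close>
  define \<tau> where "\<tau> q = (if c \<in> q ` ?B then q(inv_into ?B q c := g (q (e q))) else q(e q := c))" for q
  have case1: "\<tau> q \<in> Q \<and> \<tau> (\<tau> q) = q \<and> \<Phi> (\<tau> q) = - \<Phi> q" if q: "q \<in> Q" and cq: "c \<in> q ` ?B" for q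
  proof -
    note D = QD[OF q]
    obtain l where l: "l \<in> ?B" "q l = c" using cq by auto
    have il: "inv_into ?B q c = l" using l D(1) by (metis inv_into_f_f)
    obtain m where m: "m \<in> ?B" "g (q m) \<notin> q ` ?B" using ex_end[OF q] by blast
    have em: "e q = m" by (rule e[OF q m])
    have inS: "g (q b) \<in> q ` ?B" if "b \<in> ?B" "b \<noteq> m" for b using uniq[OF q m] that by blast
    have l0: "l \<noteq> (0,0)" using start[OF q] l c(2) by (metis imageI)
    have ml: "m \<noteq> l" using m l c(2) by auto
    define q' where "q' = q(l := g (q m))"
    have \<tau>q: "\<tau> q = q'" unfolding \<tau>_def q'_def using cq il em by simp
    have q'l: "q' l = g (q m)" and q'b: "\<And>b. b \<noteq> l \<Longrightarrow> q' b = q b" unfolding q'_def by auto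
    have q'B: "q' ` ?B = insert (g (q m)) (q ` ?B - {c})"
    proof -
      have "q' ` ?B = insert (g (q m)) (q ` (?B - {l}))" using l(1) unfolding q'_def by (auto simp: image_iff)
      also have "q ` (?B - {l}) = q ` ?B - {c}" using l D(1) by (auto simp: inj_on_def)
      finally show ?thesis .
    qed
    have cne: "g (q m) \<noteq> c" using m(2) cq by auto
    have gc: "g x = c \<longleftrightarrow> x = c" for x using geq[of x c] c(2) by simp
    have "q' \<in> Injs ?B ?X"
    proof -
      have "q' \<in> ?B \<rightarrow>\<^sub>E ?X"
        using D(2) l(1) PiE_mem[OF D(2) m(1)] gX unfolding q'_def by (intro PiE_I) (auto dest: PiE_mem PiE_arb)
      moreover have "inj_on q' ?B" unfolding q'_def by (rule inj_on_fun_updI[OF D(1) m(2)])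
      ultimately show ?thesis unfolding Injs_def by simp
    qed
    moreover have "\<exists>a\<in>?B. q' b = g (q' a)" if b: "b \<in> ?B" "0 < snd b" for b
    proof (cases "b = l")
      case True
      then show ?thesis using q'l q'b[OF ml] m(1) by (intro bexI[of _ m]) auto
    next
      case False
      obtain a where a: "a \<in> ?B" "q b = g (q a)" using D(3)[OF b] by blast
      have "a \<noteq> l"
      proof
        assume "a = l"
        then have "q b = q l" using a l c(2) by simp
        then show False using inj_onD[OF D(1)] b l False by blast
      qed
      then show ?thesis using a q'b[OF False] q'b[of a] by (intro bexI[of _ a]) auto
    qed
    ultimately have q'Q: "q' \<in> Q" unfolding Q_def by blast
    have other: "g (q' b) \<in> q' ` ?B" if b: "b \<in> ?B" "b \<noteq> l" for b
    proof (cases "b = m")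
      case True then show ?thesis using q'b[OF ml] q'B by simp
    next
      case False
      have "g (q b) \<noteq> c" using gc b l inj_onD[OF D(1), of b l] by auto
      then show ?thesis using inS[OF b(1) False] q'b[OF b(2)] q'B by simp
    qed
    then have gl: "g (q' l) \<notin> q' ` ?B" using ex_end[OF q'Q] by blast
    have "c \<notin> q' ` ?B" unfolding q'B using cne by simp
    then have "\<tau> q' = q'(l := c)" unfolding \<tau>_def using e[OF q'Q l(1) gl] by simp
    also have "\<dots> = q" unfolding q'_def using l(2) by auto
    finally have \<tau>\<tau>: "\<tau> q' = q" .
    \<comment> \<open>Before the move \<open>l\<close> is labelled by its own row and
      \<open>m\<close> by 0; afterwards it is the reverse, and all other labels stay.\<close>
    have yb: "y q' b = y q (transpose l m b)" if b: "b \<in> ?B" for b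
    proof -
      have inj': "inj_on q' ?B" using QD(1)[OF q'Q] .
      consider "b = l" | "b = m" | "b \<noteq> l" "b \<noteq> m" by blast
      then show ?thesis
      proof cases
        case 1
        then show ?thesis using gl m unfolding y_def hit_row_def by simp
      next
        case 2
        have "y q' m = snd l" unfolding y_def using q'b[OF ml] q'l hit_row_eq[OF inj' l(1)] by simp
        moreover have "y q l = snd l" unfolding y_def using l c(2) hit_row_eq[OF D(1) l(1)] by simp
        ultimately show ?thesis using 2 by simp
      next
        case 3
        obtain a where a: "a \<in> ?B" "g (q b) = q a" using inS[OF b 3(2)] by auto
        have "a \<noteq> l" using a gc l 3(1) b inj_onD[OF D(1), of b l] by auto
        then have "g (q' b) = q' a" using a q'b 3 by simp
        then have "y q' b = snd a" unfolding y_def using hit_row_eq[OF inj' a(1)] by simp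
        moreover have "y q b = snd a" unfolding y_def using a hit_row_eq[OF D(1) a(1)] by simp
        ultimately show ?thesis using 3 by simp
      qed
    qed
    obtain i j where ij: "l = (0, i)" "m = (0, j)" "i \<le> k" "j \<le> k" using l(1) m(1) unfolding B by auto
    then have ne: "i \<noteq> j" using ml by auto
    have "\<Phi> q' = vand (Suc k) (\<lambda>r. y q' (0, r))" unfolding \<Phi>_def vandprod_def by simp
    also have "\<dots> = vand (Suc k) ((\<lambda>r. y q (0, r)) \<circ> transpose i j)"
      unfolding vand_def
    proof (rule prod.cong[OF refl])
      fix ab assume "ab \<in> rowpairs (Suc k)"
      then obtain r s where ab: "ab = (r, s)" "(0, r) \<in> ?B" "(0, s) \<in> ?B" unfolding rowpairs_def B by auto
      have "y q' (0, r) = y q (0, transpose i j r)" if "(0, r) \<in> ?B" for r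
        using yb[OF that] ij by (auto simp: transpose_def)
      then show "(case ab of (a, b) \<Rightarrow> sgn (int (y q' (0, b)) - int (y q' (0, a))))
        = (case ab of (a, b) \<Rightarrow> sgn (int (((\<lambda>r. y q (0, r)) \<circ> transpose i j) b) - int (((\<lambda>r. y q (0, r)) \<circ> transpose i j) a)))"
        using ab by simp
    qed
    also have "\<dots> = inv_sign (Suc k) (transpose i j) * vand (Suc k) (\<lambda>r. y q (0, r))"
      by (rule vand_permute) (use ij in \<open>auto intro: permutes_swap_id\<close>)
    also have "inv_sign (Suc k) (transpose i j) = - 1"
      using ne ij inv_sign_transpose[of i j "Suc k"] inv_sign_transpose[of j i "Suc k"]
      by (cases "i < j") (auto simp: transpose_commute)
    finally have "\<Phi> q' = - \<Phi> q" unfolding \<Phi>_def vandprod_def by simp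
    then show ?thesis using \<tau>q \<tau>\<tau> q'Q by simp
  qed
  have case2: "\<tau> q \<in> Q \<and> c \<in> \<tau> q ` ?B \<and> \<tau> (\<tau> q) = q" if q: "q \<in> Q" and cq: "c \<notin> q ` ?B" for q
  proof -
    note D = QD[OF q]
    obtain m where m: "m \<in> ?B" "g (q m) \<notin> q ` ?B" using ex_end[OF q] by blast
    have em: "e q = m" by (rule e[OF q m])
    have inS: "g (q b) \<in> q ` ?B" if "b \<in> ?B" "b \<noteq> m" for b using uniq[OF q m] that by blast
    \<comment> \<open>The path has at least two points: otherwise the other \<open>k\<close> placed
      points would form an invariant set without \<open>c\<close>.\<close>
    have m0: "m \<noteq> (0,0)"
    proof
      assume m0: "m = (0,0)"
      let ?A = "q ` (?B - {(0,0)})"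
      have A: "?A = q ` ?B - {q (0,0)}" using D(1) o by (auto simp: inj_on_def)
      have "g ` ?A \<subseteq> ?A"
      proof (rule image_subsetI)
        fix x assume "x \<in> ?A"
        then obtain b where b: "b \<in> ?B" "b \<noteq> (0,0)" "x = q b" by auto
        have "g x \<noteq> q (0,0)" using start[OF q] b by (metis imageI)
        then show "g x \<in> ?A" unfolding A using inS[OF b(1)] b m0 by simp
      qed
      moreover have "card (g ` ?A) = card ?A" by (rule card_image) (rule inj_on_subset[OF ginj], simp)
      ultimately have "g ` ?A = ?A" using card_subset_eq[of ?A "g ` ?A"] by simp
      moreover have "card ?A = k"
        using card_image[OF inj_on_subset[OF D(1), of "?B - {(0,0)}"]] o cB by (simp add: card_Diff_singleton)
      moreover have "?A \<subseteq> ?X" using PiE_mem[OF D(2)] by auto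
      ultimately have "c \<in> ?A" using inv2 by blast
      then show False using cq by auto
    qed
    then have "0 < snd m" using zero m(1) by blast
    then obtain a where a: "a \<in> ?B" "q m = g (q a)" using D(3)[OF m(1)] by blast
    have am: "a \<noteq> m" using a m by (metis imageI)
    define q' where "q' = q(m := c)"
    have \<tau>q: "\<tau> q = q'" unfolding \<tau>_def q'_def using cq em by simp
    have q'm: "q' m = c" and q'b: "\<And>b. b \<noteq> m \<Longrightarrow> q' b = q b" unfolding q'_def by auto
    have "q' \<in> Injs ?B ?X"
    proof -
      have "q' \<in> ?B \<rightarrow>\<^sub>E ?X"
        unfolding q'_def using PiE_fun_upd[OF c(1) D(2), of m] insert_absorb[OF m(1)] by metis
      moreover have "inj_on q' ?B" unfolding q'_def by (rule inj_on_fun_updI[OF D(1) cq])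
      ultimately show ?thesis unfolding Injs_def by simp
    qed
    moreover have "\<exists>a\<in>?B. q' b = g (q' a)" if b: "b \<in> ?B" "0 < snd b" for b
    proof (cases "b = m")
      case True
      then show ?thesis using m(1) q'm c(2) by (intro bexI[of _ m]) auto
    next
      case False
      obtain a where a: "a \<in> ?B" "q b = g (q a)" using D(3)[OF b] by blast
      have "a \<noteq> m" using a m(2) b by (metis imageI)
      then show ?thesis using a q'b[OF False] q'b[of a] by (intro bexI[of _ a]) auto
    qed
    ultimately have q'Q: "q' \<in> Q" unfolding Q_def by blast
    have inj': "inj_on q' ?B" using QD(1)[OF q'Q] .
    have cq': "c \<in> q' ` ?B" using q'm m(1) by (metis imageI)
    have il: "inv_into ?B q' c = m" using q'm m(1) inj' by (metis inv_into_f_f)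
    have "g (q' a) = q m" using a q'b[OF am] by simp
    moreover have "q m \<notin> q' ` ?B"
    proof
      assume "q m \<in> q' ` ?B"
      then obtain b where b: "b \<in> ?B" "q m = q' b" by auto
      show False
      proof (cases "b = m")
        case True then show False using imageI[OF m(1), of q] b q'm cq by simp
      next
        case False then show False using b q'b[OF False] inj_onD[OF D(1) _ m(1) b(1)] by simp
      qed
    qed
    ultimately have "e q' = a" "g (q' a) = q m" using e[OF q'Q a(1)] by auto
    then have "\<tau> q' = q" unfolding \<tau>_def using cq' il by (simp add: q'_def)
    then show ?thesis using \<tau>q q'Q cq' by simp
  qed
  have \<tau>: "\<tau> q \<in> Q" "\<tau> (\<tau> q) = q" "\<Phi> (\<tau> q) = - \<Phi> q" if q: "q \<in> Q" for q
    using case1[OF q] case2[OF q] case1[of "\<tau> q"] by (cases "c \<in> q ` ?B"; force)+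
  have "(\<Sum>q\<in>Q. \<Phi> q) = (\<Sum>q\<in>Q. - \<Phi> q)"
    by (rule sum.reindex_bij_witness[of _ \<tau> \<tau>]) (use \<tau> in auto)
  then have "(\<Sum>q\<in>Q. \<Phi> q) = 0" by (simp add: sum_negf)
  moreover have "(\<Sum>q\<in>Injs ?B ?X. \<Phi> q) = (\<Sum>q\<in>Q. \<Phi> q)"
  proof (rule sum.mono_neutral_right)
    show "\<forall>q\<in>Injs ?B ?X - Q. \<Phi> q = 0"
    proof
      fix q assume q: "q \<in> Injs ?B ?X - Q"
      then obtain b where b: "b \<in> ?B" "0 < snd b" "q b \<notin> (\<lambda>b. g (q b)) ` ?B" unfolding Q_def by blast
      show "\<Phi> q = 0"
      proof (rule ccontr)
        assume "\<Phi> q \<noteq> 0"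
        then show False using vandprod_support(1)[OF ginj _ _ b(1,2), of q ?X] q b(3) unfolding \<Phi>_def y_def by blast
      qed
    qed
  qed (auto simp: Q_def)
  ultimately show "(\<Sum>q\<in>Injs ?B ?X. vandprod [Suc k] (\<lambda>b. hit_row ?B q (g (q b)))) = 0"
    unfolding \<Phi>_def y_def by simp
qed (use k odd in auto)


section \<open>The hook whose column has three boxes\<close>

lemma sum_of_bool_triples:
  fixes A1 A2 A3 A4 A5 A6 :: "'a \<Rightarrow> 'b \<Rightarrow> 'c \<Rightarrow> bool"
  assumes "finite T"
  shows "(\<Sum>(x, y, z)\<in>T. of_bool (A1 x y z) - of_bool (A2 x y z) - of_bool (A3 x y z) - of_bool (A4 x y z)
      + of_bool (A5 x y z) + of_bool (A6 x y z)) = int (card {(x, y, z) \<in> T. A1 x y z}) - int (card {(x, y, z) \<in> T. A2 x y z})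
      - int (card {(x, y, z) \<in> T. A3 x y z}) - int (card {(x, y, z) \<in> T. A4 x y z})
      + int (card {(x, y, z) \<in> T. A5 x y z}) + int (card {(x, y, z) \<in> T. A6 x y z})"
proof -
  have c: "int (card {p \<in> T. P p}) = (\<Sum>p\<in>T. of_bool (P p))" for P
    using assms by (simp add: Int_def)
  show ?thesis unfolding case_prod_unfold by (simp add: c sum.distrib sum_subtractf)
qed

text \<open>Labels 1 and 2 occur at most once each, so the product is nonzero only if the three
  labels are 0, 1, 2 in some order; the six terms are these orders with their signs.\<close>

lemma three_box_sign:
  fixes a b c y z :: nat
  assumes "a \<noteq> b" "a \<noteq> c" "b \<noteq> c" "y \<noteq> z"
  defines "lab \<equiv> \<lambda>u. if u = y then 1 else if u = z then 2 else 0 :: nat"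
  shows "sgn (int (lab b) - int (lab a)) * sgn (int (lab c) - int (lab a)) * sgn (int (lab c) - int (lab b))
    = of_bool (b = y \<and> c = z) - of_bool (b = z \<and> c = y) - of_bool (a = y \<and> c = z) - of_bool (a = z \<and> b = y)
      + of_bool (a = y \<and> b = z) + of_bool (a = z \<and> c = y)"
proof -
  have i: "u = y \<longleftrightarrow> lab u = 1" "u = z \<longleftrightarrow> lab u = 2" and L: "lab u = 0 \<or> lab u = 1 \<or> lab u = 2" for u
    unfolding lab_def using \<open>y \<noteq> z\<close> by auto
  have d: "lab a = lab b \<Longrightarrow> lab a = 0" "lab a = lab c \<Longrightarrow> lab a = 0" "lab b = lab c \<Longrightarrow> lab b = 0"
    unfolding lab_def using assms(1-4) by (auto split: if_splits)
  show ?thesis unfolding i using d L[of a] L[of b] L[of c] by (elim disjE) simp_all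
qed

lemma set_eq3I: "(\<And>x y z. (x, y, z) \<in> A \<longleftrightarrow> (x, y, z) \<in> B) \<Longrightarrow> A = B"
  by auto

text \<open>The right-hand side equals \<open>n * ((f - 1) * (f - 2) - t)\<close>, which is
  \<open>2 * n\<close> times the value of the character of shape (n - 2, 1, 1).\<close>

lemma three_box_hook_sum:
  fixes g :: "nat \<Rightarrow> nat"
  assumes g: "g permutes X" and X: "finite X" "card X = n"
    and f: "f = card {x \<in> X. g x = x}" and t: "t = card {x \<in> X. g x \<noteq> x \<and> g (g x) = x}"
  shows "(\<Sum>q\<in>Injs (boxes [3]) X. vandprod [3] (\<lambda>b. hit_row (boxes [3]) q (g (q b))))
    = (int f * (int f - 1) - int t) * (int n - 2) - 2 * int f * (int n - int f) + 2 * (int n - int f - int t)"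
proof -
  let ?B = "boxes [3]" and ?F = "{x \<in> X. g x = x}"
  let ?T = "{(x, y, z). x \<in> X \<and> y \<in> X \<and> z \<in> X \<and> x \<noteq> y \<and> x \<noteq> z \<and> y \<noteq> z}"
  have B: "?B = {(0,0), (0,1), (0,2)}" unfolding boxes_def by (auto simp: numeral_eq_Suc less_Suc_eq)
  have rp: "rowpairs 3 = {(0,1), (0,2), (1,2)}" unfolding rowpairs_def by (auto simp: numeral_eq_Suc less_Suc_eq)
  have geq: "g x = g z \<longleftrightarrow> x = z" for x z using permutes_inj[OF g] by (simp add: inj_eq)
  have gX: "g x \<in> X \<longleftrightarrow> x \<in> X" for x using permutes_in_image[OF g] .
  have finT: "finite ?T" by (rule finite_subset[of _ "X \<times> X \<times> X"]) (use X in auto)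
  define lab where "lab y z u = (if u = y then 1 else if u = z then 2 else (0::nat))" for y z u :: nat
  define \<phi> where "\<phi> = (\<lambda>(x, y, z). vand 3 (\<lambda>r. lab y z (g ([x, y, z] ! r))))"
  have "(\<Sum>q\<in>Injs ?B X. vandprod [3] (\<lambda>b. hit_row ?B q (g (q b)))) = (\<Sum>p\<in>?T. \<phi> p)"
  proof (rule sum.reindex_bij_witness[where i = "\<lambda>(x, y, z). restrict (\<lambda>b. [x, y, z] ! snd b) ?B"
        and j = "\<lambda>q. (q (0,0), q (0,1), q (0,2))"])
    fix q assume "q \<in> Injs ?B X"
    then have q: "q \<in> ?B \<rightarrow>\<^sub>E X" "inj_on q ?B" unfolding Injs_def by auto
    show "(case (q (0,0), q (0,1), q (0,2)) of (x, y, z) \<Rightarrow> restrict (\<lambda>b. [x, y, z] ! snd b) ?B) = q"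
      using q(1) by (auto simp: B fun_eq_iff PiE_def extensional_def restrict_def)
    show "(q (0,0), q (0,1), q (0,2)) \<in> ?T"
      using PiE_mem[OF q(1)] q(2) by (auto simp: B inj_on_def)
    have h: "hit_row ?B q u = lab (q (0,1)) (q (0,2)) u" for u
    proof (cases "u \<in> q ` ?B")
      case True
      then obtain b where "b \<in> ?B" "u = q b" by auto
      moreover have "q (0,0) \<noteq> q (0,1)" "q (0,0) \<noteq> q (0,2)" "q (0,1) \<noteq> q (0,2)"
        using q(2) by (auto simp: B inj_on_def)
      ultimately show ?thesis using hit_row_eq[OF q(2), of b] by (auto simp: B lab_def)
    next
      case False
      then have "u \<noteq> q (0,1)" "u \<noteq> q (0,2)" by (auto simp: B)
      then show ?thesis using False by (simp add: hit_row_def lab_def)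
    qed
    show "\<phi> (q (0,0), q (0,1), q (0,2)) = vandprod [3] (\<lambda>b. hit_row ?B q (g (q b)))"
      by (simp add: \<phi>_def vandprod_def vand_def rp h lessThan_Suc)
  next
    fix p assume "p \<in> ?T"
    then obtain x y z where p: "p = (x, y, z)" "(x, y, z) \<in> ?T" by (cases p) auto
    show "(\<lambda>q. (q (0,0), q (0,1), q (0,2))) (case p of (x, y, z) \<Rightarrow> restrict (\<lambda>b. [x, y, z] ! snd b) ?B) = p"
      by (simp add: p B)
    show "(case p of (x, y, z) \<Rightarrow> restrict (\<lambda>b. [x, y, z] ! snd b) ?B) \<in> Injs ?B X"
      using p unfolding Injs_def by (auto simp: B inj_on_def)
  qed
  also have "\<dots> = (\<Sum>(x, y, z)\<in>?T. of_bool (g y = y \<and> g z = z) - of_bool (g y = z \<and> g z = y)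
      - of_bool (g x = y \<and> g z = z) - of_bool (g x = z \<and> g y = y)
      + of_bool (g x = y \<and> g y = z) + of_bool (g x = z \<and> g z = y))"
  proof (rule sum.cong[OF refl], clarify)
    fix x y z assume "x \<in> X" "y \<in> X" "z \<in> X" "x \<noteq> y" "x \<noteq> z" "y \<noteq> z"
    then have d: "g x \<noteq> g y" "g x \<noteq> g z" "g y \<noteq> g z" using geq by auto
    have "\<phi> (x, y, z) = sgn (int (lab y z (g y)) - int (lab y z (g x))) * sgn (int (lab y z (g z)) - int (lab y z (g x)))
        * sgn (int (lab y z (g z)) - int (lab y z (g y)))"
      unfolding \<phi>_def vand_def by (simp add: rp)
    also have "\<dots> = of_bool (g y = y \<and> g z = z) - of_bool (g y = z \<and> g z = y)
      - of_bool (g x = y \<and> g z = z) - of_bool (g x = z \<and> g y = y)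
      + of_bool (g x = y \<and> g y = z) + of_bool (g x = z \<and> g z = y)"
      unfolding lab_def by (rule three_box_sign[OF d \<open>y \<noteq> z\<close>])
    finally show "\<phi> (x, y, z) = \<dots>" .
  qed
  also have "\<dots> = int (card {(x, y, z) \<in> ?T. g y = y \<and> g z = z}) - int (card {(x, y, z) \<in> ?T. g y = z \<and> g z = y})
      - int (card {(x, y, z) \<in> ?T. g x = y \<and> g z = z}) - int (card {(x, y, z) \<in> ?T. g x = z \<and> g y = y})
      + int (card {(x, y, z) \<in> ?T. g x = y \<and> g y = z}) + int (card {(x, y, z) \<in> ?T. g x = z \<and> g z = y})"
    by (rule sum_of_bool_triples[OF finT])
  finally have sum: "(\<Sum>q\<in>Injs ?B X. vandprod [3] (\<lambda>b. hit_row ?B q (g (q b)))) = \<dots>" .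
  let ?M = "{x \<in> X. g x \<noteq> x}" and ?M2 = "{x \<in> X. g x \<noteq> x \<and> g (g x) = x}" and ?M3 = "{x \<in> X. g x \<noteq> x \<and> g (g x) \<noteq> x}"
  have fin: "finite ?F" "finite ?M" "finite ?M2" "finite ?M3" using X by auto
  have "card (?F \<union> ?M) = card ?F + card ?M" by (rule card_Un_disjoint) (use X in auto)
  moreover have "card ((?F \<union> ?M2) \<union> ?M3) = card (?F \<union> ?M2) + card ?M3" by (rule card_Un_disjoint) (use X in auto)
  moreover have "card (?F \<union> ?M2) = card ?F + card ?M2" by (rule card_Un_disjoint) (use X in auto)
  moreover have "?F \<union> ?M = X" "(?F \<union> ?M2) \<union> ?M3 = X" by auto
  ultimately have nM: "n = f + card ?M" "n = f + t + card ?M3" using f t X(2) by auto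
  \<comment> \<open>Once \<open>y\<close> and \<open>z\<close> are chosen, \<open>x\<close> is any
    of the other points.\<close>
  have K: "int (card {(x, y, z) \<in> ?T. (y, z) \<in> P}) = int (card P) * (int n - 2)" if P: "P \<subseteq> {(y, z). y \<in> X \<and> z \<in> X \<and> y \<noteq> z}" for P
  proof -
    have finP: "finite P" by (rule finite_subset[OF P], rule finite_subset[of _ "X \<times> X"]) (use X in auto)
    have "{(x, y, z) \<in> ?T. (y, z) \<in> P} = (\<lambda>((y, z), x). (x, y, z)) ` (SIGMA p:P. X - {fst p, snd p})"
      using P by (auto simp: image_iff)
    also have "card \<dots> = card (SIGMA p:P. X - {fst p, snd p})" by (rule card_image) (auto simp: inj_on_def)
    also have "\<dots> = (\<Sum>p\<in>P. card (X - {fst p, snd p}))" using finP X by (intro card_SigmaI) auto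
    also have "int \<dots> = (\<Sum>p\<in>P. int n - 2)" unfolding of_nat_sum
    proof (rule sum.cong[OF refl])
      fix p assume "p \<in> P"
      then have p: "fst p \<in> X" "snd p \<in> X" "fst p \<noteq> snd p" using P by auto
      then have "card {fst p, snd p} \<le> card X" using X by (intro card_mono) auto
      then show "int (card (X - {fst p, snd p})) = int n - 2" using p X by (subst card_Diff_subset) auto
    qed
    finally show ?thesis by simp
  qed
  have "{(x, y, z) \<in> ?T. g y = y \<and> g z = z} = {(x, y, z) \<in> ?T. (y, z) \<in> ?F \<times> ?F - (\<lambda>y. (y, y)) ` ?F}" by auto
  moreover have "int (card (?F \<times> ?F - (\<lambda>y. (y, y)) ` ?F)) = int f * (int f - 1)"
  proof -
    have "card ((\<lambda>y. (y, y)) ` ?F) = f" unfolding f by (rule card_image) (auto simp: inj_on_def)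
    moreover have "card (?F \<times> ?F - (\<lambda>y. (y, y)) ` ?F) = card (?F \<times> ?F) - card ((\<lambda>y. (y, y)) ` ?F)"
      by (rule card_Diff_subset) (use X in auto)
    moreover have "card (?F \<times> ?F) = f * f" unfolding f by (rule card_cartesian_product)
    moreover have "f \<le> f * f" by simp
    ultimately show ?thesis by (simp add: of_nat_diff algebra_simps)
  qed
  ultimately have c1: "int (card {(x, y, z) \<in> ?T. g y = y \<and> g z = z}) = int f * (int f - 1) * (int n - 2)"
    using K[of "?F \<times> ?F - (\<lambda>y. (y, y)) ` ?F"] by auto
  have e2: "{(x, y, z) \<in> ?T. g y = z \<and> g z = y} = {(x, y, z) \<in> ?T. (y, z) \<in> (\<lambda>y. (y, g y)) ` ?M2}" by auto
  have k2: "card ((\<lambda>y. (y, g y)) ` ?M2) = t" unfolding t by (rule card_image) (auto simp: inj_on_def)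
  have P2: "(\<lambda>y. (y, g y)) ` ?M2 \<subseteq> {(y, z). y \<in> X \<and> z \<in> X \<and> y \<noteq> z}" using gX by auto
  have c2: "int (card {(x, y, z) \<in> ?T. g y = z \<and> g z = y}) = int t * (int n - 2)"
    unfolding e2 K[OF P2] k2 ..
  have "{(x, y, z) \<in> ?T. g x = y \<and> g z = z} = (\<lambda>(x, z). (x, g x, z)) ` (?M \<times> ?F)"
  proof (rule set_eq3I)
    fix x y z show "(x, y, z) \<in> {(x, y, z) \<in> ?T. g x = y \<and> g z = z} \<longleftrightarrow> (x, y, z) \<in> (\<lambda>(x, z). (x, g x, z)) ` (?M \<times> ?F)"
      using gX[of x] geq[of x z] by auto
  qed
  moreover have "card ((\<lambda>(x, z). (x, g x, z)) ` (?M \<times> ?F)) = card ?M * f" by (subst card_image) (auto simp: inj_on_def card_cartesian_product f)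
  ultimately have c3: "int (card {(x, y, z) \<in> ?T. g x = y \<and> g z = z}) = int (card ?M * f)" by simp
  have "{(x, y, z) \<in> ?T. g x = z \<and> g y = y} = (\<lambda>(x, y). (x, y, g x)) ` (?M \<times> ?F)"
  proof (rule set_eq3I)
    fix x y z show "(x, y, z) \<in> {(x, y, z) \<in> ?T. g x = z \<and> g y = y} \<longleftrightarrow> (x, y, z) \<in> (\<lambda>(x, y). (x, y, g x)) ` (?M \<times> ?F)"
      using gX[of x] geq[of x y] by auto
  qed
  moreover have "card ((\<lambda>(x, y). (x, y, g x)) ` (?M \<times> ?F)) = card ?M * f" by (subst card_image) (auto simp: inj_on_def card_cartesian_product f)
  ultimately have c4: "int (card {(x, y, z) \<in> ?T. g x = z \<and> g y = y}) = int (card ?M * f)" by simp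
  have "{(x, y, z) \<in> ?T. g x = y \<and> g y = z} = (\<lambda>x. (x, g x, g (g x))) ` ?M3"
  proof (rule set_eq3I)
    fix x y z show "(x, y, z) \<in> {(x, y, z) \<in> ?T. g x = y \<and> g y = z} \<longleftrightarrow> (x, y, z) \<in> (\<lambda>x. (x, g x, g (g x))) ` ?M3"
      using gX[of x] gX[of "g x"] geq[of x "g x"] by auto
  qed
  moreover have "card ((\<lambda>x. (x, g x, g (g x))) ` ?M3) = card ?M3" by (rule card_image) (auto simp: inj_on_def)
  ultimately have c5: "int (card {(x, y, z) \<in> ?T. g x = y \<and> g y = z}) = int (card ?M3)" by simp
  have "{(x, y, z) \<in> ?T. g x = z \<and> g z = y} = (\<lambda>x. (x, g (g x), g x)) ` ?M3"
  proof (rule set_eq3I)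
    fix x y z show "(x, y, z) \<in> {(x, y, z) \<in> ?T. g x = z \<and> g z = y} \<longleftrightarrow> (x, y, z) \<in> (\<lambda>x. (x, g (g x), g x)) ` ?M3"
      using gX[of x] gX[of "g x"] geq[of x "g x"] by auto
  qed
  moreover have "card ((\<lambda>x. (x, g (g x), g x)) ` ?M3) = card ?M3" by (rule card_image) (auto simp: inj_on_def)
  ultimately have c6: "int (card {(x, y, z) \<in> ?T. g x = z \<and> g z = y}) = int (card ?M3)" by simp
  show ?thesis unfolding sum c1 c2 c3 c4 c5 c6 using nM by (simp add: algebra_simps)
qed

text \<open>The two cases of \<open>ft\<close> are zeros of
  \<open>(f - 1) * (f - 2) - t\<close>.\<close>

lemma two_hook_vanishing:
  assumes G: "sym_or_alt n G" and gG: "g \<in> carrier G" and n: "n \<ge> 3"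
    and ft: "card {x \<in> {1..n}. g x = x} = 2 \<and> card {x \<in> {1..n}. g x \<noteq> x \<and> g (g x) = x} = 0 \<or>
      card {x \<in> {1..n}. g x = x} = 0 \<and> card {x \<in> {1..n}. g x \<noteq> x \<and> g (g x) = x} = 2"
    and odd: "G = alt_group n \<Longrightarrow> \<exists>t. t permutes {1..n} \<and> \<not> evenperm t \<and> t \<circ> g = g \<circ> t"
  shows "vanishing G g"
proof (rule polytabloid_vanishing[OF G gG, where ls = "[3]"])
  show "(\<Sum>q\<in>Injs (boxes [3]) {1..n}. vandprod [3] (\<lambda>b. hit_row (boxes [3]) q (g (q b)))) = 0"
    using ft by (subst three_box_hook_sum[OF sym_or_alt_carrier[OF G gG] _ _ refl refl]) (auto simp: algebra_simps)
qed (use n odd in auto)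

section \<open>Cycle types\<close>

text \<open>Fixed points count as cycles of length one, so the entries add up to the size of
  \<open>X\<close>.\<close>

inductive cycle_type :: "'a set \<Rightarrow> ('a \<Rightarrow> 'a) \<Rightarrow> nat list \<Rightarrow> bool" where
  empty: "cycle_type {} id []"
| cycle: "cycle_type X p ls \<Longrightarrow> distinct cs \<Longrightarrow> cs \<noteq> [] \<Longrightarrow> set cs \<inter> X = {}
    \<Longrightarrow> cycle_type (set cs \<union> X) (cycle_of_list cs \<circ> p) (length cs # ls)"

lemma cycle_type_props:
  "cycle_type X p ls \<Longrightarrow> finite X"
  "cycle_type X p ls \<Longrightarrow> p permutes X"
  "cycle_type X p ls \<Longrightarrow> card X = sum_list ls"
  "cycle_type X p ls \<Longrightarrow> l \<in> set ls \<Longrightarrow> 0 < l"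
proof -
  show 1: "finite X" if "cycle_type X p ls" for X :: "'a set" and p ls using that by induction auto
  show "p permutes X" if "cycle_type X p ls" using that
  proof induction
    case (cycle X p ls cs)
    show ?case
      by (rule permutes_compose) (use cycle cycle_permutes[of cs] in \<open>auto intro: permutes_subset\<close>)
  qed (rule permutes_id)
  show "card X = sum_list ls" if "cycle_type X p ls" using that
    by induction (auto simp: card_Un_disjoint distinct_card 1)
  show "0 < l" if "cycle_type X p ls" "l \<in> set ls" using that
    by induction auto
qed

lemma ex_cycle_type_of_perm:
  assumes "p permutes X" "finite X"
  shows "\<exists>ls. cycle_type X p ls"
  using cycle_decomposition[OF assms]
proof induction
  case empty
  show ?case using cycle_type.empty by blast
next
  case (comp I p cs)
  then obtain ls where ls: "cycle_type I p ls" by blast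
  show ?case
  proof (cases "cs = []")
    \<comment> \<open>An empty list in the decomposition stands for the identity and is
      skipped.\<close>
    case True
    then show ?thesis using ls by (simp only: cycle_of_list.simps list.set id_o Un_empty_left) blast
  next
    case False
    then show ?thesis using cycle_type.cycle[OF ls comp(2) False comp(3)] by blast
  qed
qed

lemma ex_perm_of_cycle_type:
  assumes "\<And>l. l \<in> set ls \<Longrightarrow> 0 < l" "finite X" "card X = sum_list ls"
  shows "\<exists>p. cycle_type X p ls"
  using assms
proof (induction ls arbitrary: X)
  case Nil
  then show ?case using cycle_type.empty by auto
next
  case (Cons l ls)
  then have "l \<le> card X" by simp
  then obtain C where C: "C \<subseteq> X" "card C = l" "finite C" using obtain_subset_with_card_n by metis
  obtain cs where cs: "set cs = C" "distinct cs" using finite_distinct_list[OF C(3)] by blast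
  have len: "length cs = l" using cs C distinct_card by metis
  have "card (X - C) = sum_list ls" using Cons.prems C by (simp add: card_Diff_subset)
  then obtain p where "cycle_type (X - C) p ls" using Cons.IH[of "X - C"] Cons.prems by auto
  then have "cycle_type (set cs \<union> (X - C)) (cycle_of_list cs \<circ> p) (length cs # ls)"
    by (rule cycle_type.cycle) (use cs len Cons.prems(1)[of l] in auto)
  moreover have "set cs \<union> (X - C) = X" using cs C by auto
  ultimately show ?case using len by auto
qed

lemma evenperm_cycle_of_list:
  "distinct cs \<Longrightarrow> cs \<noteq> [] \<Longrightarrow> evenperm (cycle_of_list cs) \<longleftrightarrow> odd (length cs)"
proof (induction cs rule: cycle_of_list.induct)
  case (1 i j cs)
  then show ?case
    using evenperm_comp[OF permutation_swap_id permutation_of_cycle, of i j "j # cs"]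
    by (auto simp: evenperm_swap simp del: o_apply simp flip: fun.map_comp)
qed (auto simp: evenperm_id)

lemma evenperm_cycle_type:
  "cycle_type X p ls \<Longrightarrow> evenperm p \<longleftrightarrow> even (length (filter even ls))"
proof (induction rule: cycle_type.induct)
  case (cycle X p ls cs)
  have "permutation p" using cycle_type_props(1,2)[OF cycle(1)] permutation_permutes by blast
  then have e: "evenperm (cycle_of_list cs \<circ> p) = (evenperm (cycle_of_list cs) = evenperm p)"
    by (rule evenperm_comp[OF permutation_of_cycle])
  show ?case unfolding e evenperm_cycle_of_list[OF cycle(2,3)] cycle.IH by simp
qed (simp add: evenperm_id)

lemma funpow_cycle_of_list:
  assumes "distinct cs" "i < length cs"
  shows "(cycle_of_list cs ^^ k) (cs ! i) = cs ! ((k + i) mod length cs)"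
  using cyclic_rotation[OF assms(1), of k] nth_map[OF assms(2), of "cycle_of_list cs ^^ k"] nth_rotate[OF assms(2), of k]
  by (simp add: add.commute)

lemma funpow_cycle_of_list_fixes:
  assumes "distinct cs" "x \<in> set cs"
  shows "(cycle_of_list cs ^^ k) x = x \<longleftrightarrow> length cs dvd k"
proof -
  obtain i where i: "i < length cs" "x = cs ! i" using assms(2) by (metis in_set_conv_nth)
  have "(cycle_of_list cs ^^ k) x = x \<longleftrightarrow> (k + i) mod length cs = i"
    using i funpow_cycle_of_list[OF assms(1) i(1), of k] nth_eq_iff_index_eq[OF assms(1) _ i(1)]
    by (metis less_nat_zero_code mod_less_divisor neq0_conv)
  also have "\<dots> \<longleftrightarrow> length cs dvd k"
    using mod_eq_dvd_iff_nat[of i "k + i" "length cs"] i(1) by simp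
  finally show ?thesis .
qed

lemma funpow_agree:
  assumes "\<And>x. x \<in> A \<Longrightarrow> f x = h x \<and> h x \<in> A" "x \<in> A"
  shows "(f ^^ k) x = (h ^^ k) x" "(h ^^ k) x \<in> A"
proof -
  have "(f ^^ k) x = (h ^^ k) x \<and> (h ^^ k) x \<in> A" by (induction k) (use assms in auto)
  then show "(f ^^ k) x = (h ^^ k) x" "(h ^^ k) x \<in> A" by auto
qed

lemma cycle_comp_apply:
  assumes "cycle_type X p ls" "set cs \<inter> X = {}"
  shows "x \<in> set cs \<Longrightarrow> (cycle_of_list cs \<circ> p) x = cycle_of_list cs x \<and> cycle_of_list cs x \<in> set cs"
    "x \<in> X \<Longrightarrow> (cycle_of_list cs \<circ> p) x = p x \<and> p x \<in> X"
    "x \<notin> set cs \<union> X \<Longrightarrow> (cycle_of_list cs \<circ> p) x = x"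
proof -
  note p = cycle_type_props(2)[OF assms(1)]
  show "x \<in> set cs \<Longrightarrow> (cycle_of_list cs \<circ> p) x = cycle_of_list cs x \<and> cycle_of_list cs x \<in> set cs"
    using permutes_not_in[OF p, of x] permutes_in_image[OF cycle_permutes[of cs], of x] assms(2) by (auto simp: disjoint_iff)
  show "x \<in> X \<Longrightarrow> (cycle_of_list cs \<circ> p) x = p x \<and> p x \<in> X"
    using permutes_in_image[OF p, of x] permutes_not_in[OF cycle_permutes[of cs], of "p x"] assms(2) by (auto simp: disjoint_iff)
  show "x \<notin> set cs \<union> X \<Longrightarrow> (cycle_of_list cs \<circ> p) x = x"
    using permutes_not_in[OF p, of x] permutes_not_in[OF cycle_permutes[of cs], of x] by auto
qed

text \<open>The power \<open>p ^^ k\<close> fixes a cycle pointwise if its length divides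
  \<open>k\<close>, and moves all its points otherwise.\<close>

lemma card_fixed_funpow:
  "cycle_type X p ls \<Longrightarrow> card {x \<in> X. (p ^^ k) x = x} = sum_list (filter (\<lambda>l. l dvd k) ls)"
proof (induction rule: cycle_type.induct)
  case (cycle X p ls cs)
  let ?q = "cycle_of_list cs \<circ> p"
  note ap = cycle_comp_apply[OF cycle(1) cycle(4)]
  have "{x \<in> set cs \<union> X. (?q ^^ k) x = x} = {x \<in> set cs. length cs dvd k} \<union> {x \<in> X. (p ^^ k) x = x}"
    using funpow_agree(1)[of "set cs" ?q "cycle_of_list cs", OF ap(1)] funpow_agree(1)[of X ?q p, OF ap(2)]
      funpow_cycle_of_list_fixes[OF cycle(2)] by auto
  also have "card \<dots> = card {x \<in> set cs. length cs dvd k} + card {x \<in> X. (p ^^ k) x = x}"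
    by (rule card_Un_disjoint) (use cycle cycle_type_props(1)[OF cycle(1)] in auto)
  also have "card {x \<in> set cs. length cs dvd k} = (if length cs dvd k then length cs else 0)"
    using distinct_card[OF cycle(2)] by auto
  finally show ?case using cycle.IH by auto
qed simp

lemma funpow_eq_id_iff:
  assumes "cycle_type X p ls"
  shows "p ^^ k = id \<longleftrightarrow> (\<forall>l\<in>set ls. l dvd k)"
proof -
  note P = cycle_type_props[OF assms]
  have "p ^^ k = id \<longleftrightarrow> {x \<in> X. (p ^^ k) x = x} = X"
    using permutes_not_in[OF permutes_funpow[OF P(2), of k]] by (auto simp: fun_eq_iff)
  also have "\<dots> \<longleftrightarrow> card {x \<in> X. (p ^^ k) x = x} = card X"
    using card_subset_eq[OF P(1), of "{x \<in> X. (p ^^ k) x = x}"] by auto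
  also have "\<dots> \<longleftrightarrow> sum_list (filter (\<lambda>l. l dvd k) ls) = sum_list ls"
    unfolding card_fixed_funpow[OF assms] P(3) ..
  also have "\<dots> \<longleftrightarrow> (\<forall>l\<in>set ls. l dvd k)"
    using P(4)
  proof (induction ls)
    case (Cons l ls)
    have le: "sum_list (filter (\<lambda>l. l dvd k) ls) \<le> sum_list ls" by (induction ls) auto
    have "0 < l" using Cons.prems by simp
    moreover have "sum_list (filter (\<lambda>l. l dvd k) ls) = sum_list ls \<longleftrightarrow> (\<forall>l\<in>set ls. l dvd k)"
      by (rule Cons.IH) (use Cons.prems in simp)
    ultimately show ?case using le by (cases "l dvd k") auto
  qed simp
  finally show ?thesis .
qed

text \<open>Equal entries at different positions are told apart, so this counts unions of cycles
  with \<open>k\<close> points: the coefficient of \<open>x ^ k\<close> in the product of the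
  factors \<open>1 + x ^ l\<close>.\<close>

primrec subset_sums :: "nat list \<Rightarrow> nat \<Rightarrow> nat" where
  "subset_sums [] k = (if k = 0 then 1 else 0)"
| "subset_sums (l # ls) k = subset_sums ls k + (if l \<le> k then subset_sums ls (k - l) else 0)"

text \<open>Membership in \<open>A\<close> is carried along the whole cycle from its first
  entry.\<close>

lemma cycle_invariant_iff:
  assumes "distinct cs"
  shows "(\<forall>x\<in>set cs. cycle_of_list cs x \<in> A \<longleftrightarrow> x \<in> A) \<longleftrightarrow> set cs \<inter> A = {} \<or> set cs \<subseteq> A"
proof
  assume inv: "\<forall>x\<in>set cs. cycle_of_list cs x \<in> A \<longleftrightarrow> x \<in> A"
  have c: "cycle_of_list cs x \<in> set cs \<longleftrightarrow> x \<in> set cs" for x by (rule permutes_in_image[OF cycle_permutes])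
  have "(cycle_of_list cs ^^ k) x \<in> set cs \<and> ((cycle_of_list cs ^^ k) x \<in> A \<longleftrightarrow> x \<in> A)" if "x \<in> set cs" for x k
    by (induction k) (use inv c that in auto)
  moreover have "(cycle_of_list cs ^^ i) (cs ! 0) = cs ! i" if "i < length cs" for i
    using funpow_cycle_of_list[OF assms, of 0 i] that by (cases "cs = []") auto
  ultimately have "cs ! i \<in> A \<longleftrightarrow> cs ! 0 \<in> A" if "i < length cs" for i
    using that nth_mem[of 0 cs] by (metis length_pos_if_in_set nth_mem)
  then show "set cs \<inter> A = {} \<or> set cs \<subseteq> A" by (metis disjoint_iff in_set_conv_nth subsetI)
next
  have c: "cycle_of_list cs x \<in> set cs \<longleftrightarrow> x \<in> set cs" for x by (rule permutes_in_image[OF cycle_permutes])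
  assume "set cs \<inter> A = {} \<or> set cs \<subseteq> A"
  then show "\<forall>x\<in>set cs. cycle_of_list cs x \<in> A \<longleftrightarrow> x \<in> A" using c by blast
qed

text \<open>An invariant set contains the new cycle or misses it, and what remains inside
  \<open>X\<close> is invariant; the two cases are the two summands of
  \<open>subset_sums\<close>.\<close>

lemma card_stable_subsets:
  "cycle_type X p ls \<Longrightarrow> card {A. A \<subseteq> X \<and> card A = k \<and> (\<forall>x\<in>X. p x \<in> A \<longleftrightarrow> x \<in> A)} = subset_sums ls k"
proof (induction arbitrary: k rule: cycle_type.induct)
  case empty
  have "{A::'a set. A \<subseteq> {} \<and> card A = k \<and> (\<forall>x\<in>{}. id x \<in> A \<longleftrightarrow> x \<in> A)} = (if k = 0 then {{}} else {})" by auto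
  then show ?case by simp
next
  case (cycle X p ls cs)
  let ?C = "set cs"
  define S where "S k = {A. A \<subseteq> X \<and> card A = k \<and> (\<forall>x\<in>X. p x \<in> A \<longleftrightarrow> x \<in> A)}" for k
  let ?q = "cycle_of_list cs \<circ> p"
  let ?T = "if length cs \<le> k then (\<lambda>A. ?C \<union> A) ` S (k - length cs) else {}"
  note ap = cycle_comp_apply[OF cycle(1) cycle(4)]
  note fX = cycle_type_props(1)[OF cycle(1)]
  have lc: "card ?C = length cs" using distinct_card[OF cycle(2)] .
  have C0: "?C \<noteq> {}" using cycle(3) by simp
  have finS: "finite (S k)" for k unfolding S_def by (rule finite_subset[of _ "Pow X"]) (use fX in auto)
  have inv: "(\<forall>x\<in>?C \<union> X. ?q x \<in> A \<longleftrightarrow> x \<in> A) \<longleftrightarrow> (?C \<inter> A = {} \<or> ?C \<subseteq> A) \<and> (\<forall>x\<in>X. p x \<in> A \<longleftrightarrow> x \<in> A)" for A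
    unfolding ball_Un cycle_invariant_iff[OF cycle(2), symmetric] using ap by (simp del: o_apply)
  have pX: "p x \<in> X" if "x \<in> X" for x using ap(2)[OF that] by simp
  have L: "{A. A \<subseteq> ?C \<union> X \<and> card A = k \<and> (\<forall>x\<in>?C \<union> X. ?q x \<in> A \<longleftrightarrow> x \<in> A)} = S k \<union> ?T" (is "?L = _")
  proof (intro equalityI subsetI)
    fix A assume "A \<in> ?L"
    then have A: "A \<subseteq> ?C \<union> X" "card A = k" "?C \<inter> A = {} \<or> ?C \<subseteq> A" "\<forall>x\<in>X. p x \<in> A \<longleftrightarrow> x \<in> A"
      unfolding inv by auto
    show "A \<in> S k \<union> ?T"
    proof (cases "?C \<subseteq> A")
      case True
      have fA: "finite A" using A(1) fX finite_subset by blast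
      have "card (A - ?C) = k - length cs" using True A(2) lc by (simp add: card_Diff_subset)
      moreover have "length cs \<le> k" using card_mono[OF fA True] A(2) lc by simp
      moreover have "A - ?C \<subseteq> X" using A(1) by blast
      moreover have "\<forall>x\<in>X. p x \<in> A - ?C \<longleftrightarrow> x \<in> A - ?C" using A(4) cycle(4) pX by blast
      ultimately have "A - ?C \<in> S (k - length cs)" and le: "length cs \<le> k" unfolding S_def by simp_all
      then have "?C \<union> (A - ?C) \<in> (\<lambda>A. ?C \<union> A) ` S (k - length cs)" by (intro imageI)
      then show ?thesis using le True by (simp add: Un_absorb1)
    next
      case False
      then have "A \<in> S k" using A unfolding S_def by blast
      then show ?thesis by blast
    qed
  next
    fix A assume "A \<in> S k \<union> ?T"
    then consider "A \<in> S k" | A' where "length cs \<le> k" "A' \<in> S (k - length cs)" "A = ?C \<union> A'"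
      by (cases "length cs \<le> k") auto
    then show "A \<in> ?L"
    proof cases
      case 1
      then have 1: "A \<subseteq> X" "card A = k" "\<forall>x\<in>X. p x \<in> A \<longleftrightarrow> x \<in> A" unfolding S_def by simp_all
      then have "?C \<inter> A = {}" using cycle(4) by blast
      then show ?thesis unfolding mem_Collect_eq inv using 1 by blast
    next
      case 2
      then have A': "A' \<subseteq> X" "card A' = k - length cs" "\<forall>x\<in>X. p x \<in> A' \<longleftrightarrow> x \<in> A'" unfolding S_def by simp_all
      then have "finite A'" using fX finite_subset by blast
      moreover have "?C \<inter> A' = {}" using A'(1) cycle(4) by blast
      ultimately have "card A = k" using 2(1,3) A'(2) lc by (simp add: card_Un_disjoint)
      moreover have "A \<subseteq> ?C \<union> X" "?C \<subseteq> A" using 2(3) A'(1) by blast+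
      moreover have "\<forall>x\<in>X. p x \<in> A \<longleftrightarrow> x \<in> A" using 2(3) A'(3) cycle(4) pX by blast
      ultimately show ?thesis unfolding mem_Collect_eq inv by blast
    qed
  qed
  obtain x where x: "x \<in> ?C" "x \<notin> X" using cycle(3) cycle(4) by (cases cs) auto
  have sub: "A \<subseteq> X" if "A \<in> S j" for A j using that unfolding S_def by simp
  have sup: "?C \<subseteq> A" if "A \<in> ?T" for A using that by (cases "length cs \<le> k") auto
  have disj: "S k \<inter> ?T = {}"
  proof (rule equals0I)
    fix A assume "A \<in> S k \<inter> ?T"
    then have "A \<subseteq> X" "?C \<subseteq> A" using sub sup by (blast, blast)
    then show False using x by (meson subsetD)
  qed
  have finT: "finite ?T" using finS by simp
  have U: "card (S k \<union> ?T) = card (S k) + card ?T" by (rule card_Un_disjoint[OF finS finT disj])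
  have T: "card ?T = (if length cs \<le> k then card (S (k - length cs)) else 0)"
  proof -
    have "inj_on (\<lambda>A. ?C \<union> A) (S (k - length cs))"
    proof (rule inj_onI)
      fix A B assume AB: "A \<in> S (k - length cs)" "B \<in> S (k - length cs)" "?C \<union> A = ?C \<union> B"
      then have "A \<subseteq> X" "B \<subseteq> X" unfolding S_def by simp_all
      then show "A = B" using AB(3) cycle(4) by blast
    qed
    then show ?thesis by (simp add: card_image)
  qed
  have IH: "card (S k') = subset_sums ls k'" for k' unfolding S_def by (rule cycle.IH)
  show ?case unfolding L U T IH subset_sums.simps ..
qed

lemma card_invariant_subsets:
  assumes "cycle_type X p ls"
  shows "card {A. A \<subseteq> X \<and> card A = k \<and> p -` A = A} = subset_sums ls k"
proof -
  note p = cycle_type_props(2)[OF assms]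
  have "p -` A = A \<longleftrightarrow> (\<forall>x\<in>X. p x \<in> A \<longleftrightarrow> x \<in> A)" if "A \<subseteq> X" for A
    using permutes_not_in[OF p] that by (auto simp: vimage_def)
  then have "{A. A \<subseteq> X \<and> card A = k \<and> p -` A = A} = {A. A \<subseteq> X \<and> card A = k \<and> (\<forall>x\<in>X. p x \<in> A \<longleftrightarrow> x \<in> A)}"
    by auto
  then show ?thesis using card_stable_subsets[OF assms] by simp
qed

lemma subset_sums_eq_0: "sum_list ls < k \<Longrightarrow> subset_sums ls k = 0"
  by (induction ls arbitrary: k) auto

text \<open>Cycles with more than \<open>K\<close> points cannot lie in a set of at most
  \<open>K\<close> points. This allows the long cycles of a type to stay symbolic when small cases
  are evaluated.\<close>

lemma subset_sums_filter:
  "k \<le> K \<Longrightarrow> subset_sums (filter (\<lambda>l. l \<le> K) ls) k = subset_sums ls k"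
  by (induction ls arbitrary: k) auto

text \<open>The complement of a union of cycles is again one.\<close>

lemma subset_sums_complement:
  "k \<le> sum_list ls \<Longrightarrow> subset_sums ls (sum_list ls - k) = subset_sums ls k"
proof (induction ls arbitrary: k)
  case (Cons l ls)
  let ?S = "sum_list ls"
  have 1: "(if l \<le> l + ?S - k then subset_sums ls (l + ?S - k - l) else 0) = subset_sums ls k"
  proof (cases "k \<le> ?S")
    case True
    then show ?thesis using Cons.IH[of k] by simp
  qed (use Cons.prems in \<open>simp add: subset_sums_eq_0\<close>)
  have 2: "subset_sums ls (l + ?S - k) = (if l \<le> k then subset_sums ls (k - l) else 0)"
  proof (cases "l \<le> k")
    case True
    then have "k - l \<le> ?S" "l + ?S - k = ?S - (k - l)" using Cons.prems by auto
    then show ?thesis using Cons.IH[of "k - l"] True by simp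
  qed (simp add: subset_sums_eq_0)
  show ?case using 1 2 by simp
qed simp

lemma subset_sums_odd:
  "(\<And>l. l \<in> set ls \<Longrightarrow> even l) \<Longrightarrow> odd k \<Longrightarrow> subset_sums ls k = 0"
  by (induction ls arbitrary: k) (auto simp: odd_pos)

lemma funpow_one [simp]: "f ^^ 1 = f" for f :: "'a \<Rightarrow> 'a"
  by (simp add: One_nat_def)

section \<open>Orders without prime factors above three\<close>

lemma ord_dvd_iff:
  assumes G: "sym_or_alt n G" and g: "g \<in> carrier G" "cycle_type {1..n} g ls"
  shows "group.ord G g dvd k \<longleftrightarrow> (\<forall>l\<in>set ls. l dvd k)"
proof -
  interpret group G by (rule sym_or_alt_group[OF G])
  have G': "mult G = (\<circ>)" "one G = id"
    using G unfolding sym_or_alt_def by (auto simp: sym_group_mult alt_group_mult sym_group_one alt_group_one)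
  have "g [^]\<^bsub>G\<^esub> k = g ^^ k" for k :: nat
    by (induction k) (simp_all add: G' funpow_Suc_right del: funpow.simps(2))
  then show ?thesis using pow_eq_id[OF g(1), of k] funpow_eq_id_iff[OF g(2), of k] by (simp add: G')
qed

lemma sym_or_alt_of_cycle_type:
  assumes G: "sym_or_alt n G" and ls: "\<And>l. l \<in> set ls \<Longrightarrow> 0 < l" "sum_list ls = n"
    and ev: "G = alt_group n \<Longrightarrow> even (length (filter even ls))"
    and m: "\<And>k. (\<forall>l\<in>set ls. l dvd k) \<longleftrightarrow> m dvd k"
  obtains g where "g \<in> carrier G" "cycle_type {1..n} g ls" "group.ord G g = m"
proof -
  obtain g where g: "cycle_type {1..n} g ls" using ex_perm_of_cycle_type[where X = "{1..n}", OF ls(1)] ls(2) by auto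
  then have gG: "g \<in> carrier G"
    using G ev cycle_type_props(2)[OF g] evenperm_cycle_type[OF g]
    unfolding sym_or_alt_def by (auto simp: sym_group_carrier alt_group_carrier)
  have "group.ord G g dvd k \<longleftrightarrow> m dvd k" for k unfolding ord_dvd_iff[OF G gG g] m ..
  then have "group.ord G g = m" by (meson dvd_antisym dvd_refl)
  then show ?thesis using that gG g by blast
qed

text \<open>The last two conditions make \<open>m\<close> the least common multiple of the entries,
  hence the order of the element; the condition on even entries is the parity of the
  permutation.\<close>

definition realizes :: "(nat \<Rightarrow> nat) monoid \<Rightarrow> nat \<Rightarrow> nat \<Rightarrow> nat list \<Rightarrow> bool" where
  "realizes G n m ls \<longleftrightarrow> sym_or_alt n G \<and> (\<forall>l\<in>set ls. 0 < l) \<and> sum_list ls = n \<and>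
     (G = alt_group n \<longrightarrow> even (length (filter even ls))) \<and>
     (\<forall>l\<in>set ls. l dvd m) \<and> (m \<in> set ls \<or> (\<exists>x\<in>set ls. \<exists>y\<in>set ls. coprime x y \<and> m = x * y))"

lemma realizesE:
  assumes "realizes G n m ls"
  obtains g where "sym_or_alt n G" "g \<in> carrier G" "cycle_type {1..n} g ls" "group.ord G g = m"
proof -
  have r: "sym_or_alt n G" "\<And>l. l \<in> set ls \<Longrightarrow> 0 < l" "sum_list ls = n"
    "G = alt_group n \<Longrightarrow> even (length (filter even ls))" "\<And>l. l \<in> set ls \<Longrightarrow> l dvd m"
    "m \<in> set ls \<or> (\<exists>x\<in>set ls. \<exists>y\<in>set ls. coprime x y \<and> m = x * y)"
    using assms unfolding realizes_def by simp_all
  have m: "(\<forall>l\<in>set ls. l dvd k) \<longleftrightarrow> m dvd k" for k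
  proof
    assume k: "\<forall>l\<in>set ls. l dvd k"
    show "m dvd k"
      using r(6)
    proof
      assume "\<exists>x\<in>set ls. \<exists>y\<in>set ls. coprime x y \<and> m = x * y"
      then obtain x y where "x \<in> set ls" "y \<in> set ls" "coprime x y" "m = x * y" by blast
      then show ?thesis using k divides_mult[of x k y] by simp
    qed (use k in blast)
  next
    assume "m dvd k"
    then show "\<forall>l\<in>set ls. l dvd k" using r(5) dvd_trans by blast
  qed
  show ?thesis
    using sym_or_alt_of_cycle_type[OF r(1,2,3,4) m] that[OF r(1)] by blast
qed

text \<open>For \<open>k = 1\<close> the equation says that there is exactly one fixed point. Only
  cycles of length at most \<open>k\<close> enter, so it can be checked with the others
  unspecified.\<close>

lemma two_row_realization:
  assumes r: "realizes G n m ls" and n: "5 \<le> n" "1 \<le> k" "2 * k \<le> n"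
    and eq: "subset_sums (filter (\<lambda>l. l \<le> k) ls) k = subset_sums (filter (\<lambda>l. l \<le> k) ls) (k - 1)"
  shows "\<exists>g. vanishing G g \<and> group.ord G g = m"
proof -
  obtain g where g: "sym_or_alt n G" "g \<in> carrier G" "cycle_type {1..n} g ls" "group.ord G g = m"
    using r by (rule realizesE)
  obtain j where j: "k = Suc j" using n(2) by (cases k) auto
  have c: "card {A \<in> ksubsets n i. g -` A = A} = subset_sums ls i" for i
    using card_invariant_subsets[OF g(3), of i] unfolding ksubsets_def by (simp add: conj_assoc)
  have "vanishing G g"
    by (rule two_row_vanishing[OF g(1,2) n(1), of j])
      (use n(3) eq subset_sums_filter[of k k ls] subset_sums_filter[of j k ls] in \<open>simp_all add: c j\<close>)
  then show ?thesis using g(4) by blast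
qed

text \<open>Without a two-cycle, \<open>g\<close> and its square would have the same fixed points,
  but the entry 2 makes the second count larger.\<close>

lemma odd_centralizer_of_two_cycle:
  assumes g: "cycle_type X g ls" and "2 \<in> set ls"
  shows "\<exists>t. t permutes X \<and> \<not> evenperm t \<and> t \<circ> g = g \<circ> t"
proof (rule ccontr)
  assume no: "\<not> ?thesis"
  have "{x \<in> X. (g ^^ 1) x = x} = {x \<in> X. (g ^^ 2) x = x}"
  proof -
    have "g (g x) = x \<longleftrightarrow> g x = x" if "x \<in> X" for x
      using no commute_two_cycle[OF cycle_type_props(2)[OF g] that] by auto
    then show ?thesis by (auto simp: numeral_2_eq_2 simp del: funpow.simps(1))
  qed
  then have "sum_list (filter (\<lambda>l. l dvd 1) ls) = sum_list (filter (\<lambda>l. l dvd 2) ls)"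
    using card_fixed_funpow[OF g, of 1] card_fixed_funpow[OF g, of 2] by simp
  moreover have le: "sum_list (filter (\<lambda>l. l dvd 1) xs) \<le> sum_list (filter (\<lambda>l. l dvd 2) xs)" for xs :: "nat list"
    by (induction xs) auto
  have "sum_list (filter (\<lambda>l. l dvd 1) ls) < sum_list (filter (\<lambda>l. l dvd 2) ls)"
    using assms(2)
  proof (induction ls)
    case (Cons l ls)
    then show ?case using le[of ls] by (cases "l = 2") auto
  qed simp
  ultimately show False by simp
qed

lemma card_two_cycle_points:
  assumes g: "cycle_type X g ls"
  shows "card {x \<in> X. g x = x} = sum_list (filter (\<lambda>l. l = 1) ls)"
    "card {x \<in> X. g x \<noteq> x \<and> g (g x) = x} = sum_list (filter (\<lambda>l. l dvd 2) ls) - sum_list (filter (\<lambda>l. l = 1) ls)"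
proof -
  show 1: "card {x \<in> X. g x = x} = sum_list (filter (\<lambda>l. l = 1) ls)"
    using card_fixed_funpow[OF g, of 1] by simp
  have "{x \<in> X. g x \<noteq> x \<and> g (g x) = x} = {x \<in> X. (g ^^ 2) x = x} - {x \<in> X. g x = x}" by (auto simp: numeral_2_eq_2)
  also have "card \<dots> = card {x \<in> X. (g ^^ 2) x = x} - card {x \<in> X. g x = x}"
    by (rule card_Diff_subset) (use cycle_type_props(1)[OF g] in \<open>auto simp: numeral_2_eq_2\<close>)
  finally show "card {x \<in> X. g x \<noteq> x \<and> g (g x) = x} = sum_list (filter (\<lambda>l. l dvd 2) ls) - sum_list (filter (\<lambda>l. l = 1) ls)"
    using card_fixed_funpow[OF g, of 2] 1 by simp
qed

lemma odd_centralizer_of_two_fixed: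
  assumes g: "g permutes X" and "2 \<le> card {x \<in> X. g x = x}"
  shows "\<exists>t. t permutes X \<and> \<not> evenperm t \<and> t \<circ> g = g \<circ> t"
proof -
  obtain S where "S \<subseteq> {x \<in> X. g x = x}" "card S = 2" using obtain_subset_with_card_n[OF assms(2)] by blast
  then obtain a b where "a \<noteq> b" "{a, b} \<subseteq> {x \<in> X. g x = x}" by (metis card_2_iff)
  then show ?thesis using commute_fixed_transpose[OF g, of a b] by auto
qed

text \<open>The entries dividing 2 describe all fixed points and two-cycles. Either kind of list
  also provides a transposition that commutes with the element.\<close>

lemma two_hook_realization:
  assumes r: "realizes G n m ls" and n: "3 \<le> n"
    and ls: "filter (\<lambda>l. l dvd 2) ls = [1, 1] \<or> filter (\<lambda>l. l dvd 2) ls = [2]"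
  shows "\<exists>g. vanishing G g \<and> group.ord G g = m"
proof -
  obtain g where g: "sym_or_alt n G" "g \<in> carrier G" "cycle_type {1..n} g ls" "group.ord G g = m"
    using r by (rule realizesE)
  define F where "F = filter (\<lambda>l. l dvd 2) ls"
  have "filter (\<lambda>l. l = 1) ls = filter (\<lambda>l. l = 1) F"
    unfolding F_def filter_filter by (rule filter_cong) auto
  moreover have F: "F = [1, 1] \<or> F = [2]" using ls unfolding F_def .
  ultimately have f: "sum_list (filter (\<lambda>l. l = 1) ls) = (if F = [1, 1] then 2 else 0)" by (elim disjE) simp_all
  have s: "sum_list F = 2" using F by (elim disjE) simp_all
  note c = card_two_cycle_points[OF g(3), folded F_def, unfolded s f]
  have "vanishing G g"
  proof (rule two_hook_vanishing[OF g(1,2) n])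
    show "card {x \<in> {1..n}. g x = x} = 2 \<and> card {x \<in> {1..n}. g x \<noteq> x \<and> g (g x) = x} = 0 \<or>
      card {x \<in> {1..n}. g x = x} = 0 \<and> card {x \<in> {1..n}. g x \<noteq> x \<and> g (g x) = x} = 2"
      unfolding c by simp
    show "\<exists>t. t permutes {1..n} \<and> \<not> evenperm t \<and> t \<circ> g = g \<circ> t"
    proof (cases "F = [2]")
      case True
      then have "2 \<in> set F" by simp
      then show ?thesis using odd_centralizer_of_two_cycle[OF g(3)] unfolding F_def by simp
    next
      case False
      then have "F = [1, 1]" using F by simp
      then have "card {x \<in> {1..n}. g x = x} = 2" unfolding c(1) by simp
      then show ?thesis
        by (intro odd_centralizer_of_two_fixed[OF cycle_type_props(2)[OF g(3)]]) simp
    qed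
  qed
  then show ?thesis using g(4) by blast
qed

lemma involution_realization:
  assumes r: "realizes G n m ls" and n: "5 \<le> n" and ls: "set ls \<subseteq> {1, 2}" "2 \<in> set ls"
    and f: "sum_list (filter (\<lambda>l. l = 1) ls) \<in> {0, 2} \<or> sum_list (filter (\<lambda>l. l = 1) ls) = 3 \<and> 14 \<le> n"
  shows "\<exists>g. vanishing G g \<and> group.ord G g = m"
proof -
  obtain g where g: "sym_or_alt n G" "g \<in> carrier G" "cycle_type {1..n} g ls" "group.ord G g = m"
    using r by (rule realizesE)
  have "g ^^ 2 = id" using funpow_eq_id_iff[OF g(3), of 2] ls by auto
  then have gg: "g (g x) = x" for x by (simp add: numeral_2_eq_2 fun_eq_iff)
  have "g ^^ 1 \<noteq> id" using funpow_eq_id_iff[OF g(3), of 1] ls(2) by auto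
  then have moved: "\<exists>a. g a \<noteq> a" by (auto simp: fun_eq_iff)
  have "vanishing G g"
  proof (cases "card {x \<in> {1..n}. g x = x} \<in> {0, 2}")
    case True
    then show ?thesis by (rule involution_few_fixed_vanishing[OF g(1,2) gg n moved])
  next
    case False
    then have "card {x \<in> {1..n}. g x = x} = 3" "14 \<le> n" using f unfolding card_two_cycle_points(1)[OF g(3)] by blast+
    then show ?thesis using involution_three_fixed_vanishing[OF g(1,2) gg _ moved] by blast
  qed
  then show ?thesis using g(4) by blast
qed

text \<open>The entry 1 provides the fixed point of the hook argument, and the entry 2 an odd
  permutation commuting with the element.\<close>

lemma hook_realization:
  assumes r: "realizes G n m ls" and k: "Suc k \<le> n" and ls: "1 \<in> set ls" "2 \<in> set ls"
    and z: "subset_sums (filter (\<lambda>l. l \<le> Suc k) ls) (Suc k) = 0"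
  shows "\<exists>g. vanishing G g \<and> group.ord G g = m"
proof -
  obtain g where g: "sym_or_alt n G" "g \<in> carrier G" "cycle_type {1..n} g ls" "group.ord G g = m"
    using r by (rule realizesE)
  note gp = cycle_type_props(2)[OF g(3)]
  have "1 \<in> set (filter (\<lambda>l. l = 1) ls)" using ls(1) by simp
  then have "1 \<le> sum_list (filter (\<lambda>l. l = 1) ls)" by (rule member_le_sum_list) simp
  then have "card {x \<in> {1..n}. g x = x} \<noteq> 0" unfolding card_two_cycle_points(1)[OF g(3)] by linarith
  then have "{x \<in> {1..n}. g x = x} \<noteq> {}" by (metis card.empty)
  then obtain c where c: "c \<in> {1..n}" "g c = c" by blast
  have "card {A. A \<subseteq> {1..n} \<and> card A = Suc k \<and> g -` A = A} = 0"
    using card_invariant_subsets[OF g(3), of "Suc k"] z subset_sums_filter[of "Suc k" "Suc k" ls] by simp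
  then have none: "{A. A \<subseteq> {1..n} \<and> card A = Suc k \<and> g -` A = A} = {}"
    by (subst (asm) card_eq_0_iff) (auto intro: finite_subset[of _ "Pow {1..n}"])
  have "vanishing G g"
  proof (rule hook_vanishing[OF g(1,2) k c])
    fix A assume A: "A \<subseteq> {1..n}" "g ` A = A"
    then have "g -` A = A" using inj_vimage_image_eq[OF permutes_inj[OF gp], of A] by simp
    then show "card A \<noteq> Suc k" using none A by blast
  qed (use odd_centralizer_of_two_cycle[OF g(3) ls(2)] in blast)
  then show ?thesis using g(4) by blast
qed

section \<open>The degree forced by an element of order 2^a 3^b\<close>

lemma dvd_prime_power_step:
  fixes p :: nat
  assumes p: "Factorial_Ring.prime p" and l: "l dvd p ^ Suc a * q" "\<not> p ^ Suc a dvd l"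
  shows "l dvd p ^ a * q"
proof -
  obtain b c where bc: "l = b * c" "b dvd p ^ Suc a" "c dvd q" using division_decomp[OF l(1)] by blast
  obtain i where i: "i \<le> Suc a" "b = p ^ i" using bc(2) divides_primepow_nat[OF p] by blast
  then have "i \<noteq> Suc a" using l(2) bc(1) by auto
  then have "b dvd p ^ a" using i by (auto intro: le_imp_power_dvd)
  then show ?thesis using bc by (simp add: mult_dvd_mono)
qed

text \<open>Otherwise all entries would divide \<open>p ^ a * q\<close>, which is smaller than their
  least common multiple.\<close>

lemma prime_power_dvd_entry:
  fixes p :: nat
  assumes p: "Factorial_Ring.prime p" and q: "0 < q"
    and m: "\<And>k. (\<forall>l\<in>set ls. l dvd k) \<longleftrightarrow> p ^ Suc a * q dvd k"
  shows "\<exists>l\<in>set ls. p ^ Suc a dvd l"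
proof (rule ccontr)
  assume "\<not> ?thesis"
  moreover have "l dvd p ^ Suc a * q" if "l \<in> set ls" for l using m[of "p ^ Suc a * q"] that by simp
  ultimately have "\<forall>l\<in>set ls. l dvd p ^ a * q" using dvd_prime_power_step[OF p] by metis
  then have "p ^ Suc a * q dvd p ^ a * q" using m by blast
  moreover have pos: "0 < p ^ a * q" using q prime_gt_0_nat[OF p] by simp
  ultimately have "p * (p ^ a * q) \<le> p ^ a * q" using dvd_imp_le by (simp only: power_Suc mult.assoc)
  moreover have "2 * (p ^ a * q) \<le> p * (p ^ a * q)" using prime_ge_2_nat[OF p] by (rule mult_le_mono1)
  ultimately show False using pos by linarith
qed

lemma two_three_smooth:
  assumes "0 < m" "\<And>p::nat. Factorial_Ring.prime p \<Longrightarrow> p > 3 \<Longrightarrow> \<not> p dvd m"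
  shows "\<exists>a b. m = 2 ^ a * (3::nat) ^ b"
  using assms
proof (induction m rule: less_induct)
  case (less m)
  show ?case
  proof (cases "m = 1")
    case True
    then have "m = 2 ^ 0 * 3 ^ 0" by simp
    then show ?thesis by blast
  next
    case False
    then obtain p where p: "Factorial_Ring.prime p" "p dvd m" using prime_factor_nat by blast
    then have "p \<le> 3" using less.prems(2) by (meson not_le)
    then have p23: "p = 2 \<or> p = 3" using prime_ge_2_nat[OF p(1)] by auto
    obtain k where k: "m = p * k" using p(2) by (rule dvdE)
    then have "0 < k" "k < m" using less.prems(1) p23 by auto
    moreover have "\<not> q dvd k" if "Factorial_Ring.prime q" "q > 3" for q
      using less.prems(2)[OF that] k by auto
    ultimately obtain a b where "k = 2 ^ a * 3 ^ b" using less.IH by blast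
    then have "m = 2 ^ Suc a * 3 ^ b \<or> m = 2 ^ a * 3 ^ Suc b" using k p23 by auto
    then show ?thesis by blast
  qed
qed

lemma sum_list_ge_remove1:
  fixes ls :: "nat list"
  assumes "x \<in> set ls"
  shows "sum_list ls = x + sum_list (remove1 x ls)"
  using assms by (induction ls) auto

lemma sum_list_ge_two:
  fixes ls :: "nat list"
  assumes "x \<in> set ls" "y \<in> set ls" "x \<noteq> y"
  shows "x + y \<le> sum_list ls"
  using sum_list_ge_remove1[OF assms(1)] member_le_sum_list[of y "remove1 x ls"] assms by simp

lemma another_even_entry:
  assumes "even (length (filter even ls))" "x \<in> set ls" "even (x::nat)"
  shows "\<exists>e\<in>set (remove1 x ls). even e"
proof (rule ccontr)
  assume "\<not> ?thesis"
  then have "filter even (remove1 x ls) = []" by (simp add: filter_empty_conv)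
  moreover have "length (filter even ls) = Suc (length (filter even (remove1 x ls)))"
    using assms(2,3) by (induction ls) auto
  ultimately show False using assms(1) by simp
qed

text \<open>Each prime power divides some cycle length, and in the alternating group a cycle of even
  length is accompanied by another. If one cycle serves both primes, its length is at least the
  product of the prime powers, which is at least their sum.\<close>

lemma degree_bounds:
  assumes G: "sym_or_alt n G" and mG: "2 ^ a * 3 ^ b \<in> element_orders G"
  shows "1 \<le> a \<Longrightarrow> b = 0 \<Longrightarrow> 2 ^ a \<le> n \<and> (G = alt_group n \<longrightarrow> 2 ^ a + 2 \<le> n)"
    "a = 0 \<Longrightarrow> 1 \<le> b \<Longrightarrow> 3 ^ b \<le> n"
    "1 \<le> a \<Longrightarrow> 1 \<le> b \<Longrightarrow> 2 ^ a + 3 ^ b \<le> n \<and> (G = alt_group n \<longrightarrow> 2 ^ a + 3 ^ b + 2 \<le> n)"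
proof -
  obtain p where p: "p \<in> carrier G" "group.ord G p = 2 ^ a * 3 ^ b"
    using mG unfolding element_orders_def by auto
  obtain ls where ls: "cycle_type {1..n} p ls"
    using ex_cycle_type_of_perm[OF sym_or_alt_carrier[OF G p(1)]] by auto
  have m: "(\<forall>l\<in>set ls. l dvd k) \<longleftrightarrow> 2 ^ a * 3 ^ b dvd k" for k
    using ord_dvd_iff[OF G p(1) ls, of k] p(2) by simp
  have n: "sum_list ls = n" using cycle_type_props(3)[OF ls] by simp
  note pos = cycle_type_props(4)[OF ls]
  have even_ls: "even (length (filter even ls))" if "G = alt_group n"
    using evenperm_cycle_type[OF ls] p(1) that by (simp add: alt_group_carrier)
  have two: "\<exists>l\<in>set ls. 2 ^ a dvd l" if "1 \<le> a"
    using that prime_power_dvd_entry[of 2 "3 ^ b" ls "a - 1"] m by (cases a) auto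
  have three: "\<exists>l\<in>set ls. 3 ^ b dvd l" if "1 \<le> b"
    using that prime_power_dvd_entry[of 3 "2 ^ a" ls "b - 1"] m by (cases b) (auto simp: mult.commute)
  show "2 ^ a \<le> n \<and> (G = alt_group n \<longrightarrow> 2 ^ a + 2 \<le> n)" if ab: "1 \<le> a" "b = 0"
  proof -
    obtain l where l: "l \<in> set ls" "2 ^ a dvd l" using two[OF ab(1)] by blast
    then have le: "2 ^ a \<le> l" using pos by (simp add: dvd_imp_le)
    have el: "even l" using l(2) ab(1) dvd_trans[of 2 "2 ^ a" l] by simp
    have "2 ^ a + 2 \<le> n" if alt: "G = alt_group n"
    proof -
      obtain e where e: "e \<in> set (remove1 l ls)" "even e" using another_even_entry[OF even_ls[OF alt] l(1) el] by blast
      then have "2 \<le> e" using pos[of e] by (metis dvd_imp_le notin_set_remove1)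
      then show ?thesis using sum_list_ge_remove1[OF l(1)] member_le_sum_list[OF e(1)] le n by simp
    qed
    moreover have "l \<le> n" using member_le_sum_list[OF l(1)] n by simp
    ultimately show ?thesis using le by simp
  qed
  show "3 ^ b \<le> n" if ab: "a = 0" "1 \<le> b"
  proof -
    obtain l where l: "l \<in> set ls" "3 ^ b dvd l" using three[OF ab(2)] by blast
    then show ?thesis using dvd_imp_le[OF l(2) pos[OF l(1)]] member_le_sum_list[OF l(1)] n by simp
  qed
  show "2 ^ a + 3 ^ b \<le> n \<and> (G = alt_group n \<longrightarrow> 2 ^ a + 3 ^ b + 2 \<le> n)" if ab: "1 \<le> a" "1 \<le> b"
  proof -
    obtain l where l: "l \<in> set ls" "2 ^ a dvd l" using two[OF ab(1)] by blast
    obtain t where t: "t \<in> set ls" "3 ^ b dvd t" using three[OF ab(2)] by blast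
    have le: "2 ^ a \<le> l" "3 ^ b \<le> t" using pos l t by (simp_all add: dvd_imp_le)
    have el: "even l" using l(2) ab(1) dvd_trans[of 2 "2 ^ a" l] by simp
    have both: "2 ^ a + 3 ^ b \<le> l" if "l = t"
    proof -
      have "2 ^ a * 3 ^ b dvd l" using l(2) t(2) that by (intro divides_mult) (auto simp: coprime_left_2_iff_odd)
      then have le': "2 ^ a * 3 ^ b \<le> l" using pos[OF l(1)] by (simp add: dvd_imp_le)
      have "(2::nat) ^ 1 \<le> 2 ^ a" "(3::nat) ^ 1 \<le> 3 ^ b" using ab by (intro power_increasing; simp)+
      \<comment> \<open>The product of \<open>2 + x\<close> and \<open>3 + y\<close>, expanded, is
        visibly at least their sum.\<close>
      then obtain x y where "(2::nat) ^ a = 2 + x" "(3::nat) ^ b = 3 + y" by (metis le_Suc_ex power_one_right)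
      then show ?thesis using le' by (simp add: algebra_simps)
    qed
    have 1: "2 ^ a + 3 ^ b \<le> n"
    proof (cases "l = t")
      case True
      then show ?thesis using both member_le_sum_list[OF l(1)] n by simp
    next
      case False
      then show ?thesis using sum_list_ge_two[OF l(1) t(1)] le n by simp
    qed
    moreover have "2 ^ a + 3 ^ b + 2 \<le> n" if alt: "G = alt_group n"
    proof -
      obtain e where e: "e \<in> set (remove1 l ls)" "even e" using another_even_entry[OF even_ls[OF alt] l(1) el] by blast
      then have e2: "2 \<le> e" using pos[of e] by (metis dvd_imp_le notin_set_remove1)
      note s = sum_list_ge_remove1[OF l(1)]
      show ?thesis
      proof (cases "l = t")
        case True
        then show ?thesis using both member_le_sum_list[OF e(1)] e2 s n by simp
      next
        case False
        then have tr: "t \<in> set (remove1 l ls)" using t(1) by simp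
        show ?thesis
        \<comment> \<open>An even \<open>t\<close> may itself be the second even cycle; then
          \<open>2 * 3 ^ b\<close> divides it, which leaves room for two more points.\<close>
        proof (cases "even t")
          case True
          then have "2 * 3 ^ b dvd t" using t(2) by (intro divides_mult) auto
          then have "2 * 3 ^ b \<le> t" using pos[OF t(1)] by (simp add: dvd_imp_le)
          moreover have "(3::nat) ^ 1 \<le> 3 ^ b" using ab by (intro power_increasing; simp)
          ultimately show ?thesis using member_le_sum_list[OF tr] le s n by simp
        next
          case False
          then show ?thesis using sum_list_ge_two[OF e(1) tr] e(2) e2 le s n by fastforce
        qed
      qed
    qed
    ultimately show ?thesis by simp
  qed
qed

section \<open>The choice of cycle types for each order\<close>

lemma realizes_selfI:
  assumes "sym_or_alt n G" "\<And>l. l \<in> set ls \<Longrightarrow> 0 < l" "sum_list ls = n"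
    "G = alt_group n \<Longrightarrow> even (length (filter even ls))" "m \<in> set ls" "\<And>l. l \<in> set ls \<Longrightarrow> l dvd m"
  shows "realizes G n m ls"
  using assms unfolding realizes_def by blast

lemma realizes_coprimeI:
  assumes "sym_or_alt n G" "\<And>l. l \<in> set ls \<Longrightarrow> 0 < l" "sum_list ls = n"
    "G = alt_group n \<Longrightarrow> even (length (filter even ls))" "coprime x y" "x \<in> set ls" "y \<in> set ls"
    "\<And>l. l \<in> set ls \<Longrightarrow> l dvd x * y"
  shows "realizes G n (x * y) ls"
  using assms unfolding realizes_def by blast

lemmas entry_simps = sum_list_replicate filter_replicate

text \<open>An even number \<open>2 * z\<close> of two-cycles suits both groups; what is left is 0,
  1, 2 or 3 fixed points.\<close>

lemma vanishing_order_two: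
  assumes G: "sym_or_alt n G" and n: "5 \<le> n" "n \<noteq> 7" "n \<noteq> 11"
  shows "\<exists>g. vanishing G g \<and> group.ord G g = 2"
proof -
  have "(\<exists>z. n = 4 * z) \<or> (\<exists>z. n = 1 + 4 * z) \<or> (\<exists>z. n = 2 + 4 * z) \<or> (\<exists>z. n = 3 + 4 * z)" by presburger
  then consider z where "n = 4 * z" | z where "n = 1 + 4 * z" | z where "n = 2 + 4 * z" | z where "n = 3 + 4 * z" by blast
  then show ?thesis
  proof cases
    case (1 z)
    have "realizes G n 2 (replicate (2 * z) 2)"
      by (rule realizes_selfI) (use G n 1 in \<open>auto simp: entry_simps\<close>)
    then show ?thesis by (rule involution_realization) (use n 1 in \<open>auto simp: entry_simps\<close>)
  next
    case (2 z)
    have "realizes G n 2 (1 # replicate (2 * z) 2)"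
      by (rule realizes_selfI) (use G n 2 in \<open>auto simp: entry_simps\<close>)
    then show ?thesis by (rule two_row_realization[where k = 1]) (use n in \<open>auto simp: entry_simps\<close>)
  next
    case (3 z)
    have "realizes G n 2 (1 # 1 # replicate (2 * z) 2)"
      by (rule realizes_selfI) (use G n 3 in \<open>auto simp: entry_simps\<close>)
    then show ?thesis by (rule involution_realization) (use n 3 in \<open>auto simp: entry_simps\<close>)
  next
    \<comment> \<open>The shape with columns 5, 4, 3, 2 needs at least 14 points, which is where \<open>n = 7\<close> and \<open>n = 11\<close> drop out.\<close>
    case (4 z)
    have "realizes G n 2 (1 # 1 # 1 # replicate (2 * z) 2)"
      by (rule realizes_selfI) (use G n 4 in \<open>auto simp: entry_simps\<close>)
    moreover have "3 \<le> z" using n 4 by presburger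
    ultimately show ?thesis by (intro involution_realization) (use 4 in \<open>auto simp: entry_simps\<close>)
  qed
qed

text \<open>For \<open>r\<close> at least 2 each list has an even number of even entries; the cases
  0 and 1 belong to the symmetric group. For odd \<open>r\<close> a single fixed point is used with
  the shape (n - 1, 1). For \<open>r = 2\<close> modulo 4 the fillers 4 leave a single 2 or two
  entries 1 for the hook.\<close>

lemma vanishing_order_power_of_two:
  assumes G: "sym_or_alt n G" and n: "5 \<le> n" "n = A + r" and A: "4 \<le> A" "4 dvd A" and r: "G = alt_group n \<Longrightarrow> 2 \<le> r"
  shows "\<exists>g. vanishing G g \<and> group.ord G g = A"
proof -
  have A': "even A" "\<not> A dvd 2" "4 dvd A" using A by (auto dest: dvd_imp_le)
  have "r = 0 \<or> r = 1 \<or> (\<exists>z. r = 3 + 4 * z) \<or> (\<exists>z. r = 5 + 4 * z) \<or> (\<exists>z. r = 4 + 4 * z) \<or> (\<exists>z. r = 2 + 8 * z) \<or> (\<exists>z. r = 6 + 8 * z)"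
    by presburger
  then consider "r = 0" | "r = 1" | z where "r = 3 + 4 * z" | z where "r = 5 + 4 * z" | z where "r = 4 + 4 * z"
    | z where "r = 2 + 8 * z" | z where "r = 6 + 8 * z" by blast
  then show ?thesis
  proof cases
    case 1
    \<comment> \<open>There are no invariant sets of one or two points.\<close>
    have "realizes G n A [A]"
      by (rule realizes_selfI) (use G n r 1 A in auto)
    then show ?thesis by (rule two_row_realization[where k = 2]) (use n A in auto)
  next
    case 2
    have "realizes G n A [A, 1]"
      by (rule realizes_selfI) (use G n r 2 A in auto)
    then show ?thesis by (rule two_row_realization[where k = 1]) (use n A in auto)
  next
    case (3 z)
    have "realizes G n A (A # 1 # replicate (1 + 2 * z) 2)"
      by (rule realizes_selfI) (use G n 3 A A' in \<open>auto simp: entry_simps\<close>)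
    then show ?thesis by (rule two_row_realization[where k = 1]) (use n A in \<open>auto simp: entry_simps\<close>)
  next
    case (4 z)
    have "realizes G n A (A # 1 # 4 # replicate (2 * z) 2)"
      by (rule realizes_selfI) (use G n 4 A A' in \<open>auto simp: entry_simps\<close>)
    then show ?thesis by (rule two_row_realization[where k = 1]) (use n A in \<open>auto simp: entry_simps\<close>)
  next
    case (5 z)
    \<comment> \<open>The counts are compared at half of the degree. Apart from two fixed points all
      cycles are even, so only even sums from \<open>E\<close> survive: with
      \<open>n = 4 * c\<close>, sizes \<open>2 * c\<close> and \<open>2 * c - 1\<close> give E(2c) +
      E(2c - 2) and 2 E(2c - 2). These agree because the total of \<open>E\<close> is
      \<open>4 * c - 2\<close>.\<close>
    define E where "E = A # replicate (1 + 2 * z) 2"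
    have R: "realizes G n A (1 # 1 # E)"
      by (rule realizes_selfI) (use G n 5 A A' in \<open>auto simp: E_def entry_simps\<close>)
    have "4 dvd n" using n(2) A(2) 5 by presburger
    then obtain c where c: "n = 4 * c" by (rule dvdE)
    then have c2: "2 \<le> c" using n(1) by linarith
    have sE: "sum_list E = 4 * c - 2" using c n(2) 5 by (simp add: E_def entry_simps)
    have odd: "subset_sums E k = 0" if "odd k" for k
      by (rule subset_sums_odd[OF _ that]) (use A'(1) in \<open>auto simp: E_def\<close>)
    have "subset_sums E (sum_list E - 2 * c) = subset_sums E (2 * c)"
      by (rule subset_sums_complement) (use sE c2 in simp)
    moreover have "4 * c - 2 - 2 * c = 2 * c - 2" by simp
    ultimately have sym: "subset_sums E (2 * c - 2) = subset_sums E (2 * c)" unfolding sE by simp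
    have e: "subset_sums (1 # 1 # E) k = subset_sums E k + 2 * subset_sums E (k - 1) + subset_sums E (k - 2)" if "2 \<le> k" for k
    proof -
      have "k - 1 - 1 = k - 2" "1 \<le> k" "1 \<le> k - 1" using that by linarith+
      then show ?thesis by simp
    qed
    have k: "2 * c - 1 - 1 = 2 * c - 2" "2 * c - 1 - 2 = 2 * c - 3" "odd (2 * c - 1)" "odd (2 * c - 3)"
      "2 \<le> 2 * c" "2 \<le> 2 * c - 1" using c2 by auto
    have eq: "subset_sums (1 # 1 # E) (2 * c) = subset_sums (1 # 1 # E) (2 * c - 1)"
      unfolding e[OF k(5)] e[OF k(6)] k(1,2) odd[OF k(3)] odd[OF k(4)] sym by simp
    show ?thesis
    proof (rule two_row_realization[OF R n(1), where k = "2 * c"])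
      show "subset_sums (filter (\<lambda>l. l \<le> 2 * c) (1 # 1 # E)) (2 * c) = subset_sums (filter (\<lambda>l. l \<le> 2 * c) (1 # 1 # E)) (2 * c - 1)"
        using eq by (simp only: subset_sums_filter[OF order_refl] subset_sums_filter[OF diff_le_self])
    qed (use c c2 in auto)
  next
    case (6 z)
    have "realizes G n A (A # 2 # replicate (2 * z) 4)"
      by (rule realizes_selfI) (use G n 6 A A' in \<open>auto simp: entry_simps\<close>)
    then show ?thesis by (rule two_hook_realization) (use n A A' in \<open>auto simp: entry_simps\<close>)
  next
    case (7 z)
    have "realizes G n A (A # 1 # 1 # replicate (1 + 2 * z) 4)"
      by (rule realizes_selfI) (use G n 7 A A' in \<open>auto simp: entry_simps\<close>)
    then show ?thesis by (rule two_hook_realization) (use n A A' in \<open>auto simp: entry_simps\<close>)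
  qed
qed

text \<open>All cycles are odd, so the element is even; the number of fixed points is the remainder
  of \<open>r\<close> modulo 3.\<close>

lemma vanishing_order_power_of_three:
  assumes G: "sym_or_alt n G" and n: "5 \<le> n" "n = B + r" and B: "3 \<le> B" "3 dvd B" "odd B"
  shows "\<exists>g. vanishing G g \<and> group.ord G g = B"
proof -
  have B': "\<not> B dvd 2" using B by (auto dest: dvd_imp_le)
  have "(\<exists>z. r = 3 * z) \<or> (\<exists>z. r = 1 + 3 * z) \<or> (\<exists>z. r = 2 + 3 * z)" by presburger
  then consider z where "r = 3 * z" | z where "r = 1 + 3 * z" | z where "r = 2 + 3 * z" by blast
  then show ?thesis
  proof cases
    case (1 z)
    have "realizes G n B (B # replicate z 3)"
      by (rule realizes_selfI) (use G n 1 B in \<open>auto simp: entry_simps\<close>)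
    then show ?thesis by (rule two_row_realization[where k = 2]) (use n B in \<open>auto simp: entry_simps\<close>)
  next
    case (2 z)
    have "realizes G n B (B # 1 # replicate z 3)"
      by (rule realizes_selfI) (use G n 2 B in \<open>auto simp: entry_simps\<close>)
    then show ?thesis by (rule two_row_realization[where k = 1]) (use n B in \<open>auto simp: entry_simps\<close>)
  next
    case (3 z)
    have "realizes G n B (B # 1 # 1 # replicate z 3)"
      by (rule realizes_selfI) (use G n 3 B in \<open>auto simp: entry_simps\<close>)
    then show ?thesis by (rule two_hook_realization) (use n B' in \<open>auto simp: entry_simps\<close>)
  qed
qed

text \<open>In the three infinite families there is one fixed point, so the shape (n - 1, 1)
  applies, and the number of even cycles is even. Six small values of \<open>r\<close> have lists of
  their own.\<close>

lemma vanishing_order_mixed: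
  assumes G: "sym_or_alt n G" and n: "5 \<le> n" "n \<noteq> 7" "n = A + B + r" and A: "A = 2 \<or> 4 \<le> A \<and> 4 dvd A"
    and B: "B = 3 \<or> 9 \<le> B" "3 dvd B" "odd B" and AB: "coprime A B" and r: "G = alt_group n \<Longrightarrow> 2 \<le> r"
  shows "\<exists>g. vanishing G g \<and> group.ord G g = A * B"
proof -
  have A': "2 \<le> A" "even A" using A by (auto dest: dvd_trans[of 2 4 A])
  have B': "3 \<le> B" "\<not> B dvd 2" using B(1) by (auto dest: dvd_imp_le)
  have d: "3 dvd A * B" "6 dvd A * B" using B(2) mult_dvd_mono[OF A'(2) B(2)] by simp_all
  note I = realizes_coprimeI[OF G _ _ _ AB]
  have "r = 0 \<or> r = 1 \<or> r = 2 \<or> r = 4 \<or> r = 5 \<or> r = 8 \<or> (\<exists>z. r = 3 + 3 * z) \<or> (\<exists>z. r = 7 + 3 * z) \<or> (\<exists>z. r = 11 + 3 * z)"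
    by presburger
  then consider "r \<in> {0, 1, 2, 4, 5, 8}" | z where "r = 3 + 3 * z" | z where "r = 7 + 3 * z" | z where "r = 11 + 3 * z" by blast
  then show ?thesis
  proof cases
    case 1
    show ?thesis
      using A
    proof
      assume A: "A = 2"
      \<comment> \<open>For \<open>r = 2\<close> and \<open>B = 3\<close> the degree would be
        7.\<close>
      consider "r = 0" | "r = 1" | "r = 2" "9 \<le> B" | "r = 4" "B = 3" | "r = 4" "9 \<le> B" | "r = 5" "B = 3" | "r = 5" "9 \<le> B" | "r = 8"
        using 1 B(1) n(2,3) A by fastforce
      then show ?thesis
      proof cases
        case 1
        have "realizes G n (A * B) [A, B]" by (rule I) (use n r 1 A B' in auto)
        then show ?thesis by (rule two_hook_realization) (use n A B' in auto)
      next
        case 2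
        have "realizes G n (A * B) [A, B, 1]" by (rule I) (use n r 2 A B' in auto)
        then show ?thesis by (rule two_row_realization[where k = 1]) (use n A B' in auto)
      next
        case 3
        \<comment> \<open>The cycles 2, 2 cover only 4 points and \<open>B\<close> is at least 9, so
          there are no invariant sets of 5 or 6 points.\<close>
        have "realizes G n (A * B) [B, 2, 2]" by (rule I) (use n B(3) 3 A B' in auto)
        then show ?thesis by (rule two_row_realization[where k = 6]) (use n A 3 in auto)
      next
        case 4
        have "realizes G n (A * B) [6, 2, 1]" by (rule realizes_selfI) (use G n 4 A in auto)
        then show ?thesis by (rule two_row_realization[where k = 1]) (use n in auto)
      next
        case 5
        \<comment> \<open>The column of the hook has 7 boxes: more than the total 6 of the short
          cycles and fewer than \<open>B\<close>.\<close>
        have "realizes G n (A * B) [B, 2, 2, 1, 1]" by (rule I) (use n B(3) 5 A B' in auto)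
        then show ?thesis by (rule hook_realization[where k = 6]) (use n A 5 in auto)
      next
        case 6
        \<comment> \<open>The entries 2, 1, 1 give two invariant sets of one point and two of two
          points.\<close>
        have "realizes G n (A * B) [6, 2, 1, 1]" by (rule realizes_selfI) (use G n 6 A in auto)
        then show ?thesis by (rule two_row_realization[where k = 2]) (use n in auto)
      next
        case 7
        \<comment> \<open>Four points arise only as 2 + 2 and three only as 3, once each.\<close>
        have "realizes G n (A * B) [B, 2, 2, 3]" by (rule I) (use n B(3) 7 A B' d in auto)
        then show ?thesis by (rule two_row_realization[where k = 4]) (use n A 7 in auto)
      next
        case 8
        have "realizes G n (A * B) [B, 2, 6, 1, 1]" by (rule I) (use n B(3) 8 A B' d in auto)
        then show ?thesis by (rule two_row_realization[where k = 2]) (use n A B' in auto)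
      qed
    next
      assume A: "4 \<le> A \<and> 4 dvd A"
      then have A4: "4 \<le> A" "4 dvd A * B" "\<not> A dvd 2" by (auto dest: dvd_imp_le)
      consider "r = 0" | "r = 1" | "r = 2" | "r = 4" | "r = 5" | "r = 8" using 1 by blast
      then show ?thesis
      proof cases
        case 1
        have "realizes G n (A * B) [A, B]" by (rule I) (use n r 1 A4 B' in auto)
        then show ?thesis by (rule two_row_realization[where k = 2]) (use n A4 B' in auto)
      next
        case 2
        have "realizes G n (A * B) [A, B, 1]" by (rule I) (use n r 2 A4 B' in auto)
        then show ?thesis by (rule two_row_realization[where k = 1]) (use n A4 B' in auto)
      next
        case 3
        have "realizes G n (A * B) [A, B, 2]" by (rule I) (use n B(3) 3 A' A4 B' in auto)
        then show ?thesis by (rule two_hook_realization) (use n A4 B' in auto)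
      next
        case 4
        have "realizes G n (A * B) [A, B, 2, 1, 1]" by (rule I) (use n B(3) 4 A' A4 B' in auto)
        then show ?thesis by (rule two_row_realization[where k = 2]) (use n A4 B' in auto)
      next
        case 5
        have "realizes G n (A * B) [A, B, 4, 1]" by (rule I) (use n B(3) 5 A' A4 B' in auto)
        then show ?thesis by (rule two_row_realization[where k = 1]) (use n A4 B' in auto)
      next
        case 6
        have "realizes G n (A * B) [A, B, 4, 3, 1]" by (rule I) (use n B(3) 6 A' A4 B' d in auto)
        then show ?thesis by (rule two_row_realization[where k = 1]) (use n A4 B' in auto)
      qed
    qed
  next
    case (2 z)
    have "realizes G n (A * B) (A # B # 1 # 2 # replicate z 3)"
      by (rule I) (use n B(3) 2 A' B' d in \<open>auto simp: entry_simps\<close>)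
    then show ?thesis by (rule two_row_realization[where k = 1]) (use n A' B' in \<open>auto simp: entry_simps\<close>)
  next
    case (3 z)
    have "realizes G n (A * B) (A # B # 6 # 1 # replicate z 3)"
      by (rule I) (use n B(3) 3 A' B' d in \<open>auto simp: entry_simps\<close>)
    then show ?thesis by (rule two_row_realization[where k = 1]) (use n A' B' in \<open>auto simp: entry_simps\<close>)
  next
    case (4 z)
    have "realizes G n (A * B) (A # B # 1 # 2 # 2 # 2 # 2 # 2 # replicate z 3)"
      by (rule I) (use n B(3) 4 A' B' d in \<open>auto simp: entry_simps\<close>)
    then show ?thesis by (rule two_row_realization[where k = 1]) (use n A' B' in \<open>auto simp: entry_simps\<close>)
  qed
qed

theorem theorem1p8:
  fixes n m :: nat and G :: "(nat \<Rightarrow> nat) monoid"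
  assumes "G = sym_group n \<or> G = alt_group n"
    and "n \<ge> 5" and "n \<noteq> 7" and "n \<noteq> 11"
    and "m \<in> element_orders_23 G" and "m \<noteq> 1"
  shows "\<exists>g. vanishing G g \<and> group.ord G g = m"
proof -
  have G: "sym_or_alt n G" using assms(1) unfolding sym_or_alt_def .
  interpret group G by (rule sym_or_alt_group[OF G])
  have m: "m \<in> element_orders G" "\<And>p::nat. Factorial_Ring.prime p \<Longrightarrow> p > 3 \<Longrightarrow> \<not> p dvd m"
    using assms(5) unfolding element_orders_23_def by auto
  have "0 < m" using m(1) ord_ge_1[OF sym_or_alt_finite[OF G]] unfolding element_orders_def by fastforce
  then obtain a b where ab: "m = 2 ^ a * 3 ^ b" using two_three_smooth[OF _ m(2)] by blast
  note bounds = degree_bounds[OF G m(1)[unfolded ab]]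
  have A: "(2::nat) ^ a = 2 \<or> 4 \<le> (2::nat) ^ a \<and> 4 dvd (2::nat) ^ a" if "1 \<le> a"
  proof (cases "a = 1")
    case False
    then have "2 \<le> a" using that by simp
    then have "(2::nat) ^ 2 dvd 2 ^ a" by (rule le_imp_power_dvd)
    then show ?thesis using dvd_imp_le[of 4 "(2::nat) ^ a"] by simp
  qed simp
  have B: "(3::nat) ^ b = 3 \<or> 9 \<le> (3::nat) ^ b" "3 dvd (3::nat) ^ b" "odd ((3::nat) ^ b)" if "1 \<le> b"
  proof -
    show "(3::nat) ^ b = 3 \<or> 9 \<le> (3::nat) ^ b"
    proof (cases "b = 1")
      case False
      then have "(3::nat) ^ 2 \<le> 3 ^ b" using that by (intro power_increasing) auto
      then show ?thesis by simp
    qed simp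
  qed (use that in simp_all)
  consider "a = 0" "b = 0" | "a = 0" "1 \<le> b" | "1 \<le> a" "b = 0" | "1 \<le> a" "1 \<le> b" by linarith
  then show ?thesis
  proof cases
    case 1
    then show ?thesis using ab assms(6) by simp
  next
    case 2
    obtain r where "n = 3 ^ b + r" using bounds(2)[OF 2] le_Suc_ex by blast
    then show ?thesis
      using vanishing_order_power_of_three[OF G assms(2), of "3 ^ b" r] B[OF 2(2)] 2(1) ab by auto
  next
    case 3
    obtain r where r: "n = 2 ^ a + r" using bounds(1)[OF 3] le_Suc_ex by blast
    have "G = alt_group n \<Longrightarrow> 2 \<le> r" using bounds(1)[OF 3] r by auto
    then show ?thesis
      using vanishing_order_power_of_two[OF G assms(2) r] vanishing_order_two[OF G assms(2,3,4)] A[OF 3(1)] 3(2) ab by auto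
  next
    case 4
    obtain r where r: "n = 2 ^ a + 3 ^ b + r" using bounds(3)[OF 4] le_Suc_ex by blast
    have "G = alt_group n \<Longrightarrow> 2 \<le> r" using bounds(3)[OF 4] r by auto
    moreover have "coprime ((2::nat) ^ a) (3 ^ b)" by (simp add: coprime_left_2_iff_odd)
    ultimately show ?thesis
      using vanishing_order_mixed[OF G assms(2,3) r A[OF 4(1)] B[OF 4(2)]] unfolding ab by blast
  qed
qed

end
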